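(* Let $P$ and $Q$ be finite essential stochastic matrices, with irreducible block-diagonal decompositions $P(1)\oplus\cdots\oplus P(\ell)$ and $Q(1)\oplus\cdots\oplus Q(s)$, where $P(k)\in M_{d_k}(\mathbb{C})$ and $Q(k')\in M_{t_{k'}}(\mathbb{C})$ are irreducible stochastic matrices, ordered so that $d_1\le\cdots\le d_\ell$ and $t_1\le\cdots\le t_s$. Then $\mathcal{O}(P)\cong\mathcal{O}(Q)$ if and only if $\ell=s$ and $d_k=t_k$ for all $1\le k\le\ell$.
   Context: A stochastic matrix over a finite set $\Omega$ is $P:\Omega\times\Omega\to[0,\infty)$ with row sums $1$; $P^{(n)}_{ij}$ is the $(i,j)$ entry of $P^n$. $P$ is irreducible if every pair of states communicates (there are directed paths both ways in the graph with edges $\{(a,b):P_{ab}>0\}$), essential if no state $i$ has some $j,n\ge1$ with $P^{(n)}_{ij}>0$ but $P^{(m)}_{ji}=0$ for all $m\ge1$; an essential matrix is, after reordering, block diagonal with irreducible stochastic blocks. $Arv(P)$: $Arv(P)_0=\ell^\infty(\Omega)$; $Arv(P)_n$ ($n\ge1$) is the set of complex $\Omega\times\Omega$ matrices $A$ with $A_{ij}=0$ whenever $P^{(n)}_{ij}=0$, with actions by diagonal matrices and inner product $\mathrm{Diag}(A^*B)$; $U_{n,m}(A\otimes B)=(\sqrt{P^{n+m}})^{\flat}*[(\sqrt{P^n}*A)(\sqrt{P^m}*B)]$ for $n,m\ge1$ ($*$ entrywise product, $\sqrt\cdot$ entrywise, $M^\flat_{ik}=M_{ik}^{-1}$ if $M_{ik}>0$,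 else $0$), $U_{0,n},U_{n,0}$ module actions. $\mathcal{F}=\bigoplus_{n\ge0}Arv(P)_n$, shifts $S^{(n)}_A(B)=U_{n,m}(A\otimes B)$, $Q_n$ the projection onto $Arv(P)_n$; $\mathcal{T}(P)$ is the C*-algebra generated by $\ell^\infty(\Omega)$ and the shifts in $\mathcal{L}(\mathcal{F})$; $\mathcal{O}(P)=\mathcal{T}(P)/\{T\in\mathcal{T}(P):\lim_n\|TQ_n\|=0\}$ (Viselter's Cuntz–Pimsner algebra). *)

theory Defs
  imports Complex_Main
begin

type_synonym 'a cmat = "'a \<Rightarrow> 'a \<Rightarrow> complex"
type_synonym 'a fock = "nat \<Rightarrow> 'a cmat"
type_synonym 'a fop = "'a fock \<Rightarrow> 'a fock"

definition fzero :: "'a fock" where "fzero = (\<lambda>n i k. 0)"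

fun matpow :: "('a::finite \<Rightarrow> 'a \<Rightarrow> real) \<Rightarrow> nat \<Rightarrow> 'a \<Rightarrow> 'a \<Rightarrow> real" where
  "matpow P 0 = (\<lambda>i j. if i = j then 1 else 0)"
| "matpow P (Suc n) = (\<lambda>i j. \<Sum>k\<in>UNIV. matpow P n i k * P k j)"

definition stochastic :: "('a::finite \<Rightarrow> 'a \<Rightarrow> real) \<Rightarrow> bool" where
  "stochastic P \<longleftrightarrow> (\<forall>i j. 0 \<le> P i j) \<and> (\<forall>i. (\<Sum>j\<in>UNIV. P i j) = 1)"

definition essential :: "('a::finite \<Rightarrow> 'a \<Rightarrow> real) \<Rightarrow> bool" where
  "essential P \<longleftrightarrow> \<not> (\<exists>i j n. n \<ge> 1 \<and> matpow P n i j > 0 \<and>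
                           (\<forall>m\<ge>1. matpow P m j i = 0))"

text \<open>The principal submatrix of P on the block B is irreducible (every pair of
  states of B communicates in the graph of that submatrix).  The block matrix is
  represented through P; paths in the graph of the submatrix are paths of P inside B.\<close>
definition path_in :: "('a::finite \<Rightarrow> 'a \<Rightarrow> real) \<Rightarrow> 'a set \<Rightarrow> 'a \<Rightarrow> 'a \<Rightarrow> bool" where
  "path_in P B i j \<longleftrightarrow> (\<exists>xs. xs \<noteq> [] \<and> hd xs = i \<and> last xs = j \<and> set xs \<subseteq> B \<and>
       (\<forall>k < length xs - 1. P (xs ! k) (xs ! Suc k) > 0))"

definition irreducible_block :: "('a::finite \<Rightarrow> 'a \<Rightarrow> real) \<Rightarrow> 'a set \<Rightarrow> bool" where
  "irreducible_block P B \<longleftrightarrow> (\<forall>i\<in>B. \<forall>j\<in>B. path_in P B i j \<and> path_in P B j i)"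

definition irred_block_decomp :: "('a::finite \<Rightarrow> 'a \<Rightarrow> real) \<Rightarrow> 'a set list \<Rightarrow> bool" where
  "irred_block_decomp P Bs \<longleftrightarrow>
     (\<forall>B\<in>set Bs. B \<noteq> {}) \<and>
     (\<forall>k<length Bs. \<forall>k'<length Bs. k \<noteq> k' \<longrightarrow> Bs ! k \<inter> Bs ! k' = {}) \<and>
     \<Union>(set Bs) = UNIV \<and>
     (\<forall>i j. P i j \<noteq> 0 \<longrightarrow> (\<exists>B\<in>set Bs. i \<in> B \<and> j \<in> B)) \<and>
     (\<forall>B\<in>set Bs. irreducible_block P B) \<and>
     sorted (map card Bs)"

text \<open>Arv(P)_n.  For n = 0 this is the set of diagonal matrices, identified with
  \<ell>^\<infinity>(\<Omega>) (P^0 = I).\<close>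
definition arv :: "('a::finite \<Rightarrow> 'a \<Rightarrow> real) \<Rightarrow> nat \<Rightarrow> 'a cmat set" where
  "arv P n = {A. \<forall>i j. matpow P n i j = 0 \<longrightarrow> A i j = 0}"

definition minner :: "'a::finite cmat \<Rightarrow> 'a cmat \<Rightarrow> 'a \<Rightarrow> complex" where
  "minner A B k = (\<Sum>i\<in>UNIV. cnj (A i k) * B i k)"

definition flat :: "('a \<Rightarrow> 'a \<Rightarrow> real) \<Rightarrow> 'a \<Rightarrow> 'a \<Rightarrow> real" where
  "flat M i k = (if M i k > 0 then inverse (M i k) else 0)"

text \<open>U_{n,m}(A \<otimes> B).  For n = 0 or m = 0 this formula reduces to the module
  actions on elements of arv P n, since P^0 = I.\<close>
definition Umul :: "('a::finite \<Rightarrow> 'a \<Rightarrow> real) \<Rightarrow> nat \<Rightarrow> nat \<Rightarrow> 'a cmat \<Rightarrow> 'a cmat \<Rightarrow> 'a cmat" where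
  "Umul P n m A B = (\<lambda>i k. complex_of_real (flat (\<lambda>a b. sqrt (matpow P (n+m) a b)) i k) *
      (\<Sum>j\<in>UNIV. (complex_of_real (sqrt (matpow P n i j)) * A i j) *
                  (complex_of_real (sqrt (matpow P m j k)) * B j k)))"

definition fock :: "('a::finite \<Rightarrow> 'a \<Rightarrow> real) \<Rightarrow> 'a fock set" where
  "fock P = {x. (\<forall>n. x n \<in> arv P n) \<and>
                (\<forall>k. summable (\<lambda>n. Re (minner (x n) (x n) k)))}"

definition finner :: "'a::finite fock \<Rightarrow> 'a fock \<Rightarrow> 'a \<Rightarrow> complex" where
  "finner x y k = (\<Sum>n. minner (x n) (y n) k)"

definition fnorm :: "'a::finite fock \<Rightarrow> real" where
  "fnorm x = sqrt (Max (range (\<lambda>k. cmod (finner x x k))))"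

text \<open>Operators are represented as maps on the whole type, normalised to 0 outside F.\<close>
definition is_adjoint :: "('a::finite \<Rightarrow> 'a \<Rightarrow> real) \<Rightarrow> 'a fop \<Rightarrow> 'a fop \<Rightarrow> bool" where
  "is_adjoint P T S \<longleftrightarrow> (\<forall>x\<in>fock P. S x \<in> fock P) \<and> (\<forall>x. x \<notin> fock P \<longrightarrow> S x = fzero) \<and>
     (\<forall>x\<in>fock P. \<forall>y\<in>fock P. finner (T x) y = finner x (S y))"

definition Lops :: "('a::finite \<Rightarrow> 'a \<Rightarrow> real) \<Rightarrow> 'a fop set" where
  "Lops P = {T. (\<forall>x\<in>fock P. T x \<in> fock P) \<and> (\<forall>x. x \<notin> fock P \<longrightarrow> T x = fzero) \<and>
                (\<exists>S. is_adjoint P T S)}"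

definition adj :: "('a::finite \<Rightarrow> 'a \<Rightarrow> real) \<Rightarrow> 'a fop \<Rightarrow> 'a fop" where
  "adj P T = (SOME S. is_adjoint P T S)"

definition opnorm :: "('a::finite \<Rightarrow> 'a \<Rightarrow> real) \<Rightarrow> 'a fop \<Rightarrow> real" where
  "opnorm P T = Sup {fnorm (T x) | x. x \<in> fock P \<and> fnorm x \<le> 1}"

definition op_add :: "'a fop \<Rightarrow> 'a fop \<Rightarrow> 'a fop" where
  "op_add T S = (\<lambda>x n i k. T x n i k + S x n i k)"

definition op_diff :: "'a fop \<Rightarrow> 'a fop \<Rightarrow> 'a fop" where
  "op_diff T S = (\<lambda>x n i k. T x n i k - S x n i k)"

definition op_scale :: "complex \<Rightarrow> 'a fop \<Rightarrow> 'a fop" where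
  "op_scale c T = (\<lambda>x n i k. c * T x n i k)"

definition lact :: "('a::finite \<Rightarrow> 'a \<Rightarrow> real) \<Rightarrow> ('a \<Rightarrow> complex) \<Rightarrow> 'a fop" where
  "lact P f = (\<lambda>x. if x \<in> fock P then (\<lambda>n i k. f i * x n i k) else fzero)"

definition shift :: "('a::finite \<Rightarrow> 'a \<Rightarrow> real) \<Rightarrow> nat \<Rightarrow> 'a cmat \<Rightarrow> 'a fop" where
  "shift P n A = (\<lambda>x. if x \<in> fock P
       then (\<lambda>m. if m < n then (\<lambda>i k. 0) else Umul P n (m - n) A (x (m - n))) else fzero)"

definition proj :: "('a::finite \<Rightarrow> 'a \<Rightarrow> real) \<Rightarrow> nat \<Rightarrow> 'a fop" where
  "proj P n = (\<lambda>x. if x \<in> fock P then (\<lambda>m. if m = n then x m else (\<lambda>i k. 0)) else fzero)"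

definition cstar_closed :: "('a::finite \<Rightarrow> 'a \<Rightarrow> real) \<Rightarrow> 'a fop set \<Rightarrow> bool" where
  "cstar_closed P S \<longleftrightarrow> S \<subseteq> Lops P \<and>
     (\<forall>T\<in>S. \<forall>T'\<in>S. op_add T T' \<in> S \<and> T \<circ> T' \<in> S) \<and>
     (\<forall>T\<in>S. \<forall>c. op_scale c T \<in> S) \<and>
     (\<forall>T\<in>S. adj P T \<in> S) \<and>
     (\<forall>X T. (\<forall>k. X k \<in> S) \<and> T \<in> Lops P \<and>
            (\<lambda>k. opnorm P (op_diff (X k) T)) \<longlonglongrightarrow> 0 \<longrightarrow> T \<in> S)"

definition toeplitz :: "('a::finite \<Rightarrow> 'a \<Rightarrow> real) \<Rightarrow> 'a fop set" where
  "toeplitz P = \<Inter> {S. cstar_closed P S \<and> range (lact P) \<subseteq> S \<and>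
        (\<forall>n\<ge>1. \<forall>A\<in>arv P n. shift P n A \<in> S)}"

definition cp_ideal :: "('a::finite \<Rightarrow> 'a \<Rightarrow> real) \<Rightarrow> 'a fop set" where
  "cp_ideal P = {T\<in>toeplitz P. (\<lambda>n. opnorm P (T \<circ> proj P n)) \<longlonglongrightarrow> 0}"

definition coset :: "('a::finite \<Rightarrow> 'a \<Rightarrow> real) \<Rightarrow> 'a fop \<Rightarrow> 'a fop set" where
  "coset P T = {S\<in>toeplitz P. op_diff S T \<in> cp_ideal P}"

definition cp_alg :: "('a::finite \<Rightarrow> 'a \<Rightarrow> real) \<Rightarrow> 'a fop set set" where
  "cp_alg P = coset P ` toeplitz P"

text \<open>*-isomorphism of the quotient C*-algebras: a bijection of cosets compatible
  with the quotient operations (sum, scalar multiple, product, adjoint), which are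
  computed on arbitrary representatives.\<close>
definition cp_isomorphic ::
  "('a::finite \<Rightarrow> 'a \<Rightarrow> real) \<Rightarrow> ('b::finite \<Rightarrow> 'b \<Rightarrow> real) \<Rightarrow> bool" where
  "cp_isomorphic P Q \<longleftrightarrow> (\<exists>\<Phi>. bij_betw \<Phi> (cp_alg P) (cp_alg Q) \<and>
     (\<forall>a\<in>toeplitz P. \<forall>b\<in>toeplitz P. \<forall>x\<in>\<Phi> (coset P a). \<forall>y\<in>\<Phi> (coset P b). \<forall>c.
        \<Phi> (coset P (op_add a b)) = coset Q (op_add x y) \<and>
        \<Phi> (coset P (op_scale c a)) = coset Q (op_scale c x) \<and>
        \<Phi> (coset P (a \<circ> b)) = coset Q (x \<circ> y) \<and>
        \<Phi> (coset P (adj P a)) = coset Q (adj Q x)))"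

end

(* On column k the Fock module is a weighted l2 space on which, by convergence of P^m, the shifts
   are asymptotically Laurent operators: after passing to coordinates that remove the period,
   every element T of the Toeplitz algebra is approximated far out by Laurent operators over the
   blocks, so it has a continuous matrix symbol on the unit circle.  The symbol is a
   *-homomorphism whose kernel is the ideal {lim ||T Q_n|| = 0} (Parseval) and whose range is the
   uniform closure of the Laurent-polynomial block matrices, so that O(P) is the direct sum of the
   algebras M_d(C(circle)) over the blocks.  The block sizes are recovered from such a sum: the
   images of the diagonal matrix units are projections, the squared Frobenius norm of a projection
   on a block is 0 or at least 1, hence by connectedness of the circle it never vanishes or always
   does; each block of Q meets the projections of a single block of P, and summing traces compares
   the sizes. *)

theory Submission
  imports Defs "HOL-Analysis.Analysis"
begin

section \<open>Square-summable families\<close>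

text \<open>A limit exists for the following reason. The square of a shift coefficient is
  \<open>matpow P n i j * matpow P (N - n) j k / matpow P N i k\<close>, the law at time n of the
  chain from i conditioned to be at k at time N. For large N the two factors that involve k cancel
  along each phase class, so the coefficient tends to the square root of
  \<open>matpow P n i j\<close> and forgets the column; hence one symbol serves all columns. The
  obstacle is that Laurent operators do not act on the Fock module, which stops at degree 0 and has
  gaps in low degrees. Every comparison is therefore made on vectors supported in high degrees,
  where the coordinates \<open>J\<close> reach all square-summable sequences, and the constants in
  the estimates may be crude because only convergence to 0 matters. One power of the circle variable
  stands for \<open>r i\<close> steps of the chain, so periods and transition probabilities leave no
  trace in the algebra and only the partition into blocks survives. Symbols are 0 off the circle and
  between blocks, so that equality of symbols is equality of functions.\<close>

definition l2 :: "('i \<Rightarrow> complex) \<Rightarrow> bool" where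
  "l2 y \<longleftrightarrow> (\<lambda>a. (cmod (y a))\<^sup>2) summable_on UNIV"

definition nrm :: "('i \<Rightarrow> complex) \<Rightarrow> real" where
  "nrm y = sqrt (infsum (\<lambda>a. (cmod (y a))\<^sup>2) UNIV)"

definition ip :: "('i \<Rightarrow> complex) \<Rightarrow> ('i \<Rightarrow> complex) \<Rightarrow> complex" where
  "ip x y = infsum (\<lambda>a. cnj (x a) * y a) UNIV"

lemma nrm_nonneg [simp]: "0 \<le> nrm y"
  unfolding nrm_def by (simp add: infsum_nonneg)

lemma nrm_sq: "(nrm y)\<^sup>2 = infsum (\<lambda>a. (cmod (y a))\<^sup>2) UNIV"
  unfolding nrm_def by (simp add: infsum_nonneg)

lemma l2I_nrm:
  assumes "0 \<le> C" "\<And>A. finite A \<Longrightarrow> L2_set (\<lambda>a. cmod (y a)) A \<le> C"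
  shows "l2 y" "nrm y \<le> C"
proof -
  have b: "(\<Sum>a\<in>A. (cmod (y a))\<^sup>2) \<le> C\<^sup>2" if "finite A" for A
  proof -
    have "sqrt (\<Sum>a\<in>A. (cmod (y a))\<^sup>2) \<le> C" using assms(2)[OF that] by (simp add: L2_set_def)
    thus ?thesis using assms(1) by (simp add: real_sqrt_le_iff sqrt_le_D)
  qed
  show l: "l2 y" unfolding l2_def
    by (rule nonneg_bdd_above_summable_on) (auto intro!: bdd_aboveI[of _ "C\<^sup>2"] b)
  have "infsum (\<lambda>a. (cmod (y a))\<^sup>2) UNIV \<le> C\<^sup>2"
    by (rule infsum_le_finite_sums) (use l b in \<open>auto simp: l2_def\<close>)
  thus "nrm y \<le> C" unfolding nrm_def using assms(1) by (simp add: real_le_lsqrt)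
qed

lemma L2_set_le_nrm: "l2 y \<Longrightarrow> finite A \<Longrightarrow> L2_set (\<lambda>a. cmod (y a)) A \<le> nrm y"
  unfolding l2_def L2_set_def nrm_def
  by (simp add: finite_sum_le_infsum)

lemma sum_sq_le_nrm: "l2 y \<Longrightarrow> finite A \<Longrightarrow> (\<Sum>a\<in>A. (cmod (y a))\<^sup>2) \<le> (nrm y)\<^sup>2"
  unfolding nrm_sq l2_def by (simp add: finite_sum_le_infsum)

lemma cmod_le_nrm: "l2 y \<Longrightarrow> cmod (y a) \<le> nrm y"
  using L2_set_le_nrm[of y "{a}"] by simp

lemma nrm_zero [simp]: "l2 (\<lambda>a. 0)" "nrm (\<lambda>a. 0) = 0"
  by (simp_all add: l2_def nrm_def)

lemma l2_add:
  assumes "l2 x" "l2 y"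
  shows "l2 (\<lambda>a. x a + y a)" "nrm (\<lambda>a. x a + y a) \<le> nrm x + nrm y"
proof -
  have *: "L2_set (\<lambda>a. cmod (x a + y a)) A \<le> nrm x + nrm y" if A: "finite A" for A
  proof -
    have "L2_set (\<lambda>a. cmod (x a + y a)) A \<le> L2_set (\<lambda>a. cmod (x a) + cmod (y a)) A"
      by (intro L2_set_mono) (auto simp: norm_triangle_ineq)
    also have "\<dots> \<le> L2_set (\<lambda>a. cmod (x a)) A + L2_set (\<lambda>a. cmod (y a)) A"
      by (rule L2_set_triangle_ineq)
    also have "\<dots> \<le> nrm x + nrm y" using L2_set_le_nrm assms A by (intro add_mono) auto
    finally show ?thesis .
  qed
  show "l2 (\<lambda>a. x a + y a)" "nrm (\<lambda>a. x a + y a) \<le> nrm x + nrm y"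
    using l2I_nrm[OF _ *] by auto
qed

lemma nrm_scale [simp]: "nrm (\<lambda>a. c * y a) = cmod c * nrm y"
  unfolding nrm_def by (simp add: norm_mult power_mult_distrib infsum_cmult_right' real_sqrt_mult)

lemma l2_scale [simp]: "l2 y \<Longrightarrow> l2 (\<lambda>a. c * y a)"
  unfolding l2_def by (simp add: norm_mult power_mult_distrib summable_on_cmult_right)

lemma nrm_uminus [simp]: "nrm (\<lambda>a. - y a) = nrm y"
  using nrm_scale[of "-1" y] by simp

lemma l2_uminus [simp]: "l2 y \<Longrightarrow> l2 (\<lambda>a. - y a)"
  using l2_scale[of y "-1"] by simp

lemma l2_diff:
  assumes "l2 x" "l2 y"
  shows "l2 (\<lambda>a. x a - y a)" "nrm (\<lambda>a. x a - y a) \<le> nrm x + nrm y"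
  using l2_add[OF assms(1) l2_uminus[OF assms(2)]] by auto

text \<open>Moving coordinates injectively and weighting them by factors of modulus at most
  \<open>C\<close> costs a factor \<open>C\<close> in norm. Matrix units, their distance from
  Laurent units and both halves of the isometry \<open>J_nrm\<close> are treated this way.\<close>

lemma l2_dom:
  assumes x: "l2 x" and C: "0 \<le> C" and inj: "inj_on g Z"
    and le: "\<And>b. b \<in> Z \<Longrightarrow> cmod (y b) \<le> C * cmod (x (g b))"
    and z: "\<And>b. b \<notin> Z \<Longrightarrow> y b = 0"
  shows "l2 y" "nrm y \<le> C * nrm x"
proof -
  have *: "L2_set (\<lambda>a. cmod (y a)) A \<le> C * nrm x" if A: "finite A" for A
  proof -
    have "L2_set (\<lambda>a. cmod (y a)) A = L2_set (\<lambda>a. cmod (y a)) (A \<inter> Z)"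
      unfolding L2_set_def using A z by (intro arg_cong[where f=sqrt] sum.mono_neutral_right) auto
    also have "\<dots> \<le> L2_set (\<lambda>a. C * cmod (x (g a))) (A \<inter> Z)"
      by (intro L2_set_mono) (auto intro: le)
    also have "\<dots> = C * L2_set (\<lambda>a. cmod (x (g a))) (A \<inter> Z)"
      using C by (simp add: L2_set_right_distrib)
    also have "L2_set (\<lambda>a. cmod (x (g a))) (A \<inter> Z) = L2_set (\<lambda>a. cmod (x a)) (g ` (A \<inter> Z))"
      unfolding L2_set_def using inj
      by (subst sum.reindex) (auto intro: inj_on_subset)
    also have "\<dots> \<le> nrm x" using L2_set_le_nrm[OF x] A by simp
    finally show ?thesis using C by (simp add: mult_left_mono)
  qed
  show "l2 y" "nrm y \<le> C * nrm x" using l2I_nrm[OF _ *] C by auto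
qed

lemma l2_mono:
  assumes "l2 x" "\<And>b. cmod (y b) \<le> cmod (x b)"
  shows "l2 y" "nrm y \<le> nrm x"
  using l2_dom[OF assms(1), of 1 id UNIV y] assms(2) by auto

text \<open>Only coordinatewise convergence is assumed, so limits can be formed entry by entry and
  their norms controlled afterwards.\<close>

lemma l2_fatou:
  assumes "\<And>s. s \<ge> t \<Longrightarrow> l2 (Y s)" "\<And>s. s \<ge> t \<Longrightarrow> nrm (Y s) \<le> C"
    and lim: "\<And>a. (\<lambda>s::nat. Y s a) \<longlonglongrightarrow> y a"
  shows "l2 y" "nrm y \<le> C"
proof -
  have C: "0 \<le> C" using assms(2)[of t] nrm_nonneg[of "Y t"] by linarith
  have *: "L2_set (\<lambda>a. cmod (y a)) A \<le> C" if A: "finite A" for A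
  proof (rule LIMSEQ_le_const2)
    show "(\<lambda>s. L2_set (\<lambda>a. cmod (Y s a)) A) \<longlonglongrightarrow> L2_set (\<lambda>a. cmod (y a)) A"
      unfolding L2_set_def by (intro tendsto_intros lim)
    show "\<exists>N. \<forall>n\<ge>N. L2_set (\<lambda>a. cmod (Y n a)) A \<le> C"
      using L2_set_le_nrm[OF assms(1) A] assms(2) by (intro exI[of _ t]) (auto intro: order_trans)
  qed
  show "l2 y" "nrm y \<le> C" using l2I_nrm[OF C *] by auto
qed

lemma ip_abs_summable:
  assumes "l2 x" "l2 y"
  shows "(\<lambda>a. norm (cnj (x a) * y a)) summable_on UNIV"
    "(\<Sum>\<^sub>\<infinity>a. norm (cnj (x a) * y a)) \<le> nrm x * nrm y"
proof -
  have b: "(\<Sum>a\<in>A. norm (cnj (x a) * y a)) \<le> nrm x * nrm y" if "finite A" for A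
  proof -
    have "(\<Sum>a\<in>A. norm (cnj (x a) * y a)) = (\<Sum>a\<in>A. \<bar>cmod (x a)\<bar> * \<bar>cmod (y a)\<bar>)"
      by (simp add: norm_mult)
    also have "\<dots> \<le> L2_set (\<lambda>a. cmod (x a)) A * L2_set (\<lambda>a. cmod (y a)) A"
      by (rule L2_set_mult_ineq)
    also have "\<dots> \<le> nrm x * nrm y"
      using L2_set_le_nrm assms that by (intro mult_mono) auto
    finally show ?thesis .
  qed
  show s: "(\<lambda>a. norm (cnj (x a) * y a)) summable_on UNIV"
    by (rule nonneg_bdd_above_summable_on) (auto intro!: bdd_aboveI[of _ "nrm x * nrm y"] b)
  show "(\<Sum>\<^sub>\<infinity>a. norm (cnj (x a) * y a)) \<le> nrm x * nrm y"
    by (rule infsum_le_finite_sums) (use s b in auto)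
qed

lemma ip_summable: "l2 x \<Longrightarrow> l2 y \<Longrightarrow> (\<lambda>a. cnj (x a) * y a) summable_on UNIV"
  by (rule abs_summable_summable[OF ip_abs_summable(1)])

lemma ip_bound: "l2 x \<Longrightarrow> l2 y \<Longrightarrow> cmod (ip x y) \<le> nrm x * nrm y"
  unfolding ip_def
  by (rule order_trans[OF norm_infsum_bound[OF ip_abs_summable(1)] ip_abs_summable(2)])

lemma ip_self: "l2 x \<Longrightarrow> ip x x = of_real ((nrm x)\<^sup>2)"
proof -
  assume "l2 x"
  have "ip x x = (\<Sum>\<^sub>\<infinity>a. of_real ((cmod (x a))\<^sup>2))"
    unfolding ip_def by (intro infsum_cong) (metis complex_norm_square mult.commute)
  also have "\<dots> = of_real (\<Sum>\<^sub>\<infinity>a. (cmod (x a))\<^sup>2)"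
    using \<open>l2 x\<close> by (intro infsumI has_sum_of_real) (simp add: l2_def)
  finally show ?thesis by (simp add: nrm_sq)
qed

lemma ip_add_right: "l2 x \<Longrightarrow> l2 y \<Longrightarrow> l2 z \<Longrightarrow> ip x (\<lambda>a. y a + z a) = ip x y + ip x z"
  unfolding ip_def by (simp add: distrib_left infsum_add ip_summable)

lemma ip_scale_right: "ip x (\<lambda>a. c * y a) = c * ip x y"
  unfolding ip_def by (simp add: mult.left_commute infsum_cmult_right')

lemma ip_cnj: "cnj (ip x y) = ip y x"
  unfolding ip_def by (subst infsum_cnj[symmetric]) (simp add: mult.commute)

lemma ip_add_left: "l2 x \<Longrightarrow> l2 y \<Longrightarrow> l2 z \<Longrightarrow> ip (\<lambda>a. y a + z a) x = ip y x + ip z x"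
  by (subst (1 2 3) ip_cnj[symmetric]) (simp add: ip_add_right)

lemma ip_scale_left: "ip (\<lambda>a. c * y a) x = cnj c * ip y x"
  unfolding ip_def by (simp add: mult.assoc infsum_cmult_right')

lemma ip_diff_right: "l2 x \<Longrightarrow> l2 y \<Longrightarrow> l2 z \<Longrightarrow> ip x (\<lambda>a. y a - z a) = ip x y - ip x z"
  using ip_add_right[of x y "\<lambda>a. (-1) * z a"] ip_scale_right[of x "-1" z] by simp

lemma ip_diff_left: "l2 x \<Longrightarrow> l2 y \<Longrightarrow> l2 z \<Longrightarrow> ip (\<lambda>a. y a - z a) x = ip y x - ip z x"
  by (subst (1 2 3) ip_cnj[symmetric]) (simp add: ip_diff_right)

definition unitv :: "'i \<Rightarrow> 'i \<Rightarrow> complex" where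
  "unitv a = (\<lambda>b. if b = a then 1 else 0)"

lemma finite_support_l2:
  assumes "finite A" "\<And>b. b \<notin> A \<Longrightarrow> y b = 0"
  shows "l2 y" "(nrm y)\<^sup>2 = (\<Sum>a\<in>A. (cmod (y a))\<^sup>2)"
proof -
  have "((\<lambda>a. (cmod (y a))\<^sup>2) has_sum (\<Sum>a\<in>A. (cmod (y a))\<^sup>2)) UNIV"
    using assms by (intro has_sum_cong_neutral[THEN iffD1, OF _ _ _ has_sum_finite[OF assms(1)]]) auto
  thus "l2 y" "(nrm y)\<^sup>2 = (\<Sum>a\<in>A. (cmod (y a))\<^sup>2)"
    unfolding l2_def nrm_sq by (auto simp: has_sum_iff)
qed

lemma unitv_l2 [simp]: "l2 (unitv a)" "nrm (unitv a) = 1"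
proof -
  show "l2 (unitv a)" using finite_support_l2(1)[of "{a}"] by (simp add: unitv_def)
  have "(nrm (unitv a))\<^sup>2 = 1" using finite_support_l2(2)[of "{a}"] by (simp add: unitv_def)
  thus "nrm (unitv a) = 1" using nrm_nonneg[of "unitv a"] by (simp add: power2_eq_1_iff)
qed

lemma ip_unitv: "ip (unitv a) y = y a"
proof -
  have "((\<lambda>b. cnj (unitv a b) * y b) has_sum (\<Sum>b\<in>{a}. cnj (unitv a b) * y b)) UNIV"
    by (rule has_sum_cong_neutral[THEN iffD1, OF _ _ _ has_sum_finite[of "{a}"]])
      (auto simp: unitv_def)
  thus ?thesis unfolding ip_def by (simp add: infsumI unitv_def)
qed

section \<open>Uniform boundedness and the Fock module\<close>

text \<open>Needed because \<^const>\<open>opnorm\<close> is a supremum that would be junk for an unbounded operator.  The proof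
  is Sokal's: a series of near-maximizers scaled by \<open>3\<^sup>-\<^sup>n\<close>, with the sign of each term chosen so that
  it does not decrease the \<open>n\<close>-th seminorm.\<close>

lemma uniform_boundedness_rows:
  fixes g :: "'i \<Rightarrow> 'j \<Rightarrow> complex"
  assumes g: "\<And>a. l2 (g a)" and T: "\<And>x. l2 x \<Longrightarrow> l2 (\<lambda>a. ip (g a) x)"
  shows "\<exists>C\<ge>0. \<forall>x. l2 x \<longrightarrow> nrm (\<lambda>a. ip (g a) x) \<le> C * nrm x"
proof (rule ccontr)
  assume neg: "\<not> ?thesis"
  define q where "q A x = L2_set (\<lambda>a. cmod (ip (g a) x)) A" for A x
  have q_nn: "0 \<le> q A x" for A x by (simp add: q_def)
  have q_T: "q A x \<le> nrm (\<lambda>a. ip (g a) x)" if "l2 x" "finite A" for A x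
    unfolding q_def using L2_set_le_nrm[OF T[OF that(1)] that(2)] .
  have q_add: "q A (\<lambda>a. x a + y a) \<le> q A x + q A y" if "l2 x" "l2 y" for A x y
  proof -
    have "q A (\<lambda>a. x a + y a) \<le> L2_set (\<lambda>a. cmod (ip (g a) x) + cmod (ip (g a) y)) A"
      unfolding q_def by (intro L2_set_mono) (auto simp: ip_add_right g that norm_triangle_ineq)
    also have "\<dots> \<le> q A x + q A y" unfolding q_def by (rule L2_set_triangle_ineq)
    finally show ?thesis .
  qed
  have q_scale: "q A (\<lambda>a. c * x a) = cmod c * q A x" for A c x
    unfolding q_def by (simp add: ip_scale_right norm_mult L2_set_right_distrib)
  \<comment> \<open>A crude bound by the norms of the rows; it ensures that the supremum
    \<open>K A\<close> over the unit ball exists.\<close>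
  define Kb where "Kb A = L2_set (\<lambda>a. nrm (g a)) A" for A
  have q_bd: "q A x \<le> Kb A * nrm x" if "l2 x" for A x
    unfolding q_def Kb_def
    by (subst L2_set_left_distrib) (auto intro!: L2_set_mono ip_bound g that)
  define U where "U = {u :: 'j \<Rightarrow> complex. l2 u \<and> nrm u \<le> 1}"
  define K where "K A = Sup (q A ` U)" for A
  have z: "(\<lambda>a. 0) \<in> U" by (simp add: U_def)
  have bdd: "bdd_above (q A ` U)" for A
  proof (rule bdd_aboveI[of _ "Kb A"])
    fix r assume "r \<in> q A ` U"
    then obtain u where u: "l2 u" "nrm u \<le> 1" "r = q A u" by (auto simp: U_def)
    have "Kb A * nrm u \<le> Kb A * 1" using u by (intro mult_left_mono) (auto simp: Kb_def)
    thus "r \<le> Kb A" using q_bd[OF u(1), of A] u(3) by simp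
  qed
  have K_up: "q A u \<le> K A" if "u \<in> U" for A u
    unfolding K_def using bdd that by (intro cSup_upper) auto
  have K_bd: "q A x \<le> K A * nrm x" if x: "l2 x" for A x
  proof (cases "nrm x = 0")
    case True thus ?thesis using q_bd[OF x, of A] by simp
  next
    case False
    hence p: "nrm x > 0" using nrm_nonneg[of x] by linarith
    have "(\<lambda>a. of_real (inverse (nrm x)) * x a) \<in> U"
      using p x by (simp add: U_def norm_inverse del: of_real_inverse)
    from K_up[OF this, of A] have "inverse (nrm x) * q A x \<le> K A"
      using p by (simp add: q_scale norm_inverse del: of_real_inverse)
    thus ?thesis using p by (simp add: field_simps)
  qed
  have K_nn: "0 \<le> K A" for A using K_up[OF z, of A] q_nn[of A "\<lambda>a. 0"] by linarith
  \<comment> \<open>If no constant works, every \<open>4^n\<close> is beaten on some finite set of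
    rows. The factor \<open>2/3\<close> lies below 1, so it is attained, and above the
    \<open>1/2\<close> that is lost to the later terms of the series.\<close>
  have ex: "\<exists>A u. finite A \<and> 4 ^ n \<le> K A \<and> u \<in> U \<and> 2/3 * K A \<le> q A u" for n :: nat
  proof -
    have "\<not> (\<forall>x. l2 x \<longrightarrow> nrm (\<lambda>a. ip (g a) x) \<le> 4^n * nrm x)"
    proof
      assume "\<forall>x. l2 x \<longrightarrow> nrm (\<lambda>a. ip (g a) x) \<le> 4^n * nrm x"
      hence "\<exists>C\<ge>0. \<forall>x. l2 x \<longrightarrow> nrm (\<lambda>a. ip (g a) x) \<le> C * nrm x"
        by (intro exI[of _ "4^n"] conjI) auto
      thus False using neg by blast
    qed
    then obtain x where x: "l2 x" "nrm (\<lambda>a. ip (g a) x) > 4^n * nrm x"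
      by (auto simp: not_le)
    obtain A where A: "finite A" "q A x > 4^n * nrm x"
    proof (rule ccontr)
      assume "\<not> thesis"
      hence "\<And>A. finite A \<Longrightarrow> q A x \<le> 4^n * nrm x" using that by force
      hence "nrm (\<lambda>a. ip (g a) x) \<le> 4^n * nrm x"
        unfolding q_def by (intro l2I_nrm(2)) auto
      thus False using x by simp
    qed
    have K4: "4^n \<le> K A"
    proof (rule ccontr)
      assume "\<not> 4^n \<le> K A"
      hence "K A * nrm x \<le> 4^n * nrm x" by (intro mult_right_mono) auto
      thus False using A K_bd[OF x(1), of A] by linarith
    qed
    hence "2/3 * K A < K A" using zero_less_power[of "4::real" n] by linarith
    hence "\<exists>r\<in>q A ` U. 2/3 * K A < r"
      unfolding K_def using z bdd by (subst (asm) less_cSup_iff) auto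
    thus ?thesis using A K4 by (auto intro!: less_imp_le)
  qed
  hence "\<forall>n. \<exists>p. finite (fst p) \<and> 4 ^ n \<le> K (fst p) \<and> snd p \<in> U \<and> 2/3 * K (fst p) \<le> q (fst p) (snd p)"
    by auto
  then obtain p where p: "\<forall>n. finite (fst (p n)) \<and> 4 ^ n \<le> K (fst (p n)) \<and> snd (p n) \<in> U
      \<and> 2/3 * K (fst (p n)) \<le> q (fst (p n)) (snd (p n))" by (rule choice[THEN exE])
  define A u where "A n = fst (p n)" and "u n = snd (p n)" for n
  have Au: "finite (A n)" "4 ^ n \<le> K (A n)" "u n \<in> U" "2/3 * K (A n) \<le> q (A n) (u n)" for n
    using p by (auto simp: A_def u_def)
  define v where "v n = (\<lambda>a. of_real ((1/3)^n) * u n a)" for n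
  have v: "l2 (v n)" "nrm (v n) \<le> (1/3)^n" for n
  proof -
    show "l2 (v n)" using Au(3)[of n] by (simp add: v_def U_def del: of_real_power)
    have "nrm (v n) = (1/3)^n * nrm (u n)" by (simp add: v_def norm_power norm_divide)
    thus "nrm (v n) \<le> (1/3)^n" using Au(3)[of n] by (simp add: U_def mult_le_one mult_left_le)
  qed
  have qv: "q (A n) (v n) \<ge> (1/3)^n * (2/3 * K (A n))" for n
    using Au(4)[of n] by (simp add: v_def q_scale norm_power norm_divide mult_left_mono)
  define X where "X = rec_nat (\<lambda>a. 0) (\<lambda>n x. if q (A n) (\<lambda>a. x a + v n a) \<ge> q (A n) (v n)
                      then (\<lambda>a. x a + v n a) else (\<lambda>a. x a + - v n a))"
  have X0: "X 0 = (\<lambda>a. 0)" by (simp add: X_def)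
  have XS: "X (Suc n) = (if q (A n) (\<lambda>a. X n a + v n a) \<ge> q (A n) (v n)
                      then (\<lambda>a. X n a + v n a) else (\<lambda>a. X n a + - v n a))" for n
    by (simp add: X_def)
  have Xl: "l2 (X n)" for n
    by (induction n) (auto simp: X0 XS intro!: l2_add(1) l2_diff(1) v)
  \<comment> \<open>The two candidates differ by \<open>2 * v n\<close>, so they cannot both have a
    seminorm below that of \<open>v n\<close>.\<close>
  have Xq: "q (A n) (X (Suc n)) \<ge> q (A n) (v n)" for n
  proof (cases "q (A n) (\<lambda>a. X n a + v n a) \<ge> q (A n) (v n)")
    case False
    have "2 * q (A n) (v n) = q (A n) (\<lambda>a. 2 * v n a)" by (simp add: q_scale)
    also have "(\<lambda>a. 2 * v n a) = (\<lambda>a. (X n a + v n a) + (-1) * (X n a + - v n a))" by auto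
    also have "q (A n) \<dots> \<le> q (A n) (\<lambda>a. X n a + v n a) + q (A n) (\<lambda>a. (-1) * (X n a + - v n a))"
      by (rule q_add) (intro l2_add(1) l2_scale Xl v l2_uminus)+
    also have "q (A n) (\<lambda>a. (-1) * (X n a + - v n a)) = q (A n) (\<lambda>a. X n a + - v n a)"
      by (subst q_scale) simp
    finally show ?thesis using False unfolding XS by simp
  qed (simp add: XS)
  have step: "nrm (\<lambda>a. X (Suc n) a - X n a) \<le> (1/3)^n" for n
    using v(2)[of n] by (simp add: XS)
  have cau: "nrm (\<lambda>a. X (n + d) a - X n a) \<le> 3/2 * (1/3)^n - 3/2 * (1/3)^(n+d)" for n d
  proof (induction d)
    case (Suc d)
    have "nrm (\<lambda>a. X (n + Suc d) a - X n a)
        = nrm (\<lambda>a. (X (Suc (n + d)) a - X (n+d) a) + (X (n + d) a - X n a))" by simp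
    also have "\<dots> \<le> nrm (\<lambda>a. X (Suc (n + d)) a - X (n+d) a) + nrm (\<lambda>a. X (n + d) a - X n a)"
      by (intro l2_add(2) l2_diff(1) Xl)
    also have "\<dots> \<le> (1/3)^(n+d) + (3/2 * (1/3)^n - 3/2 * (1/3)^(n+d))"
      by (intro add_mono step Suc)
    finally show ?case by simp
  qed simp
  have cau': "nrm (\<lambda>a. X m a - X n a) \<le> 3/2 * (1/3)^n" if "n \<le> m" for m n
  proof -
    have "0 \<le> (1/3::real)^m" by simp
    moreover have "nrm (\<lambda>a. X m a - X n a) \<le> 3/2 * (1/3)^n - 3/2 * (1/3)^m"
      using cau[of n "m - n"] that by simp
    ultimately show ?thesis by linarith
  qed
  have cX: "convergent (\<lambda>n. X n a)" for a
  proof (rule Cauchy_convergent, rule metric_CauchyI)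
    fix e :: real assume e: "e > 0"
    have "(\<lambda>n. 3 * (1/3::real)^n) \<longlonglongrightarrow> 3 * 0" by (intro tendsto_intros) auto
    from order_tendstoD(2)[OF this, of e] e obtain N where N: "3 * (1/3::real)^N < e"
      by (auto simp: eventually_sequentially)
    have b: "cmod (X m a - X N a) \<le> 3/2 * (1/3)^N" if "m \<ge> N" for m
    proof -
      have "cmod (X m a - X N a) \<le> nrm (\<lambda>a. X m a - X N a)"
        by (rule cmod_le_nrm) (intro l2_diff(1) Xl)
      thus ?thesis using cau'[OF that] by linarith
    qed
    show "\<exists>M. \<forall>m\<ge>M. \<forall>n\<ge>M. dist (X m a) (X n a) < e"
    proof (intro exI[of _ N] allI impI)
      fix m n assume "m \<ge> N" "n \<ge> N"
      have "dist (X m a) (X n a) \<le> dist (X m a) (X N a) + dist (X n a) (X N a)"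
        by (rule dist_triangle2)
      thus "dist (X m a) (X n a) < e"
        using b[OF \<open>m \<ge> N\<close>] b[OF \<open>n \<ge> N\<close>] N by (simp add: dist_norm)
    qed
  qed
  define x where "x a = lim (\<lambda>n. X n a)" for a
  have limX: "(\<lambda>n. X n a) \<longlonglongrightarrow> x a" for a
    unfolding x_def using cX convergent_LIMSEQ_iff by blast
  have xd: "l2 (\<lambda>a. x a - X n a)" "nrm (\<lambda>a. x a - X n a) \<le> 3/2 * (1/3)^n" for n
  proof -
    have 1: "l2 (\<lambda>a. X m a - X n a)" for m by (intro l2_diff(1) Xl)
    have 2: "(\<lambda>m. X m a - X n a) \<longlonglongrightarrow> x a - X n a" for a by (intro tendsto_intros limX)
    show "l2 (\<lambda>a. x a - X n a)" by (rule l2_fatou(1)[OF 1 cau' 2])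
    show "nrm (\<lambda>a. x a - X n a) \<le> 3/2 * (1/3)^n" by (rule l2_fatou(2)[OF 1 cau' 2])
  qed
  have x: "l2 x" using xd(1)[of 0] by (simp add: X0)
  \<comment> \<open>In units of \<open>K (A n) / 3^n\<close>, the partial sum contributes
    \<open>2/3\<close> and the remaining terms cost at most \<open>3/2 * 1/3 = 1/2\<close>. The
    surplus \<open>1/6\<close> grows like \<open>(4/3)^n\<close> because \<open>K (A n)\<close> is
    at least \<open>4^n\<close>.\<close>
  have "(1/6) * (4/3)^n \<le> nrm (\<lambda>a. ip (g a) x)" for n :: nat
  proof -
    have "q (A n) (X (Suc n)) = q (A n) (\<lambda>a. x a + (-1) * (x a - X (Suc n) a))" by simp
    also have "\<dots> \<le> q (A n) x + q (A n) (\<lambda>a. (-1) * (x a - X (Suc n) a))"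
      by (intro q_add x l2_scale xd)
    also have "q (A n) (\<lambda>a. (-1) * (x a - X (Suc n) a)) = q (A n) (\<lambda>a. x a - X (Suc n) a)"
      by (subst q_scale) simp
    also have "\<dots> \<le> K (A n) * nrm (\<lambda>a. x a - X (Suc n) a)" by (intro K_bd xd)
    also have "\<dots> \<le> K (A n) * (3/2 * (1/3)^Suc n)" by (intro mult_left_mono xd K_nn)
    finally have "(1/3)^n * (2/3 * K (A n)) \<le> q (A n) x + K (A n) * (3/2 * (1/3)^Suc n)"
      using Xq[of n] qv[of n] by linarith
    hence "(1/6) * ((1/3)^n * K (A n)) \<le> q (A n) x" by (simp add: algebra_simps)
    moreover have "(1/3)^n * 4^n \<le> (1/3)^n * K (A n)" using Au(2) by (intro mult_left_mono) auto
    moreover have "(1/3::real)^n * 4^n = (4/3)^n" by (simp add: power_divide)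
    ultimately show ?thesis using q_T[OF x Au(1), of n] by linarith
  qed
  note lower = this
  obtain n where "6 * nrm (\<lambda>a. ip (g a) x) < (4/3::real)^n"
    using real_arch_pow[of "4/3"] by auto
  with lower[of n] show False by simp
qed

section \<open>Columns of the Fock module as Hilbert spaces\<close>

abbreviation col :: "'k \<Rightarrow> (nat \<Rightarrow> 'a \<Rightarrow> 'k \<Rightarrow> complex) \<Rightarrow> nat \<times> 'a \<Rightarrow> complex" where
  "col k x \<equiv> (\<lambda>(n, i). x n i k)"

text \<open>Bridge between the series over degrees in the definition of the module and unordered
  sums over pairs of degree and row.\<close>

lemma has_sum_finite_fibres:
  fixes f :: "nat \<times> 'a::finite \<Rightarrow> 'c::banach"
  assumes "f summable_on UNIV"
  shows "(\<lambda>n. \<Sum>i\<in>UNIV. f (n, i)) sums infsum f UNIV"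
proof -
  have "(f has_sum infsum f UNIV) (UNIV \<times> UNIV)" using assms by simp
  hence "((\<lambda>n. \<Sum>i\<in>UNIV. f (n, i)) has_sum infsum f UNIV) UNIV"
    by (rule has_sum_SigmaD) (simp add: has_sum_finiteI)
  thus ?thesis by (rule has_sum_imp_sums)
qed

lemma l2_zero_prod [simp]: "l2 (\<lambda>(n, i). 0)"
  using nrm_zero(1) by (simp add: split_def)

lemma minner_self: "Re (minner A A k) = (\<Sum>i\<in>UNIV. (cmod (A i k))\<^sup>2)"
proof -
  have "cnj z * z = of_real ((cmod z)\<^sup>2)" for z
    using complex_norm_square[of z] by (simp only: mult.commute)
  thus ?thesis by (simp add: minner_def del: of_real_power)
qed

lemma l2_col_iff: "l2 (col k x) \<longleftrightarrow> summable (\<lambda>n. Re (minner (x n) (x n) k))"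
  for x :: "nat \<Rightarrow> 'a::finite \<Rightarrow> 'a \<Rightarrow> complex"
proof
  assume "l2 (col k x)"
  from has_sum_finite_fibres[OF this[unfolded l2_def]]
  show "summable (\<lambda>n. Re (minner (x n) (x n) k))"
    by (simp add: minner_self sums_iff)
next
  assume s: "summable (\<lambda>n. Re (minner (x n) (x n) k))"
  show "l2 (col k x)"
  proof (rule l2I_nrm(1)[of "sqrt (\<Sum>n. Re (minner (x n) (x n) k))"])
    show nn: "0 \<le> sqrt (\<Sum>n. Re (minner (x n) (x n) k))"
      by (intro real_sqrt_ge_zero suminf_nonneg s) (simp add: minner_self sum_nonneg)
    fix A :: "(nat \<times> 'a) set" assume A: "finite A"
    define N where "N = Max (fst ` A) + 1"
    have "(\<Sum>a\<in>A. (cmod (col k x a))\<^sup>2) \<le> (\<Sum>a\<in>{..<N} \<times> UNIV. (cmod (col k x a))\<^sup>2)"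
    proof (rule sum_mono2)
      show "A \<subseteq> {..<N} \<times> UNIV"
      proof
        fix a assume "a \<in> A"
        hence "fst a \<le> Max (fst ` A)" using A by simp
        thus "a \<in> {..<N} \<times> UNIV" by (cases a) (simp add: N_def)
      qed
    qed auto
    also have "\<dots> = (\<Sum>n<N. Re (minner (x n) (x n) k))"
      unfolding minner_self by (simp add: sum.cartesian_product split_def)
    also have "\<dots> \<le> (\<Sum>n. Re (minner (x n) (x n) k))"
      by (rule sum_le_suminf[OF s]) (auto simp: minner_self sum_nonneg)
    finally show "L2_set (\<lambda>a. cmod (col k x a)) A \<le> sqrt (\<Sum>n. Re (minner (x n) (x n) k))"
      by (simp add: L2_set_def)
  qed
qed

text \<open>The inner product has values in the diagonal matrices, so distinct columns never meet:
  the module is a finite family of Hilbert spaces, one for each \<open>k\<close>, on the pairs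
  \<open>(n, i)\<close> with \<open>matpow P n i k \<noteq> 0\<close>.\<close>

lemma fock_iff:
  "x \<in> fock P \<longleftrightarrow> (\<forall>n i k. matpow P n i k = 0 \<longrightarrow> x n i k = 0) \<and> (\<forall>k. l2 (col k x))"
  unfolding fock_def arv_def l2_col_iff by auto

lemma fock_l2 [simp]: "x \<in> fock P \<Longrightarrow> l2 (col k x)"
  by (simp add: fock_iff)

lemma fock_zero: "x \<in> fock P \<Longrightarrow> matpow P n i k = 0 \<Longrightarrow> x n i k = 0"
  by (simp add: fock_iff)

lemma finner_ip:
  assumes "x \<in> fock P" "y \<in> fock P"
  shows "finner x y k = ip (col k x) (col k y)"
proof -
  have "(\<lambda>n. \<Sum>i\<in>UNIV. cnj (col k x (n, i)) * col k y (n, i)) sums ip (col k x) (col k y)"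
    unfolding ip_def using assms by (intro has_sum_finite_fibres ip_summable) auto
  thus ?thesis unfolding finner_def minner_def by (simp add: sums_iff)
qed

lemma nrm_col_le_fnorm: "x \<in> fock P \<Longrightarrow> nrm (col k x) \<le> fnorm x"
proof -
  assume x: "x \<in> fock P"
  have "(nrm (col k x))\<^sup>2 = cmod (finner x x k)"
    unfolding finner_ip[OF x x] ip_self[OF fock_l2[OF x]] by (simp add: norm_power)
  also have "\<dots> \<le> Max (range (\<lambda>k. cmod (finner x x k)))" by (rule Max_ge) auto
  finally show ?thesis unfolding fnorm_def by (simp add: real_le_rsqrt)
qed

lemma fnorm_le: "x \<in> fock P \<Longrightarrow> (\<And>k. nrm (col k x) \<le> C) \<Longrightarrow> fnorm x \<le> C"
proof -
  assume x: "x \<in> fock P" and b: "\<And>k. nrm (col k x) \<le> C"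
  have C: "0 \<le> C" using b[of undefined] nrm_nonneg[of "col undefined x"] by linarith
  have "cmod (finner x x k) \<le> C\<^sup>2" for k
    unfolding finner_ip[OF x x] ip_self[OF fock_l2[OF x]] using b[of k]
    by (simp add: norm_power power_mono)
  hence "Max (range (\<lambda>k. cmod (finner x x k))) \<le> C\<^sup>2" by (subst Max_le_iff) auto
  thus ?thesis unfolding fnorm_def using C by (simp add: real_le_lsqrt)
qed

lemma col_add: "col k (\<lambda>n i k. x n i k + y n i k) = (\<lambda>a. col k x a + col k y a)" by auto
lemma col_scale: "col k (\<lambda>n i k. c * x n i k) = (\<lambda>a. c * col k x a)" by auto

lemma fock_add: "x \<in> fock P \<Longrightarrow> y \<in> fock P \<Longrightarrow> (\<lambda>n i k. x n i k + y n i k) \<in> fock P"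
  using l2_add(1)[of "col k x" "col k y" for k] by (simp add: fock_iff split_def)
lemma fock_diff: "x \<in> fock P \<Longrightarrow> y \<in> fock P \<Longrightarrow> (\<lambda>n i k. x n i k - y n i k) \<in> fock P"
  using l2_diff(1)[of "col k x" "col k y" for k] by (simp add: fock_iff split_def)
lemma fock_scale: "x \<in> fock P \<Longrightarrow> (\<lambda>n i k. c * x n i k) \<in> fock P"
  using l2_scale[of "col k x" for k] by (simp add: fock_iff split_def)
lemma fzero_fock [simp]: "fzero \<in> fock P"
  by (simp add: fock_iff fzero_def)
lemma fock_mono:
  assumes "x \<in> fock P" "\<And>n i k. cmod (y n i k) \<le> cmod (x n i k)"
  shows "y \<in> fock P"
proof -
  have "l2 (col k y)" for k
    by (rule l2_mono(1)[OF fock_l2[OF assms(1), of k]]) (simp add: assms(2) split_def)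
  moreover have "y n i k = 0" if "matpow P n i k = 0" for n i k
    using assms(2)[of n i k] fock_zero[OF assms(1) that] by simp
  ultimately show ?thesis by (simp add: fock_iff)
qed

definition bvec :: "nat \<Rightarrow> 'a \<Rightarrow> 'a \<Rightarrow> 'a fock" where
  "bvec n i k = (\<lambda>m a b. if m = n \<and> a = i \<and> b = k then 1 else 0)"

lemma col_bvec: "col k (bvec n i k) = unitv (n, i)"
  by (auto simp: bvec_def unitv_def fun_eq_iff)

lemma bvec_fock: "matpow P n i k \<noteq> 0 \<Longrightarrow> bvec n i k \<in> fock P"
proof -
  assume "matpow P n i k \<noteq> 0"
  moreover have "l2 (col b (bvec n i k))" for b
    by (cases "b = k") (simp add: col_bvec, simp add: bvec_def)
  ultimately show ?thesis unfolding fock_iff by (auto simp: bvec_def)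
qed

section \<open>Adjointable operators\<close>

text \<open>Symmetric version of \<open>is_adjoint\<close>: both maps are normalised to
  \<open>fzero\<close> outside the module and paired column by column. The symmetry lets each fact
  about an operator be reused for its adjoint, and the choice in \<open>adj\<close> becomes
  unique.\<close>

definition adjp :: "('a::finite \<Rightarrow> 'a \<Rightarrow> real) \<Rightarrow> 'a fop \<Rightarrow> 'a fop \<Rightarrow> bool" where
  "adjp P T S \<longleftrightarrow> (\<forall>x\<in>fock P. T x \<in> fock P \<and> S x \<in> fock P) \<and>
     (\<forall>x. x \<notin> fock P \<longrightarrow> T x = fzero \<and> S x = fzero) \<and>
     (\<forall>x\<in>fock P. \<forall>y\<in>fock P. \<forall>k. ip (col k (T x)) (col k y) = ip (col k x) (col k (S y)))"

lemma adjpD: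
  assumes "adjp P T S"
  shows "x \<in> fock P \<Longrightarrow> T x \<in> fock P" "x \<in> fock P \<Longrightarrow> S x \<in> fock P"
    "x \<notin> fock P \<Longrightarrow> T x = fzero" "x \<notin> fock P \<Longrightarrow> S x = fzero"
    "x \<in> fock P \<Longrightarrow> y \<in> fock P \<Longrightarrow> ip (col k (T x)) (col k y) = ip (col k x) (col k (S y))"
  using assms unfolding adjp_def by blast+

lemma adjp_sym: "adjp P T S \<Longrightarrow> adjp P S T"
  unfolding adjp_def
proof (elim conjE, intro conjI ballI allI)
  fix x y k
  assume "\<forall>x\<in>fock P. \<forall>y\<in>fock P. \<forall>k. ip (col k (T x)) (col k y) = ip (col k x) (col k (S y))"
    "x \<in> fock P" "y \<in> fock P"
  hence "ip (col k (T y)) (col k x) = ip (col k y) (col k (S x))" by blast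
  thus "ip (col k (S x)) (col k y) = ip (col k x) (col k (T y))"
    by (metis ip_cnj)
qed blast+

lemma adjp_iff: "adjp P T S \<longleftrightarrow> is_adjoint P T S \<and> (\<forall>x\<in>fock P. T x \<in> fock P) \<and>
    (\<forall>x. x \<notin> fock P \<longrightarrow> T x = fzero)"
proof
  assume a: "adjp P T S"
  show "is_adjoint P T S \<and> (\<forall>x\<in>fock P. T x \<in> fock P) \<and> (\<forall>x. x \<notin> fock P \<longrightarrow> T x = fzero)"
    unfolding is_adjoint_def
  proof (intro conjI ballI allI impI ext)
    fix x y k assume xy: "x \<in> fock P" "y \<in> fock P"
    show "finner (T x) y k = finner x (S y) k"
      using adjpD(5)[OF a xy, of k]
      by (simp add: finner_ip[OF adjpD(1)[OF a xy(1)] xy(2)] finner_ip[OF xy(1) adjpD(2)[OF a xy(2)]])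
  qed (use adjpD[OF a] in auto)
next
  assume b: "is_adjoint P T S \<and> (\<forall>x\<in>fock P. T x \<in> fock P) \<and> (\<forall>x. x \<notin> fock P \<longrightarrow> T x = fzero)"
  hence c: "\<And>x y k. x \<in> fock P \<Longrightarrow> y \<in> fock P \<Longrightarrow> finner (T x) y k = finner x (S y) k"
    unfolding is_adjoint_def by auto
  show "adjp P T S"
    unfolding adjp_def
  proof (intro conjI ballI allI impI)
    fix x y k assume xy: "x \<in> fock P" "y \<in> fock P"
    have "T x \<in> fock P" "S y \<in> fock P" using b xy by (auto simp: is_adjoint_def)
    thus "ip (col k (T x)) (col k y) = ip (col k x) (col k (S y))"
      using c[OF xy, of k] xy by (simp add: finner_ip)
  qed (use b in \<open>auto simp: is_adjoint_def\<close>)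
qed

text \<open>Pairing with a basis vector and moving \<open>T\<close> across makes each entry of
  \<open>T y\<close> an inner product with a fixed vector. Linearity, independence of the columns
  and boundedness of adjointable maps are read off from this.\<close>

lemma adjp_coord:
  assumes a: "adjp P T S" and y: "y \<in> fock P" and m: "matpow P n i k \<noteq> 0"
  shows "T y n i k = ip (col k (S (bvec n i k))) (col k y)"
  using adjpD(5)[OF adjp_sym[OF a] bvec_fock[OF m] y, of k]
  by (simp add: col_bvec ip_unitv)

lemma adjp_unique:
  assumes "adjp P T S" "adjp P T S'"
  shows "S = S'"
proof (intro ext)
  fix y n i k
  show "S y n i k = S' y n i k"
  proof (cases "y \<in> fock P")
    case True
    show ?thesis
    proof (cases "matpow P n i k = 0")
      case z: True
      show ?thesis
        using fock_zero[OF adjpD(2)[OF assms(1) True] z] fock_zero[OF adjpD(2)[OF assms(2) True] z]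
        by simp
    next
      case False
      show ?thesis
        using adjp_coord[OF adjp_sym[OF assms(1)] True False]
          adjp_coord[OF adjp_sym[OF assms(2)] True False] by simp
    qed
  next
    case False
    thus ?thesis using adjpD(4)[OF assms(1)] adjpD(4)[OF assms(2)] by simp
  qed
qed

lemma adjp_Lops: "adjp P T S \<Longrightarrow> T \<in> Lops P"
  unfolding Lops_def adjp_iff by blast

lemma Lops_adjp: "T \<in> Lops P \<Longrightarrow> adjp P T (adj P T)"
  using someI_ex[of "is_adjoint P T"] unfolding Lops_def adjp_iff adj_def by simp

lemma adjp_adj: "adjp P T S \<Longrightarrow> adj P T = S"
  using Lops_adjp[OF adjp_Lops] adjp_unique by blast

lemma adj_Lops: "T \<in> Lops P \<Longrightarrow> adj P T \<in> Lops P"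
  using Lops_adjp adjp_sym adjp_Lops by blast

lemma adj_adj: "T \<in> Lops P \<Longrightarrow> adj P (adj P T) = T"
  using Lops_adjp adjp_sym adjp_adj by blast

lemma Lops_fock: "T \<in> Lops P \<Longrightarrow> x \<in> fock P \<Longrightarrow> T x \<in> fock P"
  unfolding Lops_def by blast

lemma Lops_outside: "T \<in> Lops P \<Longrightarrow> x \<notin> fock P \<Longrightarrow> T x = fzero"
  unfolding Lops_def by blast

text \<open>Right linearity over the diagonal matrices, in coordinates. It allows norms to be
  estimated one column at a time.\<close>

lemma Lops_local:
  assumes T: "T \<in> Lops P" and x: "x \<in> fock P" "y \<in> fock P" and eq: "\<And>n i. x n i k = y n i k"
  shows "T x n i k = T y n i k"
proof (cases "matpow P n i k = 0")
  case True
  show ?thesis using fock_zero[OF Lops_fock[OF T x(1)] True] fock_zero[OF Lops_fock[OF T x(2)] True]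
    by simp
next
  case False
  have "col k x = col k y" using eq by auto
  thus ?thesis
    using adjp_coord[OF Lops_adjp[OF T] x(1) False] adjp_coord[OF Lops_adjp[OF T] x(2) False] by simp
qed

lemma Lops_add:
  assumes T: "T \<in> Lops P" and x: "x \<in> fock P" "y \<in> fock P"
  shows "T (\<lambda>n i k. x n i k + y n i k) = (\<lambda>n i k. T x n i k + T y n i k)"
proof (intro ext)
  fix n i k
  note xy = fock_add[OF x]
  show "T (\<lambda>n i k. x n i k + y n i k) n i k = T x n i k + T y n i k"
  proof (cases "matpow P n i k = 0")
    case True
    show ?thesis using fock_zero[OF Lops_fock[OF T x(1)] True] fock_zero[OF Lops_fock[OF T x(2)] True]
      fock_zero[OF Lops_fock[OF T xy] True] by simp
  next
    case False
    note c = adjp_coord[OF Lops_adjp[OF T] _ False]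
    have l: "l2 (col k (adj P T (bvec n i k)))"
      by (rule fock_l2[OF Lops_fock[OF adj_Lops[OF T] bvec_fock[OF False]]])
    show ?thesis
      unfolding c[OF x(1)] c[OF x(2)] c[OF xy]
      by (subst col_add) (rule ip_add_right[OF l fock_l2[OF x(1)] fock_l2[OF x(2)]])
  qed
qed

lemma Lops_scale:
  assumes T: "T \<in> Lops P" and x: "x \<in> fock P"
  shows "T (\<lambda>n i k. c * x n i k) = (\<lambda>n i k. c * T x n i k)"
proof (intro ext)
  fix n i k
  note xy = fock_scale[OF x]
  show "T (\<lambda>n i k. c * x n i k) n i k = c * T x n i k"
  proof (cases "matpow P n i k = 0")
    case True
    show ?thesis using fock_zero[OF Lops_fock[OF T x] True]
      fock_zero[OF Lops_fock[OF T xy] True] by simp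
  next
    case False
    note c = adjp_coord[OF Lops_adjp[OF T] _ False]
    show ?thesis
      unfolding c[OF x] c[OF xy] by (subst col_scale) (rule ip_scale_right)
  qed
qed

lemma Lops_diff:
  assumes T: "T \<in> Lops P" and x: "x \<in> fock P" "y \<in> fock P"
  shows "T (\<lambda>n i k. x n i k - y n i k) = (\<lambda>n i k. T x n i k - T y n i k)"
  using Lops_add[OF T x(1) fock_scale[OF x(2), of "-1"]] Lops_scale[OF T x(2), of "-1"] by simp

lemma Lops_fzero: "T \<in> Lops P \<Longrightarrow> T fzero = fzero"
  using Lops_scale[OF _ fzero_fock, of T P 0] by (simp add: fzero_def)

section \<open>Boundedness and the operator norm\<close>

definition opb :: "('a::finite \<Rightarrow> 'a \<Rightarrow> real) \<Rightarrow> 'a fop \<Rightarrow> real \<Rightarrow> bool" where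
  "opb P T C \<longleftrightarrow> (\<forall>x\<in>fock P. \<forall>k. nrm (col k (T x)) \<le> C * nrm (col k x))"

text \<open>In column \<open>k\<close> the entries of \<open>T x\<close> are inner products with the
  vectors \<open>g\<close>, so an everywhere defined adjointable map falls under
  \<open>uniform_boundedness_rows\<close>. The finitely many column constants are then
  added.\<close>

lemma Lops_bounded:
  assumes T: "T \<in> Lops P"
  shows "\<exists>C\<ge>0. opb P T C"
proof -
  have "\<exists>C\<ge>0. \<forall>x\<in>fock P. nrm (col k (T x)) \<le> C * nrm (col k x)" for k
  proof -
    define g where "g = (\<lambda>(n, i). if matpow P n i k = 0 then (\<lambda>a. 0) else col k (adj P T (bvec n i k)))"
    have g: "l2 (g a)" for a
      unfolding g_def by (cases a) (simp add: fock_l2[OF Lops_fock[OF adj_Lops[OF T] bvec_fock]])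
    have key: "(\<lambda>a. ip (g a) (col k x)) = col k (T x)" if x: "x \<in> fock P" for x
    proof
      fix a :: "nat \<times> 'a" obtain n i where a: "a = (n, i)" by fastforce
      show "ip (g a) (col k x) = col k (T x) a"
      proof (cases "matpow P n i k = 0")
        case True
        thus ?thesis using fock_zero[OF Lops_fock[OF T x] True] by (simp add: a g_def ip_def)
      next
        case False
        thus ?thesis using adjp_coord[OF Lops_adjp[OF T] x False] by (simp add: a g_def)
      qed
    qed
    have "l2 (\<lambda>a. ip (g a) x)" if x: "l2 x" for x
    proof -
      \<comment> \<open>An arbitrary square-summable \<open>x\<close> is put into column
        \<open>k\<close> and cut to the support of the module; the discarded entries are invisible
        because the rows \<open>g\<close> vanish there.\<close>
      define x' where "x' n i k' = (if k' = k \<and> matpow P n i k \<noteq> 0 then x (n, i) else 0)" for n i k'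
      have l: "l2 (col b x')" for b
        by (rule l2_mono(1)[OF x]) (auto simp: x'_def)
      have x': "x' \<in> fock P" unfolding fock_iff using l by (auto simp: x'_def)
      have "ip (g a) x = ip (g a) (col k x')" for a
      proof -
        obtain n i where a: "a = (n, i)" by fastforce
        have "cnj (g a b) * x b = cnj (g a b) * col k x' b" for b
        proof -
          obtain m j where b: "b = (m, j)" by fastforce
          have "matpow P m j k = 0 \<Longrightarrow> g a b = 0"
            unfolding a b g_def
            using fock_zero[OF Lops_fock[OF adj_Lops[OF T] bvec_fock], of n i k m j k] by auto
          thus ?thesis by (auto simp: b x'_def)
        qed
        thus ?thesis unfolding ip_def by (rule infsum_cong)
      qed
      hence "(\<lambda>a. ip (g a) x) = col k (T x')" using key[OF x'] by simp
      thus ?thesis using fock_l2[OF Lops_fock[OF T x']] by simp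
    qed
    from uniform_boundedness_rows[OF g this] obtain C where
      C: "C \<ge> 0" "\<And>x. l2 x \<Longrightarrow> nrm (\<lambda>a. ip (g a) x) \<le> C * nrm x" by blast
    have "nrm (col k (T x)) \<le> C * nrm (col k x)" if x: "x \<in> fock P" for x
      using C(2)[OF fock_l2[OF x, of k]] unfolding key[OF x] .
    thus ?thesis using C(1) by blast
  qed
  hence "\<forall>k. \<exists>C. C \<ge> 0 \<and> (\<forall>x\<in>fock P. nrm (col k (T x)) \<le> C * nrm (col k x))" by blast
  then obtain C where C: "\<forall>k. C k \<ge> 0 \<and> (\<forall>x\<in>fock P. nrm (col k (T x)) \<le> C k * nrm (col k x))"
    by (rule choice[THEN exE])
  have "opb P T (\<Sum>k\<in>UNIV. C k)"
    unfolding opb_def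
  proof (intro ballI allI)
    fix x k assume x: "x \<in> fock P"
    have "C k \<le> (\<Sum>k\<in>UNIV. C k)" using C by (intro member_le_sum) auto
    hence "C k * nrm (col k x) \<le> (\<Sum>k\<in>UNIV. C k) * nrm (col k x)" by (intro mult_right_mono) auto
    thus "nrm (col k (T x)) \<le> (\<Sum>k\<in>UNIV. C k) * nrm (col k x)"
      using C x by (meson order_trans)
  qed
  thus ?thesis using C by (intro exI[of _ "\<Sum>k\<in>UNIV. C k"]) (auto intro: sum_nonneg)
qed

lemma fnorm_nonneg: "0 \<le> fnorm x"
  unfolding fnorm_def by (intro real_sqrt_ge_zero, subst Max_ge_iff) auto

lemma fnorm_fzero: "fnorm (fzero :: 'a::finite fock) = 0"
proof (rule antisym[OF _ fnorm_nonneg])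
  show "fnorm (fzero :: 'a fock) \<le> 0"
    by (rule fnorm_le[OF fzero_fock]) (simp add: fzero_def split_def)
qed

lemma opnorm_set_bound:
  assumes T: "\<And>x. x \<in> fock P \<Longrightarrow> T x \<in> fock P" "opb P T C" "0 \<le> C" and x: "x \<in> fock P" "fnorm x \<le> 1"
  shows "fnorm (T x) \<le> C"
proof (rule fnorm_le[OF T(1)[OF x(1)]])
  fix k
  have "nrm (col k (T x)) \<le> C * nrm (col k x)" using T(2) x(1) by (simp add: opb_def)
  also have "\<dots> \<le> C * 1" using nrm_col_le_fnorm[OF x(1), of k] x(2) T(3) by (intro mult_left_mono) auto
  finally show "nrm (col k (T x)) \<le> C" by simp
qed

lemma opnorm_le:
  assumes "\<And>x. x \<in> fock P \<Longrightarrow> T x \<in> fock P" "opb P T C" "0 \<le> C"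
  shows "opnorm P T \<le> C"
  unfolding opnorm_def
proof (rule cSup_least)
  show "{fnorm (T x) |x. x \<in> fock P \<and> fnorm x \<le> 1} \<noteq> {}"
    using fzero_fock[of P] fnorm_fzero by (auto intro!: exI[of _ fzero] simp: fnorm_fzero)
qed (use opnorm_set_bound[OF assms] in blast)

lemma opnorm_bdd: "T \<in> Lops P \<Longrightarrow> bdd_above {fnorm (T x) |x. x \<in> fock P \<and> fnorm x \<le> 1}"
proof -
  assume T: "T \<in> Lops P"
  obtain C where C: "C \<ge> 0" "opb P T C" using Lops_bounded[OF T] by blast
  show ?thesis
    by (rule bdd_aboveI[of _ C]) (use opnorm_set_bound[OF Lops_fock[OF T] C(2,1)] in blast)
qed

lemma opnorm_nonneg: "T \<in> Lops P \<Longrightarrow> 0 \<le> opnorm P T"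
  unfolding opnorm_def
  by (rule cSup_upper2[OF _ fnorm_nonneg[of "T fzero"] opnorm_bdd]) (auto simp: fnorm_fzero intro!: exI[of _ fzero])

text \<open>\<open>fnorm\<close> is a maximum over columns, so an estimate for one column needs a
  test vector whose other columns vanish; by \<open>Lops_local\<close>, erasing them does not change
  column \<open>k\<close> of the image.\<close>

lemma opb_opnorm:
  assumes T: "T \<in> Lops P"
  shows "opb P T (opnorm P T)"
  unfolding opb_def
proof (intro ballI allI)
  fix x k assume x: "x \<in> fock P"
  define x' where "x' n i k' = (if k' = k then x n i k else 0)" for n i k'
  have x': "x' \<in> fock P"
    by (rule fock_mono[OF x]) (auto simp: x'_def)
  have same: "col k (T x) = col k (T x')"
    using Lops_local[OF T x x', of k] by (auto simp: x'_def)
  have cx: "col k x' = col k x" by (simp add: x'_def)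
  show "nrm (col k (T x)) \<le> opnorm P T * nrm (col k x)"
  proof (cases "nrm (col k x) = 0")
    case True
    obtain C where "opb P T C" using Lops_bounded[OF T] by blast
    hence "nrm (col k (T x)) \<le> C * nrm (col k x)" using x unfolding opb_def by blast
    thus ?thesis using True by simp
  next
    case False
    define c where "c = nrm (col k x)"
    have c: "c > 0" using False nrm_nonneg[of "col k x"] unfolding c_def by linarith
    define y where "y = (\<lambda>n i k. of_real (1/c) * x' n i k)"
    have y: "y \<in> fock P" unfolding y_def by (rule fock_scale[OF x'])
    have "fnorm y \<le> 1"
    proof (rule fnorm_le[OF y])
      fix b
      have "col b y = (\<lambda>a. of_real (1/c) * col b x' a)" unfolding y_def by (rule col_scale)
      hence n: "nrm (col b y) = 1/c * nrm (col b x')" using c by (simp add: norm_divide del: of_real_divide)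
      show "nrm (col b y) \<le> 1"
      proof (cases "b = k")
        case True thus ?thesis using n cx c by (simp add: c_def)
      next
        case False
        hence "col b x' = (\<lambda>a. 0)" by (auto simp: x'_def)
        thus ?thesis using n by simp
      qed
    qed
    hence "fnorm (T y) \<le> opnorm P T"
      unfolding opnorm_def using y by (intro cSup_upper opnorm_bdd[OF T]) auto
    hence "nrm (col k (T y)) \<le> opnorm P T" using nrm_col_le_fnorm[OF Lops_fock[OF T y], of k] by linarith
    moreover have "nrm (col k (T y)) = 1/c * nrm (col k (T x'))"
      unfolding y_def Lops_scale[OF T x'] col_scale nrm_scale using c
      by (simp add: norm_divide)
    ultimately show ?thesis unfolding same using c by (simp add: c_def field_simps)
  qed
qed

text \<open>The squared norm of \<open>S y\<close> is the pairing of \<open>T (S y)\<close> with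
  \<open>y\<close>; Cauchy-Schwarz and cancellation of one factor transfer the bound.\<close>

lemma adjp_opb:
  assumes a: "adjp P T S" and b: "opb P T C" "0 \<le> C"
  shows "opb P S C"
  unfolding opb_def
proof (intro ballI allI)
  fix y k assume y: "y \<in> fock P"
  note Sy = adjpD(2)[OF a y]
  have "(nrm (col k (S y)))\<^sup>2 = cmod (ip (col k (S y)) (col k (S y)))"
    by (subst ip_self[OF fock_l2[OF Sy]]) (simp add: norm_power)
  also have "\<dots> = cmod (ip (col k (T (S y))) (col k y))" using adjpD(5)[OF a Sy y] by simp
  also have "\<dots> \<le> nrm (col k (T (S y))) * nrm (col k y)"
    by (rule ip_bound[OF fock_l2[OF adjpD(1)[OF a Sy]] fock_l2[OF y]])
  also have "\<dots> \<le> (C * nrm (col k (S y))) * nrm (col k y)"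
    using b(1) Sy by (intro mult_right_mono) (auto simp: opb_def)
  finally have "nrm (col k (S y)) * nrm (col k (S y)) \<le> nrm (col k (S y)) * (C * nrm (col k y))"
    by (simp add: power2_eq_square mult_ac)
  thus "nrm (col k (S y)) \<le> C * nrm (col k y)"
    by (cases "nrm (col k (S y)) = 0")
      (use b(2) nrm_nonneg[of "col k (S y)"] in \<open>auto simp: mult_le_cancel_left\<close>)
qed

lemma adjp_add:
  assumes "adjp P T S" "adjp P T' S'"
  shows "adjp P (op_add T T') (op_add S S')"
  unfolding adjp_def
proof (intro conjI ballI allI impI)
  fix x assume "x \<in> fock P"
  thus "op_add T T' x \<in> fock P" "op_add S S' x \<in> fock P"
    unfolding op_add_def by (intro fock_add adjpD[OF assms(1)] adjpD[OF assms(2)]; assumption)+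
next
  fix x assume x: "x \<notin> fock P"
  show "op_add T T' x = fzero" "op_add S S' x = fzero"
    using adjpD(3,4)[OF assms(1) x] adjpD(3,4)[OF assms(2) x] by (auto simp: op_add_def fzero_def)
next
  fix x y k assume x: "x \<in> fock P" and y: "y \<in> fock P"
  note l = fock_l2[OF x] fock_l2[OF y] fock_l2[OF adjpD(1)[OF assms(1) x]] fock_l2[OF adjpD(1)[OF assms(2) x]]
     fock_l2[OF adjpD(2)[OF assms(1) y]] fock_l2[OF adjpD(2)[OF assms(2) y]]
  show "ip (col k (op_add T T' x)) (col k y) = ip (col k x) (col k (op_add S S' y))"
    unfolding op_add_def
    by (subst (1 2) col_add)
      (simp only: ip_add_left[OF l(2) l(3,4)] ip_add_right[OF l(1) l(5,6)]
         adjpD(5)[OF assms(1) x y] adjpD(5)[OF assms(2) x y])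
qed

lemma adjp_scale:
  assumes "adjp P T S"
  shows "adjp P (op_scale c T) (op_scale (cnj c) S)"
  unfolding adjp_def
proof (intro conjI ballI allI impI)
  fix x assume "x \<in> fock P"
  thus "op_scale c T x \<in> fock P" "op_scale (cnj c) S x \<in> fock P"
    unfolding op_scale_def by (intro fock_scale adjpD[OF assms(1)]; assumption)+
next
  fix x assume x: "x \<notin> fock P"
  show "op_scale c T x = fzero" "op_scale (cnj c) S x = fzero"
    using adjpD(3,4)[OF assms(1) x] by (auto simp: op_scale_def fzero_def)
next
  fix x y k assume x: "x \<in> fock P" and y: "y \<in> fock P"
  show "ip (col k (op_scale c T x)) (col k y) = ip (col k x) (col k (op_scale (cnj c) S y))"
    unfolding op_scale_def
    by (subst (1 2) col_scale)
      (simp only: ip_scale_left ip_scale_right adjpD(5)[OF assms(1) x y])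
qed

lemma op_diff_eq: "op_diff T S = op_add T (op_scale (-1) S)"
  by (auto simp: op_diff_def op_add_def op_scale_def fun_eq_iff)

lemma adjp_diff: "adjp P T S \<Longrightarrow> adjp P T' S' \<Longrightarrow> adjp P (op_diff T T') (op_diff S S')"
  using adjp_add[OF _ adjp_scale[of P T' S' "-1"]] by (simp add: op_diff_eq)

lemma adjp_comp:
  assumes "adjp P T S" "adjp P T' S'"
  shows "adjp P (T \<circ> T') (S' \<circ> S)"
  unfolding adjp_def o_def
proof (intro conjI ballI allI impI)
  fix x assume "x \<in> fock P"
  thus "T (T' x) \<in> fock P" "S' (S x) \<in> fock P"
    by (intro adjpD[OF assms(1)] adjpD[OF assms(2)]; assumption)+
next
  fix x assume x: "x \<notin> fock P"
  show "T (T' x) = fzero" "S' (S x) = fzero"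
    using Lops_fzero[OF adjp_Lops[OF assms(1)]] Lops_fzero[OF adjp_Lops[OF adjp_sym[OF assms(2)]]]
    by (simp_all add: adjpD(3)[OF assms(2) x] adjpD(4)[OF assms(1) x])
next
  fix x y k assume x: "x \<in> fock P" and y: "y \<in> fock P"
  show "ip (col k (T (T' x))) (col k y) = ip (col k x) (col k (S' (S y)))"
    using adjpD(5)[OF assms(1) adjpD(1)[OF assms(2) x] y] adjpD(5)[OF assms(2) x adjpD(2)[OF assms(1) y]]
    by simp
qed

lemma adjp_zero: "adjp P (\<lambda>x. fzero) (\<lambda>x. fzero)"
  unfolding adjp_def by (simp add: ip_def fzero_def split_def) (simp add: fzero_def[symmetric])

definition op_sum :: "'s set \<Rightarrow> ('s \<Rightarrow> 'a fop) \<Rightarrow> 'a fop" where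
  "op_sum I T = (\<lambda>x n i k. \<Sum>s\<in>I. T s x n i k)"

lemma op_sum_empty: "op_sum {} T = (\<lambda>x. fzero)"
  by (simp add: op_sum_def fzero_def)

lemma op_sum_insert: "finite I \<Longrightarrow> s \<notin> I \<Longrightarrow> op_sum (insert s I) T = op_add (T s) (op_sum I T)"
  by (simp add: op_sum_def op_add_def)

lemma adjp_op_sum:
  assumes "finite I" "\<And>s. s \<in> I \<Longrightarrow> adjp P (T s) (S s)"
  shows "adjp P (op_sum I T) (op_sum I S)"
  using assms by (induction I rule: finite_induct) (auto simp: op_sum_empty op_sum_insert adjp_zero adjp_add)

lemma Lops_closed:
  "T \<in> Lops P \<Longrightarrow> S \<in> Lops P \<Longrightarrow> op_add T S \<in> Lops P"
  "T \<in> Lops P \<Longrightarrow> S \<in> Lops P \<Longrightarrow> op_diff T S \<in> Lops P"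
  "T \<in> Lops P \<Longrightarrow> S \<in> Lops P \<Longrightarrow> T \<circ> S \<in> Lops P"
  "T \<in> Lops P \<Longrightarrow> op_scale c T \<in> Lops P"
  using adjp_Lops adjp_add adjp_diff adjp_comp adjp_scale Lops_adjp by meson+

lemma adj_simps:
  "T \<in> Lops P \<Longrightarrow> S \<in> Lops P \<Longrightarrow> adj P (op_add T S) = op_add (adj P T) (adj P S)"
  "T \<in> Lops P \<Longrightarrow> S \<in> Lops P \<Longrightarrow> adj P (op_diff T S) = op_diff (adj P T) (adj P S)"
  "T \<in> Lops P \<Longrightarrow> S \<in> Lops P \<Longrightarrow> adj P (T \<circ> S) = adj P S \<circ> adj P T"
  "T \<in> Lops P \<Longrightarrow> adj P (op_scale c T) = op_scale (cnj c) (adj P T)"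
  using adjp_adj adjp_add adjp_diff adjp_comp adjp_scale Lops_adjp by meson+

lemma opnorm_adj: "T \<in> Lops P \<Longrightarrow> opnorm P (adj P T) \<le> opnorm P T"
  using opnorm_le[OF Lops_fock[OF adj_Lops] adjp_opb[OF Lops_adjp opb_opnorm opnorm_nonneg] opnorm_nonneg]
  by blast

section \<open>Completeness of the adjointable operators\<close>

lemma Lops_limit_fock:
  fixes X :: "nat \<Rightarrow> 'a::finite fop"
  assumes X: "\<And>s. X s \<in> Lops P"
    and cau: "\<And>e. e > 0 \<Longrightarrow> \<exists>N. \<forall>s\<ge>N. \<forall>t\<ge>N. opb P (op_diff (X s) (X t)) e"
  obtains T where "\<And>x. x \<in> fock P \<Longrightarrow> T x \<in> fock P" "\<And>x. x \<notin> fock P \<Longrightarrow> T x = fzero"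
    "\<And>e. e > 0 \<Longrightarrow> \<exists>N. \<forall>s\<ge>N. opb P (op_diff (X s) T) e"
proof -
  have conv: "convergent (\<lambda>s. X s x n i k)" if x: "x \<in> fock P" for x n i k
  proof (rule Cauchy_convergent, rule metric_CauchyI)
    fix e :: real assume e: "e > 0"
    define d where "d = e / (nrm (col k x) + 1)"
    have p: "nrm (col k x) + 1 > 0" using nrm_nonneg[of "col k x"] by linarith
    have d: "d > 0" using e p by (simp add: d_def)
    have dn: "d * nrm (col k x) < e"
    proof -
      have "d * nrm (col k x) < d * (nrm (col k x) + 1)" using d by simp
      also have "\<dots> = e" using p by (simp add: d_def)
      finally show ?thesis .
    qed
    from cau[OF d] obtain N where N: "\<And>s t. s \<ge> N \<Longrightarrow> t \<ge> N \<Longrightarrow> opb P (op_diff (X s) (X t)) d" by blast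
    show "\<exists>M. \<forall>m\<ge>M. \<forall>n'\<ge>M. dist (X m x n i k) (X n' x n i k) < e"
    proof (intro exI[of _ N] allI impI)
      fix s t assume st: "s \<ge> N" "t \<ge> N"
      have "cmod (col k (op_diff (X s) (X t) x) (n, i)) \<le> nrm (col k (op_diff (X s) (X t) x))"
        by (rule cmod_le_nrm[OF fock_l2[OF Lops_fock[OF Lops_closed(2)[OF X X] x]]])
      also have "\<dots> \<le> d * nrm (col k x)" using N[OF st] x by (simp add: opb_def)
      finally show "dist (X s x n i k) (X t x n i k) < e" using dn by (simp add: dist_norm op_diff_def)
    qed
  qed
  define T where "T x = (if x \<in> fock P then (\<lambda>n i k. lim (\<lambda>s. X s x n i k)) else fzero)" for x
  have lim: "(\<lambda>s. X s x n i k) \<longlonglongrightarrow> T x n i k" if "x \<in> fock P" for x n i k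
    using conv[OF that] that by (simp add: T_def convergent_LIMSEQ_iff)
  \<comment> \<open>In the Cauchy estimate \<open>s\<close> stays fixed while the other index tends
    to infinity, and \<open>l2_fatou\<close> keeps the bound.\<close>
  have main: "l2 (col k (op_diff (X s) T x)) \<and> nrm (col k (op_diff (X s) T x)) \<le> e * nrm (col k x)"
    if x: "x \<in> fock P" and N: "\<And>s t. s \<ge> N \<Longrightarrow> t \<ge> N \<Longrightarrow> opb P (op_diff (X s) (X t)) e" and s: "s \<ge> N"
    for x e N s k
  proof -
    have 1: "l2 (col k (op_diff (X s) (X t) x))" for t
      by (rule fock_l2[OF Lops_fock[OF Lops_closed(2)[OF X X] x]])
    have 2: "nrm (col k (op_diff (X s) (X t) x)) \<le> e * nrm (col k x)" if "t \<ge> N" for t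
      using N[OF s that] x by (simp add: opb_def)
    have 3: "(\<lambda>t. col k (op_diff (X s) (X t) x) a) \<longlonglongrightarrow> col k (op_diff (X s) T x) a" for a
      unfolding op_diff_def by (cases a) (auto intro!: tendsto_intros lim x)
    show ?thesis
      using l2_fatou[OF 1 2 3] by blast
  qed
  have TF: "T x \<in> fock P" if x: "x \<in> fock P" for x
  proof -
    obtain N where N: "\<And>s t. s \<ge> N \<Longrightarrow> t \<ge> N \<Longrightarrow> opb P (op_diff (X s) (X t)) 1" using cau[of 1] by auto
    have l: "l2 (col k (T x))" for k
    proof -
      have "col k (T x) = (\<lambda>a. col k (X N x) a - col k (op_diff (X N) T x) a)"
        by (auto simp: op_diff_def)
      thus ?thesis
        using l2_diff(1)[OF fock_l2[OF Lops_fock[OF X x]] conjunct1[OF main[OF x N order_refl]]] by simp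
    qed
    have "T x n i k = 0" if "matpow P n i k = 0" for n i k
    proof -
      have "(\<lambda>s. X s x n i k) = (\<lambda>s. 0)" using fock_zero[OF Lops_fock[OF X x] that] by auto
      thus ?thesis using lim[OF x, of n i k] by (simp add: LIMSEQ_const_iff)
    qed
    thus ?thesis unfolding fock_iff using l by blast
  qed
  show thesis
  proof (rule that[of T])
    fix e :: real assume "e > 0"
    from cau[OF this] obtain N where N: "\<And>s t. s \<ge> N \<Longrightarrow> t \<ge> N \<Longrightarrow> opb P (op_diff (X s) (X t)) e" by blast
    show "\<exists>N. \<forall>s\<ge>N. opb P (op_diff (X s) T) e"
      unfolding opb_def using main[OF _ N] by (intro exI[of _ N]) blast
  qed (auto simp: TF, simp add: T_def)
qed

text \<open>By \<open>adjp_opb\<close> the adjoints of a Cauchy sequence are Cauchy with the same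
  constants, so both sequences converge; passing to the limit in the pairing shows that the two
  limits are adjoint to each other.\<close>

lemma Lops_complete:
  fixes X :: "nat \<Rightarrow> 'a::finite fop"
  assumes X: "\<And>s. X s \<in> Lops P"
    and cau: "\<And>e. e > 0 \<Longrightarrow> \<exists>N. \<forall>s\<ge>N. \<forall>t\<ge>N. opb P (op_diff (X s) (X t)) e"
  obtains T where "T \<in> Lops P" "(\<lambda>s. opnorm P (op_diff (X s) T)) \<longlonglongrightarrow> 0"
proof -
  obtain T where T: "\<And>x. x \<in> fock P \<Longrightarrow> T x \<in> fock P" "\<And>x. x \<notin> fock P \<Longrightarrow> T x = fzero"
    "\<And>e. e > 0 \<Longrightarrow> \<exists>N. \<forall>s\<ge>N. opb P (op_diff (X s) T) e"
    using Lops_limit_fock[OF X cau] by blast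
  define Y where "Y s = adj P (X s)" for s
  have Y: "Y s \<in> Lops P" for s unfolding Y_def by (intro adj_Lops X)
  have cauY: "\<exists>N. \<forall>s\<ge>N. \<forall>t\<ge>N. opb P (op_diff (Y s) (Y t)) e" if e: "e > 0" for e
  proof -
    obtain N where N: "\<And>s t. s \<ge> N \<Longrightarrow> t \<ge> N \<Longrightarrow> opb P (op_diff (X s) (X t)) e" using cau[OF e] by blast
    have "opb P (op_diff (Y s) (Y t)) e" if "s \<ge> N" "t \<ge> N" for s t
      unfolding Y_def using adjp_opb[OF adjp_diff[OF Lops_adjp[OF X] Lops_adjp[OF X]] N[OF that]] e by simp
    thus ?thesis by blast
  qed
  obtain S where S: "\<And>x. x \<in> fock P \<Longrightarrow> S x \<in> fock P" "\<And>x. x \<notin> fock P \<Longrightarrow> S x = fzero"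
    "\<And>e. e > 0 \<Longrightarrow> \<exists>N. \<forall>s\<ge>N. opb P (op_diff (Y s) S) e"
    using Lops_limit_fock[OF Y cauY] by blast
  have "adjp P T S"
    unfolding adjp_def
  proof (intro conjI ballI allI impI)
    fix x y k assume x: "x \<in> fock P" and y: "y \<in> fock P"
    let ?a = "ip (col k (T x)) (col k y)" and ?b = "ip (col k x) (col k (S y))"
    have "cmod (?a - ?b) \<le> e" if e: "e > 0" for e
    proof -
      define M where "M = nrm (col k x) * nrm (col k y)"
      have M: "M \<ge> 0" by (simp add: M_def)
      define d where "d = e / (2 * (M + 1))"
      have d: "d > 0" "2 * d * M \<le> e" using e M by (auto simp: d_def field_simps)
      obtain s where s: "opb P (op_diff (X s) T) d" "opb P (op_diff (Y s) S) d"
        using T(3)[OF d(1)] S(3)[OF d(1)] by (meson linear order_refl order_trans)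
      note l = fock_l2[OF x] fock_l2[OF y] fock_l2[OF T(1)[OF x]] fock_l2[OF S(1)[OF y]]
        fock_l2[OF Lops_fock[OF X x]] fock_l2[OF Lops_fock[OF Y y]]
      have 1: "cmod (ip (col k (X s x)) (col k y) - ?a) \<le> d * M"
      proof -
        have c: "col k (op_diff (X s) T x) = (\<lambda>a. col k (X s x) a - col k (T x) a)"
          by (auto simp: op_diff_def)
        have "cmod (ip (col k (X s x)) (col k y) - ?a) = cmod (ip (col k (op_diff (X s) T x)) (col k y))"
          unfolding c using ip_diff_left[OF l(2) l(5) l(3)] by simp
        also have "\<dots> \<le> nrm (col k (op_diff (X s) T x)) * nrm (col k y)"
          unfolding c by (rule ip_bound[OF l2_diff(1)[OF l(5,3)] l(2)])
        also have "\<dots> \<le> (d * nrm (col k x)) * nrm (col k y)"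
          using s(1) x by (intro mult_right_mono) (auto simp: opb_def)
        finally show ?thesis by (simp add: M_def mult_ac)
      qed
      have 2: "cmod (ip (col k x) (col k (Y s y)) - ?b) \<le> d * M"
      proof -
        have c: "col k (op_diff (Y s) S y) = (\<lambda>a. col k (Y s y) a - col k (S y) a)"
          by (auto simp: op_diff_def)
        have "cmod (ip (col k x) (col k (Y s y)) - ?b) = cmod (ip (col k x) (col k (op_diff (Y s) S y)))"
          unfolding c using ip_diff_right[OF l(1) l(6) l(4)] by simp
        also have "\<dots> \<le> nrm (col k x) * nrm (col k (op_diff (Y s) S y))"
          unfolding c by (rule ip_bound[OF l(1) l2_diff(1)[OF l(6,4)]])
        also have "\<dots> \<le> nrm (col k x) * (d * nrm (col k y))"
          using s(2) y by (intro mult_left_mono) (auto simp: opb_def)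
        finally show ?thesis by (simp add: M_def mult_ac)
      qed
      have 3: "ip (col k (X s x)) (col k y) = ip (col k x) (col k (Y s y))"
        unfolding Y_def using adjpD(5)[OF Lops_adjp[OF X] x y] .
      have "cmod (?a - ?b) \<le> cmod (ip (col k (X s x)) (col k y) - ?a) + cmod (ip (col k x) (col k (Y s y)) - ?b)"
        unfolding 3 by (metis dist_norm dist_triangle3 norm_minus_commute)
      thus ?thesis using 1 2 d(2) by linarith
    qed
    hence "cmod (?a - ?b) \<le> 0" using field_le_epsilon[of "cmod (?a - ?b)" 0] by simp
    thus "?a = ?b" by simp
  qed (use T S in auto)
  hence TL: "T \<in> Lops P" by (rule adjp_Lops)
  have "(\<lambda>s. opnorm P (op_diff (X s) T)) \<longlonglongrightarrow> 0"
  proof (rule LIMSEQ_I)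
    fix e :: real assume "e > 0"
    then obtain N where N: "\<forall>s\<ge>N. opb P (op_diff (X s) T) (e/2)" using T(3)[of "e/2"] by auto
    have "opnorm P (op_diff (X s) T) \<le> e/2" if "s \<ge> N" for s
      using N that \<open>e > 0\<close> Lops_fock[OF Lops_closed(2)[OF X TL]] by (intro opnorm_le) auto
    thus "\<exists>N. \<forall>s\<ge>N. norm (opnorm P (op_diff (X s) T) - 0) < e"
      using \<open>e > 0\<close> opnorm_nonneg[OF Lops_closed(2)[OF X TL]] by (intro exI[of _ N]) fastforce
  qed
  thus thesis using that TL by blast
qed

section \<open>Powers of a stochastic matrix\<close>

lemma matpow_nonneg: "stochastic P \<Longrightarrow> 0 \<le> matpow P n i j"
  by (induction n arbitrary: j) (auto simp: stochastic_def intro!: sum_nonneg)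

lemma matpow_add: "matpow P (m + n) i k = (\<Sum>j\<in>UNIV. matpow P m i j * matpow P n j k)"
proof (induction n arbitrary: k)
  case 0
  have "(\<Sum>j\<in>UNIV. matpow P m i j * (if j = k then 1 else 0)) = (\<Sum>j\<in>UNIV. if j = k then matpow P m i j else 0)"
    by (intro sum.cong) auto
  thus ?case by simp
next
  case (Suc n)
  have "matpow P (m + Suc n) i k = (\<Sum>l\<in>UNIV. (\<Sum>j\<in>UNIV. matpow P m i j * matpow P n j l) * P l k)"
    using Suc by simp
  also have "\<dots> = (\<Sum>l\<in>UNIV. \<Sum>j\<in>UNIV. matpow P m i j * (matpow P n j l * P l k))"
    by (simp add: sum_distrib_right mult.assoc)
  also have "\<dots> = (\<Sum>j\<in>UNIV. \<Sum>l\<in>UNIV. matpow P m i j * (matpow P n j l * P l k))"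
    by (rule sum.swap)
  also have "\<dots> = (\<Sum>j\<in>UNIV. matpow P m i j * matpow P (Suc n) j k)"
    by (simp add: sum_distrib_left)
  finally show ?case .
qed

lemma matpow_row_sum: "stochastic P \<Longrightarrow> (\<Sum>j\<in>UNIV. matpow P n i j) = 1"
proof (induction n)
  case (Suc n)
  have "(\<Sum>j\<in>UNIV. matpow P (Suc n) i j) = (\<Sum>j\<in>UNIV. \<Sum>k\<in>UNIV. matpow P n i k * P k j)" by simp
  also have "\<dots> = (\<Sum>k\<in>UNIV. \<Sum>j\<in>UNIV. matpow P n i k * P k j)" by (rule sum.swap)
  also have "\<dots> = (\<Sum>k\<in>UNIV. matpow P n i k * 1)"
    using Suc.prems by (simp add: sum_distrib_left[symmetric] stochastic_def del: mult_1_right)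
  finally show ?case using Suc by simp
qed simp

lemma matpow_pos_comp:
  assumes "stochastic P" "matpow P m i j > 0" "matpow P n j k > 0"
  shows "matpow P (m + n) i k > 0"
proof -
  have "0 < matpow P m i j * matpow P n j k" using assms by simp
  also have "\<dots> \<le> (\<Sum>j\<in>UNIV. matpow P m i j * matpow P n j k)"
    by (rule member_le_sum) (auto simp: matpow_nonneg assms(1))
  finally show ?thesis by (simp add: matpow_add)
qed

lemma matpow_pos_factor:
  assumes "stochastic P" "matpow P (m + n) i k > 0"
  obtains j where "matpow P m i j > 0" "matpow P n j k > 0"
proof -
  from assms(2) have "(\<Sum>j\<in>UNIV. matpow P m i j * matpow P n j k) \<noteq> 0" by (simp add: matpow_add)
  then obtain j where "matpow P m i j * matpow P n j k \<noteq> 0" using sum.not_neutral_contains_not_neutral by blast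
  thus thesis using that[of j] matpow_nonneg[OF assms(1)] by (simp add: less_le)
qed

lemma matpow_le_1: "stochastic P \<Longrightarrow> matpow P n i j \<le> 1"
  using member_le_sum[of j UNIV "matpow P n i"] by (simp add: matpow_row_sum matpow_nonneg)

lemma matpow_row_pos: "stochastic P \<Longrightarrow> \<exists>j. matpow P n i j > 0"
proof (rule ccontr)
  assume s: "stochastic P" and "\<not> (\<exists>j. matpow P n i j > 0)"
  hence "matpow P n i j = 0" for j using matpow_nonneg[OF s, of n i j] by (meson antisym not_less)
  thus False using matpow_row_sum[OF s, of n i] by simp
qed

lemma matpow_1: "matpow P (Suc 0) i j = P i j"
proof -
  have "(\<Sum>k\<in>UNIV. (if i = k then 1 else 0) * P k j) = (\<Sum>k\<in>UNIV. if k = i then P k j else 0)"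
    by (intro sum.cong) auto
  thus ?thesis by simp
qed

text \<open>Here \<open>r\<close> is the least positive gap between two elements. A nonzero
  remainder modulo \<open>r\<close> would produce a smaller gap, so \<open>r\<close> divides every
  element; conversely, for a pair \<open>b\<close>, \<open>b + r\<close> that realises the gap, the
  combinations \<open>(q - s) * b + s * (b + r)\<close> give all large multiples of
  \<open>r\<close>.\<close>

lemma additive_nat_set_eventually_multiples:
  fixes A :: "nat set"
  assumes z: "0 \<in> A" and add: "\<And>a b. a \<in> A \<Longrightarrow> b \<in> A \<Longrightarrow> a + b \<in> A" and pos: "\<exists>a\<in>A. a > 0"
  shows "\<exists>r>0. (\<forall>a\<in>A. r dvd a) \<and> (\<exists>N. \<forall>n\<ge>N. r dvd n \<longrightarrow> n \<in> A)"
proof -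
  have mult: "q * a \<in> A" if "a \<in> A" for q a by (induction q) (auto simp: z add that)
  define r where "r = (LEAST d. d > 0 \<and> (\<exists>b\<in>A. b + d \<in> A))"
  have "\<exists>d. d > 0 \<and> (\<exists>b\<in>A. b + d \<in> A)" using pos z by (metis add_0)
  hence r0: "r > 0 \<and> (\<exists>b\<in>A. b + r \<in> A)" unfolding r_def by (rule LeastI_ex)
  have rl: "r \<le> d" if "d > 0" "b \<in> A" "b + d \<in> A" for d b
    unfolding r_def using that by (intro Least_le) auto
  obtain b where b: "b \<in> A" "b + r \<in> A" using r0 by blast
  have rd: "r dvd a" if a: "a \<in> A" for a
  proof (rule ccontr)
    assume "\<not> r dvd a"
    hence s: "a mod r > 0" by (simp add: dvd_eq_mod_eq_0)
    define q where "q = a div r"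
    have "q * (b + r) + a mod r = a + q * b" unfolding q_def by (simp add: algebra_simps)
    hence "q * (b + r) + a mod r \<in> A" using add[OF a mult[OF b(1), of q]] by simp
    from rl[OF s mult[OF b(2), of q] this] show False using r0 mod_less_divisor[of r a] by linarith
  qed
  obtain c where c: "b = r * c" using rd[OF b(1)] by auto
  \<comment> \<open>The threshold \<open>c * c\<close> makes the quotient of \<open>t\<close> by
    \<open>c\<close> at least \<open>c\<close>, hence larger than the remainder, so that the natural
    subtraction \<open>q - s\<close> is not truncated.\<close>
  have "n \<in> A" if n: "n \<ge> r * (c * c)" "r dvd n" for n
  proof -
    obtain t where t: "n = r * t" using n(2) by auto
    have tc: "t \<ge> c * c" using n(1) r0 unfolding t by simp
    show ?thesis
    proof (cases "c = 0")
      case True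
      hence "r \<in> A" using b c by simp
      thus ?thesis using mult[of r t] t by (simp add: mult.commute)
    next
      case False
      define q s where "q = t div c" and "s = t mod c"
      have "s < c" using False by (simp add: s_def)
      moreover have "c \<le> q" using False tc by (simp add: q_def less_eq_div_iff_mult_less_eq)
      ultimately have sq: "s \<le> q" by simp
      have "t = c * q + s" by (simp add: q_def s_def)
      moreover obtain u where u: "q = s + u" using sq le_Suc_ex by blast
      ultimately have "n = (q - s) * b + s * (b + r)" unfolding t c by (simp add: algebra_simps)
      thus ?thesis using add[OF mult[OF b(1), of "q - s"] mult[OF b(2), of s]] by simp
    qed
  qed
  thus ?thesis using r0 rd by blast
qed

text \<open>\<open>r\<close> is the period of the class of a state and \<open>s\<close> a cyclic phase: \<open>P\<close> moves the phase
  forward by one modulo the period.\<close>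

locale phased =
  fixes P :: "'a::finite \<Rightarrow> 'a \<Rightarrow> real" and R :: "'a \<Rightarrow> 'a \<Rightarrow> bool" and r s :: "'a \<Rightarrow> int"
  assumes stoch: "stochastic P" and eqR: "equivp R" and r_pos: "r i > 0"
    and r_eq: "R i j \<Longrightarrow> r i = r j"
    and pos_phase: "matpow P n i j > 0 \<Longrightarrow> R i j \<and> r i dvd int n + s i - s j"
    and eventually_pos: "\<exists>N. \<forall>n\<ge>N. \<forall>i j. R i j \<longrightarrow> r i dvd int n + s i - s j \<longrightarrow> matpow P n i j > 0"
begin

lemma R_refl [simp]: "R i i" using eqR by (simp add: equivp_reflp)
lemma R_sym: "R i j \<Longrightarrow> R j i" using eqR by (rule equivp_symp)
lemma R_trans: "R i j \<Longrightarrow> R j k \<Longrightarrow> R i k" using eqR by (rule equivp_transp)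

text \<open>The states from which \<open>k\<close> can be reached in \<open>m\<close> steps as far
  as block and phase decide; for large \<open>m\<close> they are exactly those with
  \<open>matpow P m j k > 0\<close>.\<close>

definition allowed :: "'a \<Rightarrow> nat \<Rightarrow> 'a \<Rightarrow> bool" where
  "allowed k m j \<longleftrightarrow> R j k \<and> r j dvd int m + s j - s k"

lemma allowed_back: "matpow P n i j > 0 \<Longrightarrow> allowed k (m + n) i \<Longrightarrow> allowed k m j"
proof -
  assume p: "matpow P n i j > 0" and a: "allowed k (m + n) i"
  from pos_phase[OF p] a have "R i j" "r i dvd int n + s i - s j" "R i k" "r i dvd int (m + n) + s i - s k"
    by (auto simp: allowed_def)
  note h = this
  have "r i dvd (int (m + n) + s i - s k) - (int n + s i - s j)" by (rule dvd_diff[OF h(4,2)])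
  also have "(int (m + n) + s i - s k) - (int n + s i - s j) = int m + s j - s k" by simp
  finally show ?thesis unfolding allowed_def using r_eq[OF h(1)] R_trans[OF R_sym[OF h(1)] h(3)] by simp
qed

lemma allowed_edge: "N \<le> n \<Longrightarrow> \<forall>n\<ge>N. \<forall>i j. R i j \<longrightarrow> r i dvd int n + s i - s j \<longrightarrow> matpow P n i j > 0 \<Longrightarrow>
  allowed k (m + n) i \<Longrightarrow> allowed k m j \<Longrightarrow> matpow P n i j > 0"
proof -
  assume N: "N \<le> n" "\<forall>n\<ge>N. \<forall>i j. R i j \<longrightarrow> r i dvd int n + s i - s j \<longrightarrow> matpow P n i j > 0"
    and a: "allowed k (m + n) i" "allowed k m j"
  have R: "R i k" "R j k" using a by (auto simp: allowed_def)
  hence Rij: "R i j" using R_sym R_trans by blast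
  have "r i dvd (int (m + n) + s i - s k) - (int m + s j - s k)"
    by (rule dvd_diff) (use a r_eq[OF Rij] in \<open>simp_all add: allowed_def\<close>)
  hence "r i dvd int n + s i - s j" by (simp add: algebra_simps)
  thus ?thesis using N Rij by blast
qed

lemma matpow_allowed: "matpow P m j k > 0 \<Longrightarrow> allowed k m j"
  using pos_phase unfolding allowed_def by blast

section \<open>Convergence of the columns of the powers\<close>

definition boxed :: "'a \<Rightarrow> nat \<Rightarrow> real \<Rightarrow> real \<Rightarrow> bool" where
  "boxed k m a b \<longleftrightarrow> (\<forall>j. allowed k m j \<longrightarrow> a \<le> matpow P m j k \<and> matpow P m j k \<le> b)"

text \<open>Entries in column \<open>k\<close> of a later power are averages of entries of an
  earlier one, since rows sum to 1, and by \<open>allowed_back\<close> only allowed states enter the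
  average.\<close>

lemma boxed_mono:
  assumes w: "boxed k m a b"
  shows "boxed k (m + n) a b"
  unfolding boxed_def
proof (intro allI impI)
  fix i assume i: "allowed k (m + n) i"
  have eq: "matpow P (m + n) i k = (\<Sum>j\<in>UNIV. matpow P n i j * matpow P m j k)"
    using matpow_add[of P n m i k] by (simp add: add.commute)
  have t: "matpow P n i j * a \<le> matpow P n i j * matpow P m j k \<and>
      matpow P n i j * matpow P m j k \<le> matpow P n i j * b" for j
  proof (cases "matpow P n i j > 0")
    case True
    thus ?thesis using w allowed_back[OF True i] unfolding boxed_def by (auto intro: mult_left_mono)
  next
    case False
    thus ?thesis using matpow_nonneg[OF stoch, of n i j] by simp
  qed
  have "(\<Sum>j\<in>UNIV. matpow P n i j * a) \<le> matpow P (m + n) i k"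
    "matpow P (m + n) i k \<le> (\<Sum>j\<in>UNIV. matpow P n i j * b)"
    unfolding eq using t by (auto intro!: sum_mono)
  thus "a \<le> matpow P (m + n) i k \<and> matpow P (m + n) i k \<le> b"
    by (simp add: sum_distrib_right[symmetric] matpow_row_sum[OF stoch])
qed

text \<open>Doeblin's argument: every allowed row of the \<open>N\<close>-th power puts weight at
  least \<open>d\<close> on one fixed allowed state \<open>j0\<close>, which pulls both ends of the
  interval towards the value \<open>c\<close> found there. The total shortening is
  \<open>d * (b - a)\<close> wherever \<open>c\<close> lies.\<close>

lemma boxed_contract:
  assumes w: "boxed k m a b" and ab: "a \<le> b" and d: "0 < d" "d \<le> 1"
    and N: "\<forall>n\<ge>N. \<forall>i j. R i j \<longrightarrow> r i dvd int n + s i - s j \<longrightarrow> matpow P n i j > 0"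
    and dl: "\<And>i j. matpow P N i j > 0 \<Longrightarrow> d \<le> matpow P N i j"
  shows "\<exists>a' b'. a \<le> a' \<and> a' \<le> b' \<and> b' - a' \<le> (1 - d) * (b - a) \<and> boxed k (m + N) a' b'"
proof (cases "\<exists>j. allowed k m j")
  case False
  \<comment> \<open>With no allowed state in degree \<open>m\<close> there is none in degree
    \<open>m + N\<close> either, and a degenerate interval works vacuously.\<close>
  have "\<not> allowed k (m + N) i" for i
    using matpow_row_pos[OF stoch, of N i] allowed_back False by blast
  hence "boxed k (m + N) a a" by (simp add: boxed_def)
  thus ?thesis using ab d by (intro exI[of _ a]) auto
next
  case True
  then obtain j0 where j0: "allowed k m j0" by blast
  define c where "c = matpow P m j0 k"
  have c: "a \<le> c" "c \<le> b" using w j0 by (auto simp: boxed_def c_def)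
  have "boxed k (m + N) (a + d * (c - a)) (b - d * (b - c))"
    unfolding boxed_def
  proof (intro allI impI)
    fix i assume i: "allowed k (m + N) i"
    have eq: "matpow P (m + N) i k = (\<Sum>j\<in>UNIV. matpow P N i j * matpow P m j k)"
      using matpow_add[of P N m i k] by (simp add: add.commute)
    have t: "0 \<le> matpow P N i j * (matpow P m j k - a) \<and> 0 \<le> matpow P N i j * (b - matpow P m j k)" for j
    proof (cases "matpow P N i j > 0")
      case True
      thus ?thesis using w allowed_back[OF True i] unfolding boxed_def by auto
    next
      case False
      thus ?thesis using matpow_nonneg[OF stoch, of N i j] by simp
    qed
    have dj: "d \<le> matpow P N i j0" using allowed_edge[OF order_refl N i j0] dl by blast
    have "d * (c - a) \<le> matpow P N i j0 * (matpow P m j0 k - a)"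
      using dj c by (auto simp: c_def intro: mult_right_mono)
    also have "\<dots> \<le> (\<Sum>j\<in>UNIV. matpow P N i j * (matpow P m j k - a))"
      using t by (intro member_le_sum) auto
    also have "\<dots> = matpow P (m + N) i k - a"
      by (simp add: eq right_diff_distrib sum_subtractf sum_distrib_right[symmetric] matpow_row_sum[OF stoch])
    finally have 1: "a + d * (c - a) \<le> matpow P (m + N) i k" by simp
    have "d * (b - c) \<le> matpow P N i j0 * (b - matpow P m j0 k)"
      using dj c by (auto simp: c_def intro: mult_right_mono)
    also have "\<dots> \<le> (\<Sum>j\<in>UNIV. matpow P N i j * (b - matpow P m j k))"
      using t by (intro member_le_sum) auto
    also have "\<dots> = b - matpow P (m + N) i k"
      by (simp add: eq right_diff_distrib sum_subtractf sum_distrib_right[symmetric] matpow_row_sum[OF stoch])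
    finally show "a + d * (c - a) \<le> matpow P (m + N) i k \<and> matpow P (m + N) i k \<le> b - d * (b - c)"
      using 1 by simp
  qed
  moreover have "(b - d * (b - c)) - (a + d * (c - a)) = (1 - d) * (b - a)" by (simp add: algebra_simps)
  moreover from this have "a + d * (c - a) \<le> b - d * (b - c)"
    using d ab mult_nonneg_nonneg[of "1 - d" "b - a"] by linarith
  moreover have "a \<le> a + d * (c - a)" using c d by simp
  ultimately show ?thesis by (intro exI[of _ "a + d * (c - a)"] exI[of _ "b - d * (b - c)"]) auto
qed

text \<open>Both entries lie in one interval, whose length shrinks geometrically while its lower end
  stays above \<open>d\<close>; hence their quotient is near 1, uniformly in \<open>n\<close> and in
  the states. All limits of shift coefficients come from here.\<close>

lemma weight_limit:
  assumes e: "e > 0"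
  shows "\<exists>N. \<forall>m\<ge>N. \<forall>n i j k. matpow P n i j > 0 \<longrightarrow> matpow P m j k > 0 \<longrightarrow>
     \<bar>sqrt (matpow P m j k) / sqrt (matpow P (n + m) i k) - 1\<bar> \<le> e"
proof -
  obtain N where N: "\<forall>n\<ge>N. \<forall>i j. R i j \<longrightarrow> r i dvd int n + s i - s j \<longrightarrow> matpow P n i j > 0"
    using eventually_pos by blast
  \<comment> \<open>Inserting 1 keeps the set nonempty and gives \<open>d \<le> 1\<close>.\<close>
  define S where "S = insert 1 {matpow P N i j | i j. matpow P N i j > 0}"
  have "{matpow P N i j | i j. matpow P N i j > 0} \<subseteq> (\<lambda>(i, j). matpow P N i j) ` UNIV" by auto
  from finite_subset[OF this] have fS: "finite S" unfolding S_def by simp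
  define d where "d = Min S"
  have d: "0 < d" "d \<le> 1" unfolding d_def using fS by (auto simp: S_def)
  have dl: "d \<le> matpow P N i j" if "matpow P N i j > 0" for i j
    unfolding d_def using fS that by (intro Min_le) (auto simp: S_def)
  have iter: "\<exists>a b. d \<le> a \<and> a \<le> b \<and> b - a \<le> (1 - d)^t \<and> boxed k (N + t * N) a b" for t k
  proof (induction t)
    case 0
    have "boxed k N d 1" unfolding boxed_def
      using N dl matpow_le_1[OF stoch] unfolding allowed_def by blast
    thus ?case using d by (intro exI[of _ d] exI[of _ 1]) auto
  next
    case (Suc t)
    then obtain a b where ab: "d \<le> a" "a \<le> b" "b - a \<le> (1 - d)^t" "boxed k (N + t * N) a b" by blast
    obtain a' b' where a': "a \<le> a'" "a' \<le> b'" "b' - a' \<le> (1 - d) * (b - a)" "boxed k (N + t * N + N) a' b'"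
      using boxed_contract[OF ab(4,2) d N dl] by blast
    have "(1 - d) * (b - a) \<le> (1 - d) * (1 - d)^t" using ab d by (intro mult_left_mono) auto
    thus ?case using ab a' by (intro exI[of _ a'] exI[of _ b']) (auto simp: add_ac)
  qed
  have "(\<lambda>t. (1 - d)^t) \<longlonglongrightarrow> 0" using d by (intro LIMSEQ_realpow_zero) auto
  from order_tendstoD(2)[OF this, of "e * d"] obtain t where t: "(1 - d)^t < e * d"
    using e d by (auto simp: eventually_sequentially)
  show ?thesis
  proof (intro exI[of _ "N + t * N"] allI impI)
    fix m n i j k
    assume m: "N + t * N \<le> m" and p: "matpow P n i j > 0" "matpow P m j k > 0"
    obtain a b where ab: "d \<le> a" "a \<le> b" "b - a \<le> (1 - d)^t" "boxed k (N + t * N) a b" using iter by blast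
    define x y where "x = matpow P m j k" and "y = matpow P (n + m) i k"
    have py: "y > 0" unfolding y_def by (rule matpow_pos_comp[OF stoch p])
    have "boxed k m a b" using boxed_mono[OF ab(4), of "m - (N + t * N)"] m by simp
    hence x: "a \<le> x" "x \<le> b" using matpow_allowed[OF p(2)] by (auto simp: boxed_def x_def)
    have "boxed k (n + m) a b" using boxed_mono[OF ab(4), of "n + m - (N + t * N)"] m by simp
    hence y: "a \<le> y" "y \<le> b" using matpow_allowed[of "n + m" i k] py by (auto simp: boxed_def y_def)
    define q where "q = sqrt (x / y)"
    have q: "q \<ge> 0" "q * q = x / y" using py p(2) by (auto simp: q_def x_def)
    \<comment> \<open>The square root is removed by the factor \<open>q + 1\<close>, which is at
      least 1.\<close>
    have "\<bar>q - 1\<bar> \<le> \<bar>q - 1\<bar> * (q + 1)" using q(1) by (simp add: mult_le_cancel_left1)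
    also have "\<dots> = \<bar>(q - 1) * (q + 1)\<bar>" using q(1) by (simp add: abs_mult)
    also have "(q - 1) * (q + 1) = x / y - 1" using q(2) by (simp add: algebra_simps)
    also have "x / y - 1 = (x - y) / y" using py by (simp add: field_simps)
    also have "\<bar>(x - y) / y\<bar> = \<bar>x - y\<bar> / y" using py by simp
    also have "\<dots> \<le> (e * d) / d" using x y ab d t by (intro frac_le) auto
    also have "\<dots> = e" using d by simp
    finally show "\<bar>sqrt (matpow P m j k) / sqrt (matpow P (n + m) i k) - 1\<bar> \<le> e"
      by (simp add: q_def x_def y_def real_sqrt_divide)
  qed
qed

end

section \<open>Periods and phases of a block decomposition\<close>

lemma path_matpow_pos:
  assumes s: "stochastic P"
  shows "xs \<noteq> [] \<Longrightarrow> \<forall>k < length xs - 1. P (xs ! k) (xs ! Suc k) > 0 \<Longrightarrow>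
    matpow P (length xs - 1) (hd xs) (last xs) > 0"
proof (induction xs rule: induct_list012)
  case (3 x y zs)
  have "P x y > 0" using 3(4)[rule_format, of 0] by simp
  hence 1: "matpow P 1 x y > 0" using matpow_1[of P x y] by simp
  have "\<forall>k < length (y # zs) - 1. P ((y # zs) ! k) ((y # zs) ! Suc k) > 0"
    using 3(4) by (auto dest: spec[of _ "Suc _"])
  hence "matpow P (length (y # zs) - 1) (hd (y # zs)) (last (y # zs)) > 0" using 3(2) by blast
  hence "matpow P (1 + (length (y # zs) - 1)) x (last (y # zs)) > 0"
    using matpow_pos_comp[OF s 1] by simp
  thus ?case by simp
qed auto

definition same_block :: "'a set list \<Rightarrow> 'a \<Rightarrow> 'a \<Rightarrow> bool" where
  "same_block Bs i j \<longleftrightarrow> (\<exists>B\<in>set Bs. i \<in> B \<and> j \<in> B)"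

lemma equivp_same_block:
  assumes "irred_block_decomp P Bs"
  shows "equivp (same_block Bs)"
proof (rule equivpI)
  show "reflp (same_block Bs)"
  proof (rule reflpI)
    fix i
    have "i \<in> \<Union>(set Bs)" using assms by (simp add: irred_block_decomp_def)
    thus "same_block Bs i i" unfolding same_block_def by simp
  qed
  show "symp (same_block Bs)" by (rule sympI) (auto simp: same_block_def)
  show "transp (same_block Bs)"
  proof (rule transpI)
    fix i j k assume "same_block Bs i j" "same_block Bs j k"
    then obtain a b where ab: "a < length Bs" "b < length Bs" "i \<in> Bs ! a" "j \<in> Bs ! a" "j \<in> Bs ! b" "k \<in> Bs ! b"
      by (auto simp: same_block_def in_set_conv_nth)
    have "\<forall>k<length Bs. \<forall>k'<length Bs. k \<noteq> k' \<longrightarrow> Bs ! k \<inter> Bs ! k' = {}"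
      using assms by (simp add: irred_block_decomp_def)
    hence "a = b" using ab by (metis IntI empty_iff)
    hence "Bs ! a \<in> set Bs \<and> i \<in> Bs ! a \<and> k \<in> Bs ! a" using ab by simp
    thus "same_block Bs i k" unfolding same_block_def by blast
  qed
qed

text \<open>Each block gets a base state. Its return times form an additive set, whose generator is
  the period of the block, and the phase of \<open>i\<close> is the length \<open>f i\<close> of a
  chosen path from the base state to \<open>i\<close>. Return paths of length \<open>g i\<close>
  close the paths to loops at the base state.\<close>

lemma phased_exists:
  fixes P :: "'a::finite \<Rightarrow> 'a \<Rightarrow> real"
  assumes st: "stochastic P" and bd: "irred_block_decomp P Bs"
  shows "\<exists>r s. phased P (same_block Bs) r s"
proof -
  let ?R = "same_block Bs"
  note eq = equivp_same_block[OF bd]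
  note refl = equivp_reflp[OF eq] and sym = equivp_symp[OF eq] and trans = equivp_transp[OF eq]
  have posR: "?R i j" if "matpow P n i j > 0" for n i j
    using that
  proof (induction n arbitrary: j)
    case 0 thus ?case using refl by (auto split: if_splits)
  next
    case (Suc n)
    from Suc.prems have "matpow P (n + 1) i j > 0" by simp
    then obtain l where l: "matpow P n i l > 0" "matpow P 1 l j > 0" by (rule matpow_pos_factor[OF st])
    have "P l j \<noteq> 0" using l(2) matpow_1[of P l j] by simp
    hence "?R l j" using bd by (simp add: irred_block_decomp_def same_block_def)
    thus ?case using Suc.IH[OF l(1)] trans by blast
  qed
  have conn: "\<exists>n. matpow P n i j > 0" if "?R i j" for i j
  proof -
    obtain B where B: "B \<in> set Bs" "i \<in> B" "j \<in> B" using \<open>?R i j\<close> by (auto simp: same_block_def)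
    hence "path_in P B i j" using bd by (simp add: irred_block_decomp_def irreducible_block_def)
    then obtain xs where "xs \<noteq> []" "hd xs = i" "last xs = j" "\<forall>k < length xs - 1. P (xs ! k) (xs ! Suc k) > 0"
      unfolding path_in_def by blast
    thus ?thesis using path_matpow_pos[OF st, of xs] by blast
  qed
  define A where "A c = {n. matpow P n c c > 0}" for c
  have "\<exists>\<rho>>0. (\<forall>a\<in>A c. \<rho> dvd a) \<and> (\<exists>N. \<forall>n\<ge>N. \<rho> dvd n \<longrightarrow> n \<in> A c)" for c
  proof (rule additive_nat_set_eventually_multiples)
    show "\<exists>a\<in>A c. a > 0"
    proof -
      obtain l where l: "matpow P 1 c l > 0" using matpow_row_pos[OF st] by blast
      obtain n where "matpow P n l c > 0" using conn[OF sym[OF posR[OF l]]] by blast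
      from matpow_pos_comp[OF st l this] show ?thesis unfolding A_def by (intro bexI[of _ "1 + n"]) auto
    qed
  qed (auto simp: A_def intro: matpow_pos_comp[OF st])
  hence "\<forall>c. \<exists>\<rho>. \<rho> > 0 \<and> (\<forall>a\<in>A c. \<rho> dvd a) \<and> (\<exists>N. \<forall>n\<ge>N. \<rho> dvd n \<longrightarrow> n \<in> A c)" by simp
  then obtain \<rho> where \<rho>: "\<forall>c. \<rho> c > 0 \<and> (\<forall>a\<in>A c. \<rho> c dvd a) \<and> (\<exists>N. \<forall>n\<ge>N. \<rho> c dvd n \<longrightarrow> n \<in> A c)"
    by (rule choice[THEN exE])
  hence "\<forall>c. \<exists>N. \<forall>n\<ge>N. \<rho> c dvd n \<longrightarrow> n \<in> A c" by blast
  then obtain M where M: "\<forall>c. \<forall>n\<ge>M c. \<rho> c dvd n \<longrightarrow> n \<in> A c" by (rule choice[THEN exE])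
  \<comment> \<open>The choice depends only on the predicate \<open>?R i\<close>, so equivalent
    states share their base state.\<close>
  define b where "b i = (SOME j. ?R i j)" for i
  have b: "?R i (b i)" for i unfolding b_def using refl by (rule someI)
  have beq: "b i = b j" if "?R i j" for i j
  proof -
    have "?R i = ?R j" using that sym trans by blast
    thus ?thesis by (simp add: b_def)
  qed
  have "\<forall>i. \<exists>n. matpow P n (b i) i > 0" using conn sym b by blast
  then obtain f where f: "\<forall>i. matpow P (f i) (b i) i > 0" by (rule choice[THEN exE])
  have "\<forall>i. \<exists>n. matpow P n i (b i) > 0" using conn b by blast
  then obtain g where g: "\<forall>i. matpow P (g i) i (b i) > 0" by (rule choice[THEN exE])
  have loop: "\<rho> (b i) dvd f i + n + g j" if "matpow P n i j > 0" for n i j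
  proof -
    have "b i = b j" using beq posR that by blast
    hence "f i + n + g j \<in> A (b i)"
      using matpow_pos_comp[OF st matpow_pos_comp[OF st f[rule_format, of i] that] g[rule_format, of j]]
      by (simp add: A_def)
    thus ?thesis using \<rho> by blast
  qed
  \<comment> \<open>\<open>f i + n + g j\<close> and \<open>f j + g j\<close> are both return times;
    their difference no longer contains the return path.\<close>
  have dvdint: "int (\<rho> (b i)) dvd int n + int (f i) - int (f j)" if "matpow P n i j > 0" for n i j
  proof -
    have "b i = b j" using beq posR that by blast
    moreover have "matpow P 0 j j > 0" by simp
    ultimately have "int (\<rho> (b i)) dvd int (f i + n + g j) - int (f j + 0 + g j)"
      using loop[OF that] loop[of 0 j j] by (intro dvd_diff) (simp_all only: int_dvd_int_iff)
    thus ?thesis by (simp add: algebra_simps)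
  qed
  \<comment> \<open>Long enough to travel from \<open>i\<close> to the base state, to loop there
    past every threshold \<open>M\<close>, and to go on to \<open>j\<close>.\<close>
  define N where "N = (\<Sum>i\<in>UNIV. g i) + (\<Sum>i\<in>UNIV. f i) + (\<Sum>c\<in>UNIV. M c)"
  have "phased P ?R (\<lambda>i. int (\<rho> (b i))) (\<lambda>i. int (f i))"
  proof
    show "stochastic P" "equivp ?R" by (rule st, rule eq)
    show "int (\<rho> (b i)) > 0" for i using \<rho> by simp
    show "int (\<rho> (b i)) = int (\<rho> (b j))" if "?R i j" for i j using beq[OF that] by simp
    show "?R i j \<and> int (\<rho> (b i)) dvd int n + int (f i) - int (f j)" if "matpow P n i j > 0" for n i j
      using posR dvdint that by blast
    show "\<exists>N. \<forall>n\<ge>N. \<forall>i j. ?R i j \<longrightarrow> int (\<rho> (b i)) dvd int n + int (f i) - int (f j) \<longrightarrow> matpow P n i j > 0"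
    proof (intro exI[of _ N] allI impI)
      fix n i j assume n: "N \<le> n" and R: "?R i j" and d: "int (\<rho> (b i)) dvd int n + int (f i) - int (f j)"
      have "g i \<le> (\<Sum>i\<in>UNIV. g i)" "f j \<le> (\<Sum>i\<in>UNIV. f i)" "M (b i) \<le> (\<Sum>c\<in>UNIV. M c)"
        by (intro member_le_sum; simp)+
      hence m: "g i + f j + M (b i) \<le> n" using n by (simp add: N_def)
      define m where "m = n - g i - f j"
      have nm: "n = g i + m + f j" "M (b i) \<le> m" using m by (auto simp: m_def)
      have "\<rho> (b i) dvd f i + 0 + g i" by (rule loop) simp
      hence "int (\<rho> (b i)) dvd int (f i + g i)" by (simp only: int_dvd_int_iff add_0_right)
      hence "int (\<rho> (b i)) dvd (int n + int (f i) - int (f j)) - int (f i + g i)" by (rule dvd_diff[OF d])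
      hence "int (\<rho> (b i)) dvd int m" unfolding nm by (simp add: algebra_simps)
      hence "m \<in> A (b i)" using M nm(2) by simp
      hence "matpow P m (b i) (b i) > 0" by (simp add: A_def)
      from matpow_pos_comp[OF st matpow_pos_comp[OF st g[rule_format, of i] this]]
      show "matpow P n i j > 0" using f[rule_format, of j] beq[OF R] nm(1) by simp
    qed
  qed
  thus ?thesis by blast
qed

section \<open>Weighted matrix units and the Toeplitz algebra\<close>

text \<open>The degree shift \<open>q\<close> may be negative, so adjoints have the same form; the
  weight depends on the target degree and the column. The test
  \<open>matpow P n i k \<noteq> 0\<close> keeps the output inside the module.\<close>

definition wunit :: "('a::finite \<Rightarrow> 'a \<Rightarrow> real) \<Rightarrow> 'a \<Rightarrow> 'a \<Rightarrow> int \<Rightarrow> (nat \<Rightarrow> 'a \<Rightarrow> complex) \<Rightarrow> 'a fop" where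
  "wunit P i j q w = (\<lambda>x. if x \<in> fock P then
     (\<lambda>n a k. if a = i \<and> matpow P n i k \<noteq> 0 \<and> q \<le> int n then w n k * x (nat (int n - q)) j k else 0)
     else fzero)"

lemma wunit_apply: "x \<in> fock P \<Longrightarrow> wunit P i j q w x n a k =
   (if a = i \<and> matpow P n i k \<noteq> 0 \<and> q \<le> int n then w n k * x (nat (int n - q)) j k else 0)"
  by (simp add: wunit_def)

lemma wunit_fock:
  assumes b: "\<And>n k. q \<le> int n \<Longrightarrow> cmod (w n k) \<le> C" "0 \<le> C" and x: "x \<in> fock P"
  shows "wunit P i j q w x \<in> fock P" "nrm (col k (wunit P i j q w x)) \<le> C * nrm (col k x)"
proof -
  have inj: "inj_on (\<lambda>(n, a). (nat (int n - q), j)) {(n, a). a = i \<and> q \<le> int n}"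
    by (rule inj_onI) auto
  have le: "cmod (col k (wunit P i j q w x) b) \<le> C * cmod (col k x ((\<lambda>(n, a). (nat (int n - q), j)) b))"
    if "b \<in> {(n, a). a = i \<and> q \<le> int n}" for b k
    using that b by (cases b) (auto simp: wunit_apply[OF x] norm_mult intro!: mult_right_mono)
  have z: "col k (wunit P i j q w x) b = 0" if "b \<notin> {(n, a). a = i \<and> q \<le> int n}" for b k
    using that by (cases b) (auto simp: wunit_apply[OF x])
  have l: "l2 (col k (wunit P i j q w x))" for k
    by (rule l2_dom(1)[OF fock_l2[OF x] b(2) inj le z])
  show "wunit P i j q w x \<in> fock P"
    unfolding fock_iff using l by (auto simp: wunit_apply[OF x])
  show "nrm (col k (wunit P i j q w x)) \<le> C * nrm (col k x)"
    by (rule l2_dom(2)[OF fock_l2[OF x] b(2) inj le z])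
qed

lemma infsum_slice:
  assumes "\<And>a. a \<notin> (\<lambda>n. (n, i)) ` S \<Longrightarrow> f a = 0"
  shows "infsum f UNIV = infsum (\<lambda>n. f (n, i)) S"
proof -
  have "infsum f UNIV = infsum f ((\<lambda>n. (n, i)) ` S)"
    by (rule infsum_cong_neutral) (use assms in auto)
  also have "\<dots> = infsum (f \<circ> (\<lambda>n. (n, i))) S"
    by (rule infsum_reindex) (simp add: inj_on_def)
  finally show ?thesis by (simp add: o_def)
qed

lemma adjp_wunit:
  assumes b: "\<And>n k. q \<le> int n \<Longrightarrow> cmod (w n k) \<le> C" "0 \<le> C"
  shows "adjp P (wunit P i j q w) (wunit P j i (- q) (\<lambda>m k. cnj (w (nat (int m + q)) k)))"
    (is "adjp P ?T ?S")
proof -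
  have b': "cmod (cnj (w (nat (int m + q)) k)) \<le> C" if "- q \<le> int m" for m k
    using b(1)[of "nat (int m + q)" k] that by simp
  show ?thesis
    unfolding adjp_def
  proof (intro conjI ballI allI impI)
    fix x assume x: "x \<in> fock P"
    show "?T x \<in> fock P" by (rule wunit_fock(1)[OF b x])
    show "?S x \<in> fock P" by (rule wunit_fock(1)[OF b' b(2) x])
  next
    fix x assume "x \<notin> fock P"
    thus "?T x = fzero" "?S x = fzero" by (simp_all add: wunit_def)
  next
    fix x y k assume x: "x \<in> fock P" and y: "y \<in> fock P"
    have "ip (col k (?T x)) (col k y) = (\<Sum>\<^sub>\<infinity>n\<in>{n. q \<le> int n}. cnj (?T x n i k) * y n i k)"
      unfolding ip_def by (subst infsum_slice[where i=i and S="{n. q \<le> int n}"])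
        (auto simp: wunit_apply[OF x] image_iff)
    \<comment> \<open>On the range \<open>q \<le> int n\<close> the truncation by \<open>nat\<close>
      is exact, so target and source degrees correspond one to one.\<close>
    also have "\<dots> = (\<Sum>\<^sub>\<infinity>m\<in>{m. - q \<le> int m}. cnj (x m j k) * ?S y m j k)"
    proof (rule infsum_reindex_bij_witness[where j="\<lambda>n. nat (int n - q)" and i="\<lambda>m. nat (int m + q)"])
      fix n assume n: "n \<in> {n. q \<le> int n}"
      hence e: "nat (int (nat (int n - q)) + q) = n" "- q \<le> int (nat (int n - q))" by auto
      show "cnj (x (nat (int n - q)) j k) * ?S y (nat (int n - q)) j k = cnj (?T x n i k) * y n i k"
        using n e fock_zero[OF x, of "nat (int n - q)" j k] fock_zero[OF y, of n i k]
        by (auto simp: wunit_apply[OF x] wunit_apply[OF y] mult_ac)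
    qed auto
    also have "\<dots> = ip (col k x) (col k (?S y))"
      unfolding ip_def by (subst infsum_slice[where i=j and S="{m. - q \<le> int m}"])
        (auto simp: wunit_apply[OF y] image_iff)
    finally show "ip (col k (?T x)) (col k y) = ip (col k x) (col k (?S y))" .
  qed
qed

section \<open>Shifts as sums of weighted matrix units\<close>

definition shift_weight :: "('a::finite \<Rightarrow> 'a \<Rightarrow> real) \<Rightarrow> nat \<Rightarrow> 'a \<Rightarrow> 'a \<Rightarrow> nat \<Rightarrow> 'a \<Rightarrow> real" where
  "shift_weight P n i j N k =
     flat (\<lambda>a b. sqrt (matpow P N a b)) i k * (sqrt (matpow P n i j) * sqrt (matpow P (N - n) j k))"

lemma shift_weight_nonneg: "stochastic P \<Longrightarrow> 0 \<le> shift_weight P n i j N k"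
  unfolding shift_weight_def flat_def by (simp add: matpow_nonneg)

text \<open>The right-hand side is the probability that the chain from \<open>i\<close>, conditioned
  to be at \<open>k\<close> at time \<open>N\<close>, passes through \<open>j\<close> at time
  \<open>n\<close>; this is why the squares sum to 1 over \<open>j\<close> and the weights are at
  most 1.\<close>

lemma shift_weight_sq:
  assumes s: "stochastic P" and p: "matpow P N i k \<noteq> 0"
  shows "(shift_weight P n i j N k)\<^sup>2 = matpow P n i j * matpow P (N - n) j k / matpow P N i k"
proof -
  have "matpow P N i k > 0" using p matpow_nonneg[OF s, of N i k] by simp
  thus ?thesis unfolding shift_weight_def flat_def
    by (simp add: power_mult_distrib matpow_nonneg[OF s] field_simps)
qed

lemma shift_weight_sum_sq:
  assumes s: "stochastic P" and p: "matpow P N i k \<noteq> 0" and N: "n \<le> N"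
  shows "(\<Sum>j\<in>UNIV. (shift_weight P n i j N k)\<^sup>2) = 1"
  using p N matpow_add[of P n "N - n" i k]
  by (simp add: shift_weight_sq[OF s p] sum_divide_distrib[symmetric])

lemma shift_weight_le_1:
  assumes s: "stochastic P" and N: "n \<le> N"
  shows "shift_weight P n i j N k \<le> 1"
proof (cases "matpow P N i k = 0")
  case True thus ?thesis by (simp add: shift_weight_def flat_def)
next
  case False
  have "(shift_weight P n i j N k)\<^sup>2 \<le> (\<Sum>j\<in>UNIV. (shift_weight P n i j N k)\<^sup>2)"
    by (rule member_le_sum) auto
  hence "(shift_weight P n i j N k)\<^sup>2 \<le> 1\<^sup>2" by (simp add: shift_weight_sum_sq[OF s False N])
  thus ?thesis by (rule power2_le_imp_le) simp
qed

lemma shift_eq_op_sum: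
  "shift P n A = op_sum UNIV (\<lambda>(i, j). wunit P i j (int n) (\<lambda>N k. A i j * of_real (shift_weight P n i j N k)))"
proof (intro ext)
  fix x m a k
  show "shift P n A x m a k = op_sum UNIV (\<lambda>(i, j). wunit P i j (int n) (\<lambda>N k. A i j * of_real (shift_weight P n i j N k))) x m a k"
  proof (cases "x \<in> fock P")
    case False
    thus ?thesis by (simp add: shift_def op_sum_def wunit_def fzero_def split_def)
  next
    case x: True
    have "op_sum UNIV (\<lambda>(i, j). wunit P i j (int n) (\<lambda>N k. A i j * of_real (shift_weight P n i j N k))) x m a k
      = (\<Sum>i\<in>UNIV. \<Sum>j\<in>UNIV. wunit P i j (int n) (\<lambda>N k. A i j * of_real (shift_weight P n i j N k)) x m a k)"
      unfolding op_sum_def by (simp add: sum.cartesian_product split_def)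
    also have "\<dots> = (\<Sum>i\<in>UNIV. if i = a then (\<Sum>j\<in>UNIV. wunit P a j (int n) (\<lambda>N k. A a j * of_real (shift_weight P n a j N k)) x m a k) else 0)"
      by (intro sum.cong refl) (auto simp: wunit_apply[OF x])
    also have "\<dots> = (\<Sum>j\<in>UNIV. wunit P a j (int n) (\<lambda>N k. A a j * of_real (shift_weight P n a j N k)) x m a k)"
      by simp
    also have "\<dots> = shift P n A x m a k"
    proof (cases "m < n")
      case True thus ?thesis using x by (simp add: wunit_apply[OF x] shift_def)
    next
      case False
      have e: "nat (int m - int n) = m - n" using False by simp
      show ?thesis
      proof (cases "matpow P m a k = 0")
        case True
        thus ?thesis using x False by (simp add: wunit_apply[OF x] shift_def Umul_def flat_def)
      next
        case nz: False
        show ?thesis using x False nz e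
          by (simp add: wunit_apply[OF x] shift_def Umul_def shift_weight_def sum_distrib_left mult_ac)
      qed
    qed
    finally show ?thesis by simp
  qed
qed

definition munit :: "'a \<Rightarrow> 'a \<Rightarrow> 'a cmat" where
  "munit i j = (\<lambda>a b. if a = i \<and> b = j then 1 else 0)"

lemma shift_munit:
  "shift P n (munit i j) = wunit P i j (int n) (\<lambda>N k. of_real (shift_weight P n i j N k))"
proof (intro ext)
  fix x m a k
  show "shift P n (munit i j) x m a k = wunit P i j (int n) (\<lambda>N k. of_real (shift_weight P n i j N k)) x m a k"
  proof (cases "x \<in> fock P")
    case False thus ?thesis by (simp add: shift_def wunit_def fzero_def)
  next
    case x: True
    have "shift P n (munit i j) x m a k = (\<Sum>p\<in>UNIV. if p = (i, j) then
        wunit P i j (int n) (\<lambda>N k. of_real (shift_weight P n i j N k)) x m a k else 0)"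
      unfolding shift_eq_op_sum op_sum_def
      by (intro sum.cong refl) (auto simp: munit_def wunit_apply[OF x] split: if_splits)
    thus ?thesis by simp
  qed
qed

lemma lact_eq_op_sum: "lact P f = op_sum UNIV (\<lambda>i. wunit P i i 0 (\<lambda>N k. f i))"
proof (intro ext)
  fix x m a k
  show "lact P f x m a k = op_sum UNIV (\<lambda>i. wunit P i i 0 (\<lambda>N k. f i)) x m a k"
  proof (cases "x \<in> fock P")
    case False thus ?thesis by (simp add: lact_def op_sum_def wunit_def fzero_def)
  next
    case x: True
    have "op_sum UNIV (\<lambda>i. wunit P i i 0 (\<lambda>N k. f i)) x m a k
        = (\<Sum>i\<in>UNIV. if i = a then f a * x m a k else 0)"
      unfolding op_sum_def using fock_zero[OF x, of m a k]
      by (intro sum.cong refl) (auto simp: wunit_apply[OF x])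
    thus ?thesis using x by (simp add: lact_def)
  qed
qed

lemma adjp_shift_summand:
  assumes s: "stochastic P"
  shows "adjp P (wunit P i j (int n) (\<lambda>N k. c * of_real (shift_weight P n i j N k)))
    (wunit P j i (- int n) (\<lambda>m k. cnj (c * of_real (shift_weight P n i j (nat (int m + int n)) k))))"
proof (rule adjp_wunit[where C="cmod c"])
  fix N k assume "int n \<le> int N"
  hence "shift_weight P n i j N k \<le> 1" by (intro shift_weight_le_1[OF s]) simp
  thus "cmod (c * of_real (shift_weight P n i j N k)) \<le> cmod c"
    using shift_weight_nonneg[OF s, of n i j N k] by (simp add: norm_mult mult_left_le)
qed simp

lemma shift_Lops: "stochastic P \<Longrightarrow> shift P n A \<in> Lops P"
  unfolding shift_eq_op_sum
proof (rule adjp_Lops[OF adjp_op_sum[OF finite]])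
  fix p :: "'a \<times> 'a" assume s: "stochastic P"
  show "adjp P ((\<lambda>(i, j). wunit P i j (int n) (\<lambda>N k. A i j * of_real (shift_weight P n i j N k))) p)
    ((\<lambda>(i, j). wunit P j i (- int n) (\<lambda>m k. cnj (A i j * of_real (shift_weight P n i j (nat (int m + int n)) k)))) p)"
    by (cases p) (simp only: prod.case adjp_shift_summand[OF s])
qed

lemma lact_Lops: "lact P f \<in> Lops P"
  unfolding lact_eq_op_sum
proof (rule adjp_Lops[OF adjp_op_sum[OF finite]])
  fix i show "adjp P (wunit P i i 0 (\<lambda>N k. f i)) (wunit P i i (- 0) (\<lambda>m k. cnj (f i)))"
    by (rule adjp_wunit[where C="cmod (f i)"]) auto
qed

section \<open>The Toeplitz algebra as a least closed set\<close>

lemma cstar_closed_Lops: "cstar_closed P (Lops P)"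
  unfolding cstar_closed_def by (simp add: Lops_closed adj_Lops)

lemma toeplitz_least:
  "cstar_closed P S \<Longrightarrow> (\<And>f. lact P f \<in> S) \<Longrightarrow> (\<And>n A. n \<ge> 1 \<Longrightarrow> A \<in> arv P n \<Longrightarrow> shift P n A \<in> S)
    \<Longrightarrow> toeplitz P \<subseteq> S"
  unfolding toeplitz_def by (rule Inter_lower) auto

lemma toeplitz_gens:
  "lact P f \<in> toeplitz P" "n \<ge> 1 \<Longrightarrow> A \<in> arv P n \<Longrightarrow> shift P n A \<in> toeplitz P"
  unfolding toeplitz_def by auto

lemma toeplitz_Lops: "stochastic P \<Longrightarrow> toeplitz P \<subseteq> Lops P"
  by (rule toeplitz_least) (auto simp: cstar_closed_Lops lact_Lops shift_Lops)

text \<open>Membership may be tested on the closed sets above the algebra, which turns each closure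
  property of such sets into one of \<open>toeplitz\<close>.\<close>

lemma toeplitzI: "(\<And>S. cstar_closed P S \<Longrightarrow> toeplitz P \<subseteq> S \<Longrightarrow> T \<in> S) \<Longrightarrow> T \<in> toeplitz P"
proof -
  assume h: "\<And>S. cstar_closed P S \<Longrightarrow> toeplitz P \<subseteq> S \<Longrightarrow> T \<in> S"
  have "T \<in> S" if "cstar_closed P S \<and> range (lact P) \<subseteq> S \<and> (\<forall>n\<ge>1. \<forall>A\<in>arv P n. shift P n A \<in> S)" for S
    using that by (intro h toeplitz_least) auto
  thus ?thesis unfolding toeplitz_def by simp
qed

lemma cstar_closedD:
  assumes "cstar_closed P S"
  shows "T \<in> S \<Longrightarrow> T' \<in> S \<Longrightarrow> op_add T T' \<in> S" "T \<in> S \<Longrightarrow> T' \<in> S \<Longrightarrow> T \<circ> T' \<in> S"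
    "T \<in> S \<Longrightarrow> op_scale c T \<in> S" "T \<in> S \<Longrightarrow> adj P T \<in> S"
    "(\<And>k. X k \<in> S) \<Longrightarrow> T \<in> Lops P \<Longrightarrow> (\<lambda>k. opnorm P (op_diff (X k) T)) \<longlonglongrightarrow> 0 \<Longrightarrow> T \<in> S"
proof -
  show "T \<in> S \<Longrightarrow> T' \<in> S \<Longrightarrow> op_add T T' \<in> S" "T \<in> S \<Longrightarrow> T' \<in> S \<Longrightarrow> T \<circ> T' \<in> S"
    "T \<in> S \<Longrightarrow> op_scale c T \<in> S" "T \<in> S \<Longrightarrow> adj P T \<in> S"
    using assms unfolding cstar_closed_def by simp_all
  show "(\<And>k. X k \<in> S) \<Longrightarrow> T \<in> Lops P \<Longrightarrow> (\<lambda>k. opnorm P (op_diff (X k) T)) \<longlonglongrightarrow> 0 \<Longrightarrow> T \<in> S"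
    using assms[unfolded cstar_closed_def, THEN conjunct2, THEN conjunct2, THEN conjunct2,
        THEN conjunct2, rule_format, of X T] by simp
qed

lemma toeplitz_closed:
  "T \<in> toeplitz P \<Longrightarrow> S \<in> toeplitz P \<Longrightarrow> op_add T S \<in> toeplitz P"
  "T \<in> toeplitz P \<Longrightarrow> S \<in> toeplitz P \<Longrightarrow> T \<circ> S \<in> toeplitz P"
  "T \<in> toeplitz P \<Longrightarrow> op_scale c T \<in> toeplitz P"
  "T \<in> toeplitz P \<Longrightarrow> adj P T \<in> toeplitz P"
  by (rule toeplitzI, rule cstar_closedD, assumption, erule subsetD, assumption+,
      (erule subsetD, assumption)?)+

lemma toeplitz_limit:
  assumes X: "\<And>k. X k \<in> toeplitz P" and T: "T \<in> Lops P"
    and l: "(\<lambda>k. opnorm P (op_diff (X k) T)) \<longlonglongrightarrow> 0"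
  shows "T \<in> toeplitz P"
proof (rule toeplitzI)
  fix S assume S: "cstar_closed P S" and sub: "toeplitz P \<subseteq> S"
  show "T \<in> S" by (rule cstar_closedD(5)[OF S subsetD[OF sub X] T l])
qed

lemma toeplitz_diff: "T \<in> toeplitz P \<Longrightarrow> S \<in> toeplitz P \<Longrightarrow> op_diff T S \<in> toeplitz P"
  by (simp add: op_diff_eq toeplitz_closed)

lemma toeplitz_zero: "(\<lambda>x. fzero) \<in> toeplitz P"
proof -
  have "op_scale 0 (lact P (\<lambda>i. 0)) = (\<lambda>x. fzero)" by (simp add: op_scale_def fzero_def)
  thus ?thesis using toeplitz_closed(3)[OF toeplitz_gens(1)] by metis
qed

lemma toeplitz_op_sum:
  "finite I \<Longrightarrow> (\<And>s. s \<in> I \<Longrightarrow> T s \<in> toeplitz P) \<Longrightarrow> op_sum I T \<in> toeplitz P"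
  by (induction I rule: finite_induct) (auto simp: op_sum_empty op_sum_insert toeplitz_zero toeplitz_closed)

definition tailp :: "('a::finite \<Rightarrow> 'a \<Rightarrow> real) \<Rightarrow> nat \<Rightarrow> 'a fop" where
  "tailp P n = (\<lambda>x. if x \<in> fock P then (\<lambda>m i k. if m < n then 0 else x m i k) else fzero)"

text \<open>The identity is \<open>\<Sum> S S\<^sup>*\<close> over the matrix units of the \<open>n\<close>-th fibre; it is the
  Chapman--Kolmogorov equation.\<close>

lemma tailp_toeplitz:
  assumes s: "stochastic P" and n: "n \<ge> 1"
  shows "tailp P n \<in> toeplitz P"
proof -
  \<comment> \<open>Matrix units outside this set do not lie in \<open>arv P n\<close>; their weight
    is 0, so the sum may later be extended to all pairs.\<close>
  define I where "I = {(i, j). matpow P n i j \<noteq> 0}"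
  define S where "S = (\<lambda>(i, j). shift P n (munit i j))"
  have S: "S p \<in> toeplitz P" if "p \<in> I" for p
    using that n unfolding S_def I_def by (auto intro!: toeplitz_gens(2) simp: arv_def munit_def)
  have adjS: "adj P (S (i, j)) = wunit P j i (- int n) (\<lambda>m k. of_real (shift_weight P n i j (nat (int m + int n)) k))"
    for i j
    using adjp_adj[OF adjp_shift_summand[OF s, of i j n 1]] by (simp add: S_def shift_munit)
  have "tailp P n = op_sum I (\<lambda>p. S p \<circ> adj P (S p))"
  proof (intro ext)
    fix x m a k
    show "tailp P n x m a k = op_sum I (\<lambda>p. S p \<circ> adj P (S p)) x m a k"
    proof (cases "x \<in> fock P")
      case False
      have "(S p \<circ> adj P (S p)) x = fzero" for p
      proof -
        obtain i j where p: "p = (i, j)" by fastforce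
        have "S p \<in> Lops P" unfolding p S_def using shift_Lops[OF s] by simp
        thus ?thesis using Lops_outside[OF adj_Lops[of "S p" P]] Lops_fzero[of "S p" P] False by simp
      qed
      thus ?thesis using False by (simp add: tailp_def op_sum_def fzero_def)
    next
      case x: True
      have trm: "S (i, j) (adj P (S (i, j)) x) m a k =
          (if a = i \<and> matpow P m i k \<noteq> 0 \<and> n \<le> m then of_real ((shift_weight P n i j m k)\<^sup>2) * x m i k else 0)" for i j
      proof -
        have y: "adj P (S (i, j)) x \<in> fock P"
          using shift_Lops[OF s] by (auto simp: S_def intro!: Lops_fock[OF adj_Lops] x)
        have z: "shift_weight P n i j m k = 0" if "matpow P (m - n) j k = 0"
          using that by (simp add: shift_weight_def)
        show ?thesis
          using z
          by (subst S_def, simp only: prod.case shift_munit wunit_apply[OF y])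
            (auto simp: adjS wunit_apply[OF x] nat_diff_distrib' power2_eq_square)
      qed
      have "op_sum I (\<lambda>p. S p \<circ> adj P (S p)) x m a k = (\<Sum>p\<in>UNIV. (S p \<circ> adj P (S p)) x m a k)"
        unfolding op_sum_def
        by (rule sum.mono_neutral_left) (auto simp: I_def trm shift_weight_def split: if_splits)
      also have "\<dots> = (\<Sum>i\<in>UNIV. \<Sum>j\<in>UNIV. (S (i, j) \<circ> adj P (S (i, j))) x m a k)"
        by (simp add: sum.cartesian_product split_def)
      also have "\<dots> = (\<Sum>i\<in>UNIV. if i = a then (if matpow P m a k \<noteq> 0 \<and> n \<le> m then
          (\<Sum>j\<in>UNIV. of_real ((shift_weight P n a j m k)\<^sup>2)) * x m a k else 0) else 0)"
        by (intro sum.cong refl) (auto simp: trm sum_distrib_right)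
      also have "\<dots> = (if matpow P m a k \<noteq> 0 \<and> n \<le> m then x m a k else 0)"
      proof -
        have "(\<Sum>j\<in>UNIV. complex_of_real ((shift_weight P n a j m k)\<^sup>2)) = 1" if "matpow P m a k \<noteq> 0" "n \<le> m"
          by (simp only: of_real_sum[symmetric] shift_weight_sum_sq[OF s that] of_real_1)
        thus ?thesis by (simp del: of_real_power)
      qed
      also have "\<dots> = tailp P n x m a k"
        using x fock_zero[OF x, of m a k] by (auto simp: tailp_def)
      finally show ?thesis by simp
    qed
  qed
  also have "\<dots> \<in> toeplitz P"
    by (rule toeplitz_op_sum) (auto intro: toeplitz_closed S)
  finally show ?thesis .
qed

section \<open>Laurent operators\<close>

definition laurent_unit :: "'a \<Rightarrow> 'a \<Rightarrow> int \<Rightarrow> (int \<times> 'a \<Rightarrow> complex) \<Rightarrow> int \<times> 'a \<Rightarrow> complex" where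
  "laurent_unit i j p y = (\<lambda>(q, a). if a = i then y (q - p, j) else 0)"

definition monom_symbol :: "'a \<Rightarrow> 'a \<Rightarrow> int \<Rightarrow> complex \<Rightarrow> 'a \<Rightarrow> 'a \<Rightarrow> complex" where
  "monom_symbol i j p z a b = (if a = i \<and> b = j \<and> cmod z = 1 then z powi p else 0)"

text \<open>Laurent operators on \<open>\<int> \<times> \<Omega>\<close> paired with their symbols, Laurent-polynomial matrices on the
  unit circle (set to 0 off the circle).\<close>

inductive laurent :: "('a \<Rightarrow> 'a \<Rightarrow> bool) \<Rightarrow> ((int \<times> 'a \<Rightarrow> complex) \<Rightarrow> int \<times> 'a \<Rightarrow> complex)
    \<Rightarrow> (complex \<Rightarrow> 'a \<Rightarrow> 'a \<Rightarrow> complex) \<Rightarrow> bool" for R where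
  zero: "laurent R (\<lambda>y a. 0) (\<lambda>z a b. 0)"
| step: "laurent R A f \<Longrightarrow> R i j \<Longrightarrow>
    laurent R (\<lambda>y a. A y a + c * laurent_unit i j p y a) (\<lambda>z a b. f z a b + c * monom_symbol i j p z a b)"

lemma laurent_monom:
  "R i j \<Longrightarrow> laurent R (\<lambda>y a. c * laurent_unit i j p y a) (\<lambda>z a b. c * monom_symbol i j p z a b)"
  using laurent.step[OF laurent.zero, of R i j c p] by simp

lemma laurent_add:
  assumes A: "laurent R A f"
  shows "laurent R B g \<Longrightarrow> laurent R (\<lambda>y a. A y a + B y a) (\<lambda>z a b. f z a b + g z a b)"
proof (induction rule: laurent.induct)
  case zero thus ?case using A by simp
next
  case (step B g i j c p)
  from laurent.step[OF step.IH step.hyps(2), of c p] show ?case by (simp add: add.assoc)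
qed

lemma laurent_scale: "laurent R A f \<Longrightarrow> laurent R (\<lambda>y a. c * A y a) (\<lambda>z a b. c * f z a b)"
proof (induction rule: laurent.induct)
  case zero thus ?case using laurent.zero by simp
next
  case (step A f i j d p)
  from laurent.step[OF step.IH step.hyps(2), of "c * d" p] show ?case
    by (simp add: distrib_left mult.assoc)
qed

lemma laurent_linear:
  "laurent R A f \<Longrightarrow> A (\<lambda>a. x a + y a) = (\<lambda>a. A x a + A y a)"
  "laurent R A f \<Longrightarrow> A (\<lambda>a. c * x a) = (\<lambda>a. c * A x a)"
  by (induction rule: laurent.induct) (auto simp: fun_eq_iff laurent_unit_def algebra_simps)

lemma laurent_zero_arg: "laurent R A f \<Longrightarrow> A (\<lambda>a. 0) = (\<lambda>a. 0)"
  using laurent_linear(2)[of R A f 0 "\<lambda>a. 0"] by simp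

text \<open>Multiplying by one unit from the left relabels rows and adds exponents; transitivity of
  \<open>R\<close> keeps the resulting units inside blocks.\<close>

lemma laurent_unit_left:
  assumes tr: "\<And>i j k. R i j \<Longrightarrow> R j k \<Longrightarrow> R i k" and R: "R i j"
  shows "laurent R B g \<Longrightarrow> laurent R (\<lambda>y. laurent_unit i j p (B y))
     (\<lambda>z a b. if a = i \<and> cmod z = 1 then z powi p * g z j b else 0)"
proof (induction rule: laurent.induct)
  case zero
  have "(\<lambda>y. laurent_unit i j p (\<lambda>a. 0)) = (\<lambda>(y :: int \<times> 'a \<Rightarrow> complex) a. 0)"
    by (auto simp: laurent_unit_def fun_eq_iff)
  thus ?case using laurent.zero by (simp cong: if_cong)
next
  case (step B g i' j' c p')
  have e: "laurent_unit i j p (\<lambda>a. B y a + c * laurent_unit i' j' p' y a)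
    = (\<lambda>a. laurent_unit i j p (B y) a + c * (if j = i' then laurent_unit i j' (p + p') y a else 0))" for y
    by (auto simp: laurent_unit_def fun_eq_iff algebra_simps)
  have e2: "(if a = i \<and> cmod z = 1 then z powi p * (g z j b + c * monom_symbol i' j' p' z j b) else 0)
    = (if a = i \<and> cmod z = 1 then z powi p * g z j b else 0) +
      c * (if j = i' then monom_symbol i j' (p + p') z a b else 0)" for z a b
  proof -
    have "cmod z = 1 \<Longrightarrow> z powi (p + p') = z powi p * z powi p'"
      by (intro power_int_add) auto
    thus ?thesis by (auto simp: monom_symbol_def algebra_simps)
  qed
  show ?case
  proof (cases "j = i'")
    case True
    hence "R i j'" using tr R step.hyps(2) by blast
    from laurent.step[OF step.IH this, of c "p + p'"] show ?thesis unfolding e e2 using True by simp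
  next
    case False
    thus ?thesis unfolding e e2 using step.IH by simp
  qed
qed

lemma laurent_comp:
  fixes R :: "'a::finite \<Rightarrow> 'a \<Rightarrow> bool"
  assumes tr: "\<And>i j k. R i j \<Longrightarrow> R j k \<Longrightarrow> R i k" and B: "laurent R B g"
  shows "laurent R A f \<Longrightarrow> laurent R (\<lambda>y. A (B y)) (\<lambda>z a b. \<Sum>l\<in>UNIV. f z a l * g z l b)"
proof (induction rule: laurent.induct)
  case zero thus ?case using laurent.zero by simp
next
  case (step A f i j c p)
  have e: "(\<Sum>l\<in>UNIV. (f z a l + c * monom_symbol i j p z a l) * g z l b)
    = (\<Sum>l\<in>UNIV. f z a l * g z l b) + c * (if a = i \<and> cmod z = 1 then z powi p * g z j b else 0)" for z a b
  proof -
    have "(\<Sum>l\<in>UNIV. c * monom_symbol i j p z a l * g z l b)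
      = (\<Sum>l\<in>UNIV. if l = j then c * (if a = i \<and> cmod z = 1 then z powi p * g z j b else 0) else 0)"
      by (intro sum.cong refl) (auto simp: monom_symbol_def)
    thus ?thesis by (simp add: distrib_right sum.distrib)
  qed
  show ?case unfolding e
    by (rule laurent_add[OF step.IH laurent_scale[OF laurent_unit_left[OF tr step.hyps(2) B]]])
qed

text \<open>A Laurent polynomial has finitely many diagonals. Row \<open>q\<close> of
  \<open>A y\<close> sees \<open>y\<close> only within distance \<open>L\<close>, so
  \<open>A\<close> can be tested on finite windows, even of sequences that are not
  square-summable.\<close>

lemma laurent_propagation:
  "laurent R A f \<Longrightarrow> \<exists>L\<ge>0. \<forall>y y' q. (\<forall>q' i. \<bar>q' - q\<bar> \<le> L \<longrightarrow> y (q', i) = y' (q', i)) \<longrightarrow> (\<forall>a. A y (q, a) = A y' (q, a))"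
proof (induction rule: laurent.induct)
  case zero thus ?case by (intro exI[of _ 0]) auto
next
  case (step A f i j c p)
  then obtain L where L: "L \<ge> 0"
    "\<And>y y' q a. (\<And>q' i. \<bar>q' - q\<bar> \<le> L \<Longrightarrow> y (q', i) = y' (q', i)) \<Longrightarrow> A y (q, a) = A y' (q, a)" by blast
  show ?case
  proof (intro exI[of _ "L + \<bar>p\<bar>"] conjI allI impI)
    fix y y' :: "int \<times> 'a \<Rightarrow> complex" and q a
    assume h: "\<forall>q' i. \<bar>q' - q\<bar> \<le> L + \<bar>p\<bar> \<longrightarrow> y (q', i) = y' (q', i)"
    have "A y (q, a) = A y' (q, a)" by (rule L(2)) (use h in auto)
    moreover have "laurent_unit i j p y (q, a) = laurent_unit i j p y' (q, a)"
      using h[rule_format, of "q - p" j] L(1) by (simp add: laurent_unit_def)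
    ultimately show "A y (q, a) + c * laurent_unit i j p y (q, a) = A y' (q, a) + c * laurent_unit i j p y' (q, a)"
      by simp
  qed (use L in auto)
qed

lemma laurent_block:
  assumes eq: "equivp R"
  shows "laurent R A f \<Longrightarrow> (\<And>q i. \<not> R i k \<Longrightarrow> y (q, i) = 0) \<Longrightarrow> \<not> R i k \<Longrightarrow> A y (q, i) = 0"
proof (induction arbitrary: q i rule: laurent.induct)
  case (step A f i' j c p)
  have "laurent_unit i' j p y (q, i) = 0"
  proof (cases "i = i'")
    case True
    hence "\<not> R j k" using step.hyps(2) step.prems(2) equivp_transp[OF eq] by blast
    thus ?thesis using step.prems(1) True by (simp add: laurent_unit_def)
  qed (simp add: laurent_unit_def)
  moreover have "A y (q, i) = 0" by (rule step.IH[OF step.prems])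
  ultimately show ?case by simp
qed simp

lemma laurent_symbol_support: "laurent R A f \<Longrightarrow> cmod z \<noteq> 1 \<or> \<not> R a b \<Longrightarrow> f z a b = 0"
  by (induction rule: laurent.induct) (auto simp: monom_symbol_def)

lemma laurent_symbol_bounded: "laurent R A f \<Longrightarrow> \<exists>M\<ge>0. \<forall>z a b. cmod (f z a b) \<le> M"
proof (induction rule: laurent.induct)
  case (step A f i j c p)
  then obtain M where M: "M \<ge> 0" "\<And>z a b. cmod (f z a b) \<le> M" by blast
  have "cmod (f z a b + c * monom_symbol i j p z a b) \<le> M + cmod c" for z a b
  proof -
    have "cmod (monom_symbol i j p z a b) \<le> 1" by (simp add: monom_symbol_def norm_power_int)
    hence "cmod (c * monom_symbol i j p z a b) \<le> cmod c" by (simp add: norm_mult mult_left_le)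
    thus ?thesis using M(2)[of z a b] norm_triangle_ineq[of "f z a b" "c * monom_symbol i j p z a b"]
      by linarith
  qed
  thus ?case using M(1) by (intro exI[of _ "M + cmod c"]) auto
qed auto

lemma laurent_symbol_continuous: "laurent R A f \<Longrightarrow> continuous_on {z. cmod z = 1} (\<lambda>z. f z a b)"
proof (induction rule: laurent.induct)
  case (step A f i j c p)
  have "continuous_on {z. cmod z = 1} (\<lambda>z. monom_symbol i j p z a b)"
  proof (rule continuous_on_eq)
    show "continuous_on {z. cmod z = 1} (\<lambda>z. if a = i \<and> b = j then z powi p else 0)"
      by (cases "a = i \<and> b = j") (auto intro!: continuous_intros)
  qed (simp add: monom_symbol_def)
  thus ?case using step.IH by (intro continuous_intros)
qed auto

text \<open>The exponent is negated because a unit of exponent \<open>p\<close> reads its argument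
  at position \<open>q - p\<close>.\<close>

lemma laurent_eigen:
  assumes z: "cmod z = 1"
  shows "laurent R A f \<Longrightarrow> A (\<lambda>(q, i). if i = j then z powi (- q) else 0) (q, a) = f z a j * z powi (- q)"
proof (induction rule: laurent.induct)
  case (step A f i l c p)
  have "z powi (p - q) = z powi p * z powi (- q)" using z by (subst power_int_add[symmetric]) auto
  hence "laurent_unit i l p (\<lambda>(q, i). if i = j then z powi (- q) else 0) (q, a)
    = monom_symbol i l p z a j * z powi (- q)"
    using z by (auto simp: laurent_unit_def monom_symbol_def)
  thus ?case using step.IH by (simp add: distrib_right)
qed simp

section \<open>Fourier transform and norm bounds\<close>

definition fin_supp :: "('i \<Rightarrow> complex) \<Rightarrow> bool" where
  "fin_supp y \<longleftrightarrow> finite {a. y a \<noteq> 0}"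

definition hat :: "(int \<times> 'a \<Rightarrow> complex) \<Rightarrow> complex \<Rightarrow> 'a \<Rightarrow> complex" where
  "hat y z i = (\<Sum>\<^sub>\<infinity>q. y (q, i) * z powi q)"

lemma fin_supp_l2: "fin_supp y \<Longrightarrow> l2 y"
  unfolding fin_supp_def by (rule finite_support_l2(1)[of "{a. y a \<noteq> 0}"]) simp_all

lemma hat_summable: "fin_supp y \<Longrightarrow> (\<lambda>q. y (q, i) * z powi q) summable_on UNIV"
proof -
  assume f: "fin_supp y"
  have "{q. y (q, i) \<noteq> 0} \<subseteq> fst ` {a. y a \<noteq> 0}" by force
  from finite_subset[OF this] have "finite {q. y (q, i) \<noteq> 0}" using f by (simp add: fin_supp_def)
  from summable_on_finite[OF this, of "\<lambda>q. y (q, i) * z powi q"] show ?thesis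
    by (rule summable_on_cong_neutral[THEN iffD1, rotated 3]) auto
qed

lemma fin_supp_laurent_unit: "fin_supp y \<Longrightarrow> fin_supp (laurent_unit i j p y)"
proof -
  assume f: "fin_supp y"
  have "{a. laurent_unit i j p y a \<noteq> 0} \<subseteq> (\<lambda>(q, b). (q + p, i)) ` {a. y a \<noteq> 0}"
    by (force simp: laurent_unit_def image_iff split: if_splits)
  thus ?thesis unfolding fin_supp_def using f finite_subset by (auto simp: fin_supp_def)
qed

lemma hat_laurent_unit:
  "cmod z = 1 \<Longrightarrow> hat (laurent_unit i j p y) z a = (if a = i then z powi p * hat y z j else 0)"
proof (cases "a = i")
  case True
  assume z: "cmod z = 1"
  have "hat (laurent_unit i j p y) z a = (\<Sum>\<^sub>\<infinity>q. y (q - p, j) * z powi q)"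
    using True by (simp add: hat_def laurent_unit_def)
  also have "\<dots> = (\<Sum>\<^sub>\<infinity>q. z powi p * (y (q, j) * z powi q))"
  proof (rule infsum_reindex_bij_witness[where j="\<lambda>q. q - p" and i="\<lambda>q. q + p"])
    fix q
    have "z powi q = z powi p * z powi (q - p)" using z by (subst power_int_add[symmetric]) auto
    thus "z powi p * (y (q - p, j) * z powi (q - p)) = y (q - p, j) * z powi q" by simp
  qed auto
  finally show ?thesis using True by (simp add: hat_def infsum_cmult_right')
qed (simp add: hat_def laurent_unit_def)

text \<open>The Fourier transform turns a Laurent operator into pointwise multiplication by its
  symbol; finite support is preserved, so every sum involved is finite.\<close>

lemma laurent_hat:
  fixes R :: "'a::finite \<Rightarrow> 'a \<Rightarrow> bool"
  assumes y: "fin_supp y" and z: "cmod z = 1"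
  shows "laurent R A f \<Longrightarrow> fin_supp (A y) \<and> hat (A y) z a = (\<Sum>b\<in>UNIV. f z a b * hat y z b)"
proof (induction rule: laurent.induct)
  case zero thus ?case by (simp add: fin_supp_def hat_def)
next
  case (step A f i j c p)
  note fu = fin_supp_laurent_unit[OF y, of i j p]
  have "{b. A y b + c * laurent_unit i j p y b \<noteq> 0} \<subseteq> {b. A y b \<noteq> 0} \<union> {b. laurent_unit i j p y b \<noteq> 0}"
    by auto
  from finite_subset[OF this] have 1: "fin_supp (\<lambda>b. A y b + c * laurent_unit i j p y b)"
    using step.IH fu by (simp add: fin_supp_def)
  have "hat (\<lambda>b. A y b + c * laurent_unit i j p y b) z a
      = (\<Sum>\<^sub>\<infinity>q. A y (q, a) * z powi q + c * (laurent_unit i j p y (q, a) * z powi q))"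
    by (simp add: hat_def distrib_right mult.assoc)
  also have "\<dots> = hat (A y) z a + c * hat (laurent_unit i j p y) z a"
    unfolding hat_def
    by (subst infsum_add) (auto intro!: hat_summable summable_on_cmult_right fu simp: step.IH infsum_cmult_right')
  also have "\<dots> = (\<Sum>b\<in>UNIV. f z a b * hat y z b) + (\<Sum>b\<in>UNIV. if b = j then c * (if a = i then z powi p * hat y z j else 0) else 0)"
    using step.IH by (simp add: hat_laurent_unit[OF z])
  also have "\<dots> = (\<Sum>b\<in>UNIV. (f z a b + c * monom_symbol i j p z a b) * hat y z b)"
    unfolding sum.distrib[symmetric] using z
    by (intro sum.cong refl) (auto simp: monom_symbol_def distrib_right)
  finally show ?case using 1 by simp
qed

lemma cis_integral:
  "((\<lambda>t. cis (of_int n * t)) has_integral (if n = 0 then 2 * of_real pi else 0)) {0..2 * pi}"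
proof (cases "n = 0")
  case True
  have "((\<lambda>t::real. 1 :: complex) has_integral (2 * pi - 0) *\<^sub>R 1) {0..2 * pi}"
    using has_integral_const_real[of "1::complex" 0 "2 * pi"] by simp
  thus ?thesis using True by (simp add: scaleR_conv_of_real)
next
  case False
  define F where "F = (\<lambda>w::complex. exp (\<i> * of_int n * w) / (\<i> * of_int n))"
  have d: "((\<lambda>t. F (of_real t)) has_vector_derivative cis (of_int n * t)) (at t within {0..2*pi})" for t
  proof -
    have "(F has_field_derivative exp (\<i> * of_int n * of_real t)) (at (of_real t))"
      unfolding F_def using False by (auto intro!: derivative_eq_intros)
    from has_vector_derivative_real_field[OF this]
    have "((\<lambda>x. F (of_real x)) has_vector_derivative exp (\<i> * of_int n * of_real t)) (at t within {0..2*pi})"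
      by (rule has_vector_derivative_at_within)
    thus ?thesis by (simp add: cis_conv_exp mult.assoc)
  qed
  have "exp (\<i> * of_int n * of_real (2 * pi)) = 1"
    using exp_integer_2pi[of "of_int n"] by (simp add: mult_ac)
  hence "F (of_real (2 * pi)) - F (of_real 0) = 0" by (simp add: F_def)
  thus ?thesis using fundamental_theorem_of_calculus[of 0 "2 * pi" "\<lambda>t. F (of_real t)", OF _ d] False by simp
qed

text \<open>The square expands into a double sum whose nonzero frequencies integrate to 0.\<close>

lemma parseval_polynomial:
  assumes S: "finite S"
  shows "((\<lambda>t. (cmod (\<Sum>q\<in>S. c q * cis t powi q))\<^sup>2) has_integral 2 * pi * (\<Sum>q\<in>S. (cmod (c q))\<^sup>2)) {0..2 * pi}"
proof -
  have sq: "complex_of_real ((cmod (\<Sum>q\<in>S. c q * cis t powi q))\<^sup>2)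
     = (\<Sum>q\<in>S. \<Sum>q'\<in>S. (c q * cnj (c q')) * cis (of_int (q - q') * t))" for t
  proof -
    have "cis (of_int q * t) * cis (- (of_int q' * t)) = cis (of_int (q - q') * t)" for q q'
      by (simp add: cis_mult left_diff_distrib)
    hence e: "(c q * cis (of_int q * t)) * cnj (c q' * cis (of_int q' * t)) = (c q * cnj (c q')) * cis (of_int (q - q') * t)" for q q'
      by (simp add: cis_cnj mult_ac)
    show ?thesis
      unfolding complex_norm_square cis_power_int cnj_sum sum_product e ..
  qed
  have "((\<lambda>t. \<Sum>q\<in>S. \<Sum>q'\<in>S. (c q * cnj (c q')) * cis (of_int (q - q') * t)) has_integral
      (\<Sum>q\<in>S. \<Sum>q'\<in>S. (c q * cnj (c q')) * (if q - q' = 0 then 2 * of_real pi else 0))) {0..2 * pi}"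
    by (intro has_integral_sum S has_integral_mult_right cis_integral)
  also have "(\<Sum>q\<in>S. \<Sum>q'\<in>S. (c q * cnj (c q')) * (if q - q' = 0 then 2 * of_real pi else 0))
     = (\<Sum>q\<in>S. \<Sum>q'\<in>S. if q' = q then c q * cnj (c q) * (2 * of_real pi) else 0)"
    by (intro sum.cong refl) auto
  also have "\<dots> = (\<Sum>q\<in>S. c q * cnj (c q) * (2 * of_real pi))" using S by simp
  also have "\<dots> = complex_of_real (2 * pi * (\<Sum>q\<in>S. (cmod (c q))\<^sup>2))"
    by (simp add: sum_distrib_left complex_norm_square[symmetric] mult_ac del: of_real_power flip: of_real_mult of_real_sum)
      (simp add: complex_norm_square mult_ac)
  finally have "((\<lambda>t. complex_of_real ((cmod (\<Sum>q\<in>S. c q * cis t powi q))\<^sup>2)) has_integral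
     complex_of_real (2 * pi * (\<Sum>q\<in>S. (cmod (c q))\<^sup>2))) {0..2 * pi}"
    unfolding sq .
  from has_integral_linear[OF this bounded_linear_Re] show ?thesis by (simp add: o_def)
qed

lemma plancherel:
  fixes y :: "int \<times> 'a::finite \<Rightarrow> complex"
  assumes y: "fin_supp y"
  shows "((\<lambda>t. \<Sum>i\<in>UNIV. (cmod (hat y (cis t) i))\<^sup>2) has_integral 2 * pi * (nrm y)\<^sup>2) {0..2 * pi}"
proof -
  define S where "S = fst ` {a. y a \<noteq> 0}"
  have S: "finite S" using y by (simp add: S_def fin_supp_def)
  have z: "y (q, i) = 0" if "q \<notin> S" for q i using that by (force simp: S_def)
  have h: "hat y w i = (\<Sum>q\<in>S. y (q, i) * w powi q)" for w i
  proof -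
    have "hat y w i = infsum (\<lambda>q. y (q, i) * w powi q) S"
      unfolding hat_def by (rule infsum_cong_neutral) (use z in auto)
    thus ?thesis using S by simp
  qed
  have "(nrm y)\<^sup>2 = (\<Sum>a\<in>S \<times> UNIV. (cmod (y a))\<^sup>2)"
    by (rule finite_support_l2(2)) (use S z in auto)
  also have "\<dots> = (\<Sum>q\<in>S. \<Sum>i\<in>UNIV. (cmod (y (q, i)))\<^sup>2)"
    by (simp add: sum.cartesian_product split_def)
  also have "\<dots> = (\<Sum>i\<in>UNIV. \<Sum>q\<in>S. (cmod (y (q, i)))\<^sup>2)" by (rule sum.swap)
  finally have n: "2 * pi * (nrm y)\<^sup>2 = (\<Sum>i\<in>UNIV. 2 * pi * (\<Sum>q\<in>S. (cmod (y (q, i)))\<^sup>2))"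
    by (simp add: sum_distrib_left)
  show ?thesis unfolding n h by (intro has_integral_sum parseval_polynomial S finite)
qed

text \<open>At each point of the circle the matrix of the symbol is bounded by Cauchy-Schwarz with
  the crude constant \<open>CARD('a) * M\<close>; integration transfers this to sequences. The later
  limits only ask that the factor in front of \<open>M\<close> be the same for all
  operators.\<close>

lemma laurent_bound_fin:
  fixes R :: "'a::finite \<Rightarrow> 'a \<Rightarrow> bool"
  assumes A: "laurent R A f" and M: "0 \<le> M" "\<And>z a b. cmod (f z a b) \<le> M" and y: "fin_supp y"
  shows "nrm (A y) \<le> real CARD('a) * M * nrm y"
proof -
  let ?d = "real CARD('a)"
  have fA: "fin_supp (A y)" using laurent_hat[OF y _ A, of 1] by simp
  have pt: "(\<Sum>a\<in>UNIV. (cmod (hat (A y) (cis t) a))\<^sup>2) \<le> (?d * M)\<^sup>2 * (\<Sum>i\<in>UNIV. (cmod (hat y (cis t) i))\<^sup>2)" for t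
  proof -
    have "(cmod (hat (A y) (cis t) a))\<^sup>2 \<le> ?d * M\<^sup>2 * (\<Sum>i\<in>UNIV. (cmod (hat y (cis t) i))\<^sup>2)" for a
    proof -
      have "cmod (hat (A y) (cis t) a) \<le> (\<Sum>b\<in>UNIV. M * cmod (hat y (cis t) b))"
        using laurent_hat[OF y _ A, of "cis t" a]
        by (auto intro!: sum_norm_le mult_right_mono M simp: norm_mult)
      hence "(cmod (hat (A y) (cis t) a))\<^sup>2 \<le> (\<Sum>b\<in>UNIV. M * cmod (hat y (cis t) b))\<^sup>2"
        by (intro power_mono) auto
      also have "\<dots> \<le> ?d * (\<Sum>b\<in>UNIV. (M * cmod (hat y (cis t) b))\<^sup>2)"
        using sum_squared_le_sum_of_squares[of "\<lambda>b. M * cmod (hat y (cis t) b)" UNIV]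
        by (simp add: mult.commute)
      finally show ?thesis by (simp add: power_mult_distrib sum_distrib_left mult_ac)
    qed
    hence "(\<Sum>a\<in>UNIV. (cmod (hat (A y) (cis t) a))\<^sup>2) \<le> (\<Sum>a\<in>(UNIV::'a set). ?d * M\<^sup>2 * (\<Sum>i\<in>UNIV. (cmod (hat y (cis t) i))\<^sup>2))"
      by (intro sum_mono)
    thus ?thesis by (simp add: power2_eq_square mult_ac)
  qed
  have "2 * pi * (nrm (A y))\<^sup>2 \<le> (?d * M)\<^sup>2 * (2 * pi * (nrm y)\<^sup>2)"
    by (rule has_integral_le[OF plancherel[OF fA] has_integral_mult_right[OF plancherel[OF y]]]) (rule pt)
  hence "(nrm (A y))\<^sup>2 \<le> (?d * M * nrm y)\<^sup>2" by (simp add: power_mult_distrib mult_ac)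
  thus ?thesis by (rule power2_le_imp_le) (use M in simp)
qed

lemma laurent_bound:
  fixes R :: "'a::finite \<Rightarrow> 'a \<Rightarrow> bool"
  assumes A: "laurent R A f" and M: "0 \<le> M" "\<And>z a b. cmod (f z a b) \<le> M" and y: "l2 y"
  shows "l2 (A y)" "nrm (A y) \<le> real CARD('a) * M * nrm y"
proof -
  have C: "0 \<le> real CARD('a) * M * nrm y" using M by simp
  obtain L where L: "L \<ge> 0"
    "\<And>y y' q a. (\<And>q' i. \<bar>q' - q\<bar> \<le> L \<Longrightarrow> y (q', i) = y' (q', i)) \<Longrightarrow> A y (q, a) = A y' (q, a)"
    using laurent_propagation[OF A] by blast
  have "L2_set (\<lambda>a. cmod (A y a)) X \<le> real CARD('a) * M * nrm y" if X: "finite X" for X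
  proof -
    \<comment> \<open>The window contains every position that \<open>A\<close> can read from the
      finite set \<open>X\<close>; the sum bounds each position occurring in
      \<open>X\<close>.\<close>
    define K where "K = (\<Sum>a\<in>X. \<bar>fst a\<bar>) + L"
    define y' where "y' = (\<lambda>(q, i). if \<bar>q\<bar> \<le> K then y (q, i) else 0)"
    have "{a. y' a \<noteq> 0} \<subseteq> {- K..K} \<times> UNIV" by (auto simp: y'_def abs_le_iff split: if_splits)
    hence fy: "fin_supp y'" unfolding fin_supp_def by (rule finite_subset) simp
    have eq: "A y a = A y' a" if "a \<in> X" for a
    proof -
      obtain q i where a: "a = (q, i)" by fastforce
      have "\<bar>fst a\<bar> \<le> (\<Sum>a\<in>X. \<bar>fst a\<bar>)" using that X by (intro member_le_sum) auto
      thus ?thesis unfolding a by (intro L(2)) (auto simp: y'_def K_def a)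
    qed
    have "L2_set (\<lambda>a. cmod (A y a)) X = L2_set (\<lambda>a. cmod (A y' a)) X"
      by (intro L2_set_cong refl) (simp add: eq)
    also have "\<dots> \<le> nrm (A y')"
      using laurent_hat[OF fy _ A, of 1] by (intro L2_set_le_nrm fin_supp_l2 X) simp
    also have "\<dots> \<le> real CARD('a) * M * nrm y'" by (rule laurent_bound_fin[OF A M fy])
    also have "nrm y' \<le> nrm y" by (rule l2_mono(2)[OF y]) (auto simp: y'_def)
    finally show ?thesis using M by (simp add: mult_left_mono)
  qed
  from l2I_nrm[OF C this] show "l2 (A y)" "nrm (A y) \<le> real CARD('a) * M * nrm y" by auto
qed

text \<open>The norm of one column of the operator is the mean square of the matching column of the
  symbol, so single basis vectors detect whether a symbol is small.\<close>

lemma laurent_unitv_norm: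
  fixes R :: "'a::finite \<Rightarrow> 'a \<Rightarrow> bool"
  assumes A: "laurent R A f"
  shows "((\<lambda>t. \<Sum>a\<in>UNIV. (cmod (f (cis t) a j))\<^sup>2) has_integral 2 * pi * (nrm (A (unitv (q, j))))\<^sup>2) {0..2 * pi}"
proof -
  have fy: "fin_supp (unitv (q, j))" by (simp add: fin_supp_def unitv_def)
  have h: "hat (unitv (q, j)) z b = (if b = j then z powi q else 0)" for z and b :: 'a
  proof -
    have "hat (unitv (q, j)) z b = infsum (\<lambda>q'. unitv (q, j) (q', b) * z powi q') {q}"
      unfolding hat_def by (rule infsum_cong_neutral) (auto simp: unitv_def)
    thus ?thesis by (simp add: unitv_def)
  qed
  have e: "cmod (hat (A (unitv (q, j))) (cis t) a) = cmod (f (cis t) a j)" for t a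
  proof -
    have "hat (A (unitv (q, j))) (cis t) a = (\<Sum>b\<in>UNIV. f (cis t) a b * (if b = j then cis t powi q else 0))"
      using laurent_hat[OF fy _ A, of "cis t" a] by (simp add: h)
    also have "\<dots> = (\<Sum>b\<in>UNIV. if b = j then f (cis t) a j * cis t powi q else 0)"
      by (intro sum.cong refl) auto
    finally have "hat (A (unitv (q, j))) (cis t) a = (\<Sum>b\<in>UNIV. if b = j then f (cis t) a j * cis t powi q else 0)" .
    thus ?thesis by (simp add: norm_mult norm_power_int)
  qed
  have "fin_supp (A (unitv (q, j)))" using laurent_hat[OF fy _ A, of 1] by simp
  from plancherel[OF this] show ?thesis unfolding e .
qed

section \<open>Asymptotic symbols\<close>

definition star_symbol :: "(complex \<Rightarrow> 'a \<Rightarrow> 'a \<Rightarrow> complex) \<Rightarrow> complex \<Rightarrow> 'a \<Rightarrow> 'a \<Rightarrow> complex" where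
  "star_symbol F = (\<lambda>z a b. cnj (F z b a))"

definition mult_symbol :: "(complex \<Rightarrow> 'a::finite \<Rightarrow> 'a \<Rightarrow> complex) \<Rightarrow> (complex \<Rightarrow> 'a \<Rightarrow> 'a \<Rightarrow> complex)
    \<Rightarrow> complex \<Rightarrow> 'a \<Rightarrow> 'a \<Rightarrow> complex" where
  "mult_symbol F G = (\<lambda>z a b. \<Sum>l\<in>UNIV. F z a l * G z l b)"

definition tail :: "nat \<Rightarrow> 'a fock \<Rightarrow> bool" where
  "tail n x \<longleftrightarrow> (\<forall>m<n. \<forall>i k. x m i k = 0)"

lemma tail_mono: "tail n x \<Longrightarrow> m \<le> n \<Longrightarrow> tail m x"
  by (simp add: tail_def)

context phased
begin

text \<open>Solves the equation \<open>q = (n + s i - s k) / r i\<close> for the degree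
  \<open>n\<close>.\<close>

definition lev :: "'a \<Rightarrow> int \<Rightarrow> 'a \<Rightarrow> int" where
  "lev k q i = r i * q + s k - s i"

text \<open>Coordinates \<open>\<int> \<times> \<Omega>\<close> on column \<open>k\<close> in which the entry \<open>(n, i)\<close> has position
  \<open>(n + s i - s k) / r i\<close>; they remove the period.\<close>

definition J :: "'a \<Rightarrow> 'a fock \<Rightarrow> int \<times> 'a \<Rightarrow> complex" where
  "J k x = (\<lambda>(q, i). if R i k \<and> 0 \<le> lev k q i then x (nat (lev k q i)) i k else 0)"

lemma J_apply: "J k x (q, i) = (if R i k \<and> 0 \<le> lev k q i then x (nat (lev k q i)) i k else 0)"
  by (simp add: J_def)

lemma lev_inj: "lev k q i = lev k q' i \<Longrightarrow> q = q'"
  using r_pos[of i] by (simp add: lev_def)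

lemma lev_div: "r i dvd int n + s i - s k \<Longrightarrow> lev k ((int n + s i - s k) div r i) i = int n"
  by (simp add: lev_def)

lemma lev_div_inj:
  assumes "r i dvd int m + s i - s k" "r i dvd int n + s i - s k"
    and e: "(int m + s i - s k) div r i = (int n + s i - s k) div r i"
  shows "m = n"
proof -
  have "int m = lev k ((int m + s i - s k) div r i) i" by (rule lev_div[OF assms(1), symmetric])
  also have "\<dots> = int n" unfolding e by (rule lev_div[OF assms(2)])
  finally show ?thesis by simp
qed

lemma inj_on_position:
  "inj_on (\<lambda>(n, i). ((int n + s i - s k) div r i, i)) {(n, i). R i k \<and> r i dvd int n + s i - s k}"
proof (rule inj_onI)
  fix b c assume h: "b \<in> {(n, i). R i k \<and> r i dvd int n + s i - s k}" "c \<in> {(n, i). R i k \<and> r i dvd int n + s i - s k}"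
    "(\<lambda>(n, i). ((int n + s i - s k) div r i, i)) b = (\<lambda>(n, i). ((int n + s i - s k) div r i, i)) c"
  obtain m i n j where bc: "b = (m, i)" "c = (n, j)" by (meson prod.exhaust)
  have ij: "i = j" using h(3) by (simp add: bc)
  show "b = c" using lev_div_inj[of i m k n] h unfolding bc ij by simp
qed

lemma fock_pos:
  assumes x: "x \<in> fock P" and nz: "x n i k \<noteq> 0"
  shows "R i k" "r i dvd int n + s i - s k"
proof -
  have "matpow P n i k > 0"
    using nz fock_zero[OF x, of n i k] matpow_nonneg[OF stoch, of n i k] by fastforce
  thus "R i k" "r i dvd int n + s i - s k" using pos_phase by blast+
qed

text \<open>On the support of the module the phase condition makes positions integral and the
  passage from degrees to positions injective; comparison in both directions with constant 1 gives
  the isometry.\<close>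

lemma J_l2: "x \<in> fock P \<Longrightarrow> l2 (J k x)" and J_nrm: "x \<in> fock P \<Longrightarrow> nrm (J k x) = nrm (col k x)"
proof -
  assume x: "x \<in> fock P"
  have inj: "inj_on (\<lambda>(q, i). (nat (lev k q i), i)) {(q, i). R i k \<and> 0 \<le> lev k q i}"
    by (rule inj_onI) (auto dest: lev_inj simp: eq_nat_nat_iff)
  have le: "cmod (J k x b) \<le> 1 * cmod (col k x ((\<lambda>(q, i). (nat (lev k q i), i)) b))" for b
    by (cases b) (auto simp: J_apply)
  have z: "J k x b = 0" if "b \<notin> {(q, i). R i k \<and> 0 \<le> lev k q i}" for b
    using that by (cases b) (auto simp: J_apply)
  show l: "l2 (J k x)" by (rule l2_dom(1)[OF fock_l2[OF x, of k] _ inj le z]) auto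
  have 1: "nrm (J k x) \<le> 1 * nrm (col k x)" by (rule l2_dom(2)[OF fock_l2[OF x, of k] _ inj le z]) auto
  let ?Z = "{(n, i). R i k \<and> r i dvd int n + s i - s k}" and ?g = "\<lambda>(n, i). ((int n + s i - s k) div r i, i)"
  have inj': "inj_on ?g ?Z"
    by (rule inj_on_position)
  have le': "cmod (col k x b) \<le> 1 * cmod (J k x (?g b))" if "b \<in> ?Z" for b
    using that by (cases b) (auto simp: J_apply lev_div)
  have z': "col k x b = 0" if "b \<notin> ?Z" for b
    using that fock_pos[OF x, of _ _ k] by (cases b) auto
  have "nrm (col k x) \<le> 1 * nrm (J k x)" by (rule l2_dom(2)[OF l _ inj' le' z']) auto
  thus "nrm (J k x) = nrm (col k x)" using 1 by simp
qed

lemma J_diff: "J k (\<lambda>n i k. x n i k - y n i k) = (\<lambda>a. J k x a - J k y a)"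
  by (auto simp: J_def fun_eq_iff)

lemma J_tail: "tail n x \<Longrightarrow> lev k q i < int n \<Longrightarrow> J k x (q, i) = 0"
  by (auto simp: J_apply tail_def nat_less_iff)

text \<open>From degree \<open>N\<close> on, the powers of \<open>P\<close> are positive wherever
  the phase allows, so far out the coordinates are onto and Laurent images of tails can be brought
  back into the module.\<close>

lemma J_surj:
  "\<exists>N. \<forall>n\<ge>N. \<forall>y. (\<forall>k. l2 (y k)) \<longrightarrow> (\<forall>k q i. \<not> R i k \<or> lev k q i < int n \<longrightarrow> y k (q, i) = 0) \<longrightarrow>
     (\<exists>x\<in>fock P. tail n x \<and> (\<forall>k. J k x = y k))"
proof -
  obtain N where N: "\<forall>n\<ge>N. \<forall>i j. R i j \<longrightarrow> r i dvd int n + s i - s j \<longrightarrow> matpow P n i j > 0"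
    using eventually_pos by blast
  show ?thesis
  proof (intro exI[of _ N] allI impI)
    fix n and y :: "'a \<Rightarrow> int \<times> 'a \<Rightarrow> complex"
    assume n: "N \<le> n" and l: "\<forall>k. l2 (y k)"
      and z: "\<forall>k q i. \<not> R i k \<or> lev k q i < int n \<longrightarrow> y k (q, i) = 0"
    define x where "x m i k = (if R i k \<and> r i dvd int m + s i - s k then y k ((int m + s i - s k) div r i, i) else 0)" for m i k
    have xz: "x m i k = 0" if "m < n" for m i k
      using z that lev_div[of i m k] by (auto simp: x_def)
    have x0: "x m i k = 0" if "matpow P m i k = 0" for m i k
    proof (rule ccontr)
      assume nz: "x m i k \<noteq> 0"
      hence "R i k" "r i dvd int m + s i - s k" by (auto simp: x_def split: if_splits)
      moreover have "N \<le> m" using nz xz[of m i k] n by (meson not_less order_trans)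
      ultimately show False using N that by fastforce
    qed
    have "l2 (col k x)" for k
    proof (rule l2_dom(1)[of "y k" 1 "\<lambda>(m, i). ((int m + s i - s k) div r i, i)" "{(m, i). R i k \<and> r i dvd int m + s i - s k}"])
      show "inj_on (\<lambda>(m, i). ((int m + s i - s k) div r i, i)) {(m, i). R i k \<and> r i dvd int m + s i - s k}"
        by (rule inj_on_position)
    qed (use l in \<open>auto simp: x_def split: if_splits\<close>)
    hence xf: "x \<in> fock P" unfolding fock_iff using x0 by blast
    have "J k x (q, i) = y k (q, i)" for k q i
    proof (cases "R i k \<and> 0 \<le> lev k q i")
      case True
      have "int (nat (lev k q i)) + s i - s k = r i * q" using True by (simp add: lev_def)
      thus ?thesis using True r_pos[of i] by (simp add: J_apply x_def)
    next
      case False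
      thus ?thesis using z by (auto simp: J_apply)
    qed
    hence "J k x = y k" for k by auto
    thus "\<exists>x\<in>fock P. tail n x \<and> (\<forall>k. J k x = y k)"
      using xf xz by (intro bexI[of _ x]) (auto simp: tail_def)
  qed
qed

lemma laurent_level:
  assumes A: "laurent R A f"
  shows "\<exists>D. \<forall>n x k q i. tail n x \<longrightarrow> \<not> R i k \<or> lev k q i < int n - D \<longrightarrow> A (J k x) (q, i) = 0"
proof -
  obtain L where L: "L \<ge> 0"
    "\<And>y y' q a. (\<And>q' i. \<bar>q' - q\<bar> \<le> L \<Longrightarrow> y (q', i) = y' (q', i)) \<Longrightarrow> A y (q, a) = A y' (q, a)"
    using laurent_propagation[OF A] by blast
  \<comment> \<open>A displacement by \<open>L\<close> positions changes the degree by at most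
    \<open>r i * L\<close>, and a change of row adds at most two phases; sums over all states bound
    both.\<close>
  define D where "D = (\<Sum>i\<in>UNIV. r i) * L + 2 * (\<Sum>i\<in>UNIV. \<bar>s i\<bar>)"
  have "A (J k x) (q, i) = 0" if t: "tail n x" and h: "\<not> R i k \<or> lev k q i < int n - D" for n x k q i
  proof (cases "R i k")
    case False
    show ?thesis by (rule laurent_block[OF eqR A _ False]) (simp add: J_apply)
  next
    case True
    have "A (J k x) (q, i) = A (\<lambda>a. 0) (q, i)"
    proof (rule L(2))
      fix q' i' assume q': "\<bar>q' - q\<bar> \<le> L"
      show "J k x (q', i') = 0"
      proof (cases "R i' k")
        case R': True
        have re: "r i' = r i" using r_eq True R' by metis
        have sb: "\<bar>s j\<bar> \<le> (\<Sum>i\<in>UNIV. \<bar>s i\<bar>)" for j by (rule member_le_sum) auto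
        have rb: "r i \<le> (\<Sum>i\<in>UNIV. r i)" by (rule member_le_sum) (auto intro: less_imp_le r_pos)
        have "lev k q' i' = lev k q i + (r i * (q' - q) + s i - s i')"
          by (simp add: lev_def re algebra_simps)
        moreover have "r i * (q' - q) \<le> r i * L" using q' r_pos[of i] by (intro mult_left_mono) auto
        moreover have "r i * L \<le> (\<Sum>i\<in>UNIV. r i) * L" using rb L(1) by (intro mult_right_mono) auto
        ultimately have "lev k q' i' < int n"
          using h True sb[of i] sb[of i'] unfolding D_def by linarith
        thus ?thesis by (rule J_tail[OF t])
      qed (simp add: J_apply)
    qed
    thus ?thesis using laurent_zero_arg[OF A] by simp
  qed
  thus ?thesis by blast
qed

text \<open>Needed for products: the output of one Laurent operator has to be realised by a genuine
  module vector before the next operator can be compared on it.\<close>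

lemma laurent_lift:
  assumes A: "laurent R A f"
  shows "\<exists>D N. \<forall>n\<ge>N. \<forall>x\<in>fock P. tail (n + D) x \<longrightarrow> (\<exists>x'\<in>fock P. tail n x' \<and> (\<forall>k. J k x' = A (J k x)))"
proof -
  obtain D where D: "\<And>n x k q i. tail n x \<Longrightarrow> \<not> R i k \<or> lev k q i < int n - D \<Longrightarrow> A (J k x) (q, i) = 0"
    using laurent_level[OF A] by blast
  obtain N where N: "\<And>n y. n \<ge> N \<Longrightarrow> (\<And>k. l2 (y k)) \<Longrightarrow>
      (\<And>k q i. \<not> R i k \<or> lev k q i < int n \<Longrightarrow> y k (q, i) = 0) \<Longrightarrow>
     (\<exists>x\<in>fock P. tail n x \<and> (\<forall>k. J k x = y k))"
    using J_surj by blast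
  obtain M where M: "M \<ge> 0" "\<And>z a b. cmod (f z a b) \<le> M" using laurent_symbol_bounded[OF A] by blast
  show ?thesis
  proof (rule exI[of _ "nat D"], rule exI[of _ N], intro allI impI ballI)
    fix n x assume n: "N \<le> n" and x: "x \<in> fock P" and t: "tail (n + nat D) x"
    show "\<exists>x'\<in>fock P. tail n x' \<and> (\<forall>k. J k x' = A (J k x))"
    proof (rule N[OF n])
      show "l2 (A (J k x))" for k by (rule laurent_bound(1)[OF A M J_l2[OF x]])
      show "A (J k x) (q, i) = 0" if "\<not> R i k \<or> lev k q i < int n" for k q i
        by (rule D[OF t]) (use that in auto)
    qed
  qed
qed

section \<open>Calculus of asymptotic symbols\<close>

definition approx :: "'a fop \<Rightarrow> ((int \<times> 'a \<Rightarrow> complex) \<Rightarrow> int \<times> 'a \<Rightarrow> complex) \<Rightarrow> real \<Rightarrow> nat \<Rightarrow> bool" where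
  "approx T A e n \<longleftrightarrow> (\<forall>x\<in>fock P. tail n x \<longrightarrow> (\<forall>k. nrm (\<lambda>a. J k (T x) a - A (J k x) a) \<le> e * nrm (J k x)))"

text \<open>One Laurent pair approximates \<open>T\<close> on far tails and \<open>F\<close>
  uniformly, with the same error. Asking for both at once makes the relation closed under norm
  limits without forming limits of Laurent operators.\<close>

definition symb :: "'a fop \<Rightarrow> (complex \<Rightarrow> 'a \<Rightarrow> 'a \<Rightarrow> complex) \<Rightarrow> bool" where
  "symb T F \<longleftrightarrow> (\<forall>e>0. \<exists>A f n. laurent R A f \<and> approx T A e n \<and> (\<forall>z a b. cmod (F z a b - f z a b) \<le> e))"

lemma symbE:
  assumes "symb T F" "e > 0"
  obtains A f n where "laurent R A f" "approx T A e n" "\<And>z a b. cmod (F z a b - f z a b) \<le> e"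
  using assms unfolding symb_def by blast

lemma approxD: "approx T A e n \<Longrightarrow> x \<in> fock P \<Longrightarrow> tail n x \<Longrightarrow> nrm (\<lambda>a. J k (T x) a - A (J k x) a) \<le> e * nrm (J k x)"
  unfolding approx_def by blast

lemma laurent_l2: "laurent R A f \<Longrightarrow> l2 y \<Longrightarrow> l2 (A y)"
  using laurent_symbol_bounded[of R A f] laurent_bound(1)[of R A f] by blast

lemma symb_support:
  assumes "symb T F" "cmod z \<noteq> 1 \<or> \<not> R a b"
  shows "F z a b = 0"
proof -
  have "cmod (F z a b) \<le> e" if e: "e > 0" for e
  proof -
    obtain A f n where "laurent R A f" "approx T A e n" and c: "\<And>z a b. cmod (F z a b - f z a b) \<le> e"
      by (rule symbE[OF assms(1) e]) (rule that)
    note c[of z a b] this(1)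
    thus ?thesis using laurent_symbol_support[of R A f z a b] assms(2) by simp
  qed
  hence "cmod (F z a b) \<le> 0" using field_le_epsilon[of "cmod (F z a b)" 0] by simp
  thus ?thesis by simp
qed

lemma symb_bounded: "symb T F \<Longrightarrow> \<exists>M\<ge>0. \<forall>z a b. cmod (F z a b) \<le> M"
proof -
  assume F: "symb T F"
  obtain A f n where A: "laurent R A f" "approx T A 1 n" "\<And>z a b. cmod (F z a b - f z a b) \<le> 1"
    by (rule symbE[OF F zero_less_one]) (rule that)
  obtain M where M: "M \<ge> 0" "\<And>z a b. cmod (f z a b) \<le> M" using laurent_symbol_bounded[OF A(1)] by blast
  have "cmod (F z a b) \<le> M + 1" for z a b
    using norm_triangle_sub[of "F z a b" "f z a b"] A(3)[of z a b] M(2)[of z a b] by linarith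
  thus ?thesis using M(1) by (intro exI[of _ "M + 1"]) auto
qed

lemma symb_add:
  assumes T: "T \<in> Lops P" "S \<in> Lops P" and F: "symb T F" and G: "symb S G"
  shows "symb (op_add T S) (\<lambda>z a b. F z a b + G z a b)"
  unfolding symb_def
proof (intro allI impI)
  fix e :: real assume e: "e > 0"
  obtain A f n where A: "laurent R A f" "approx T A (e/2) n" "\<And>z a b. cmod (F z a b - f z a b) \<le> e/2"
    by (rule symbE[OF F half_gt_zero[OF e]]) (rule that)
  obtain B g m where B: "laurent R B g" "approx S B (e/2) m" "\<And>z a b. cmod (G z a b - g z a b) \<le> e/2"
    by (rule symbE[OF G half_gt_zero[OF e]]) (rule that)
  have "approx (op_add T S) (\<lambda>y a. A y a + B y a) e (max m n)"
    unfolding approx_def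
  proof (intro ballI impI allI)
    fix x k assume x: "x \<in> fock P" and t: "tail (max m n) x"
    have e1: "(\<lambda>a. J k (op_add T S x) a - (A (J k x) a + B (J k x) a))
      = (\<lambda>a. (J k (T x) a - A (J k x) a) + (J k (S x) a - B (J k x) a))"
      by (auto simp: fun_eq_iff J_def op_add_def)
    have "nrm (\<lambda>a. J k (op_add T S x) a - (A (J k x) a + B (J k x) a))
      \<le> nrm (\<lambda>a. J k (T x) a - A (J k x) a) + nrm (\<lambda>a. J k (S x) a - B (J k x) a)"
      unfolding e1
      by (rule l2_add(2)[OF l2_diff(1)[OF J_l2[OF Lops_fock[OF T(1) x]] laurent_l2[OF A(1) J_l2[OF x]]]
            l2_diff(1)[OF J_l2[OF Lops_fock[OF T(2) x]] laurent_l2[OF B(1) J_l2[OF x]]]])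
    also have "\<dots> \<le> e/2 * nrm (J k x) + e/2 * nrm (J k x)"
      by (intro add_mono approxD[OF A(2) x] approxD[OF B(2) x] tail_mono[OF t]) auto
    finally show "nrm (\<lambda>a. J k (op_add T S x) a - (A (J k x) a + B (J k x) a)) \<le> e * nrm (J k x)" by simp
  qed
  moreover have "cmod (F z a b + G z a b - (f z a b + g z a b)) \<le> e" for z a b
    using norm_triangle_ineq[of "F z a b - f z a b" "G z a b - g z a b"] A(3)[of z a b] B(3)[of z a b]
    by (simp add: algebra_simps)
  ultimately show "\<exists>A f n. laurent R A f \<and> approx (op_add T S) A e n \<and> (\<forall>z a b. cmod (F z a b + G z a b - f z a b) \<le> e)"
    using laurent_add[OF A(1) B(1)] by blast
qed

lemma symb_scale:
  assumes F: "symb T F"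
  shows "symb (op_scale c T) (\<lambda>z a b. c * F z a b)"
  unfolding symb_def
proof (intro allI impI)
  fix e :: real assume e: "e > 0"
  define d where "d = e / (cmod c + 1)"
  have p: "cmod c + 1 > 0" using norm_ge_zero[of c] by linarith
  have d: "d > 0" "cmod c * d \<le> e"
    using e p by (auto simp: d_def field_simps)
  obtain A f n where A: "laurent R A f" "approx T A d n" "\<And>z a b. cmod (F z a b - f z a b) \<le> d"
    by (rule symbE[OF F d(1)]) (rule that)
  have "approx (op_scale c T) (\<lambda>y a. c * A y a) e n"
    unfolding approx_def
  proof (intro ballI impI allI)
    fix x k assume x: "x \<in> fock P" and t: "tail n x"
    have e1: "(\<lambda>a. J k (op_scale c T x) a - c * A (J k x) a) = (\<lambda>a. c * (J k (T x) a - A (J k x) a))"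
      by (auto simp: fun_eq_iff J_def op_scale_def right_diff_distrib)
    have "cmod c * nrm (\<lambda>a. J k (T x) a - A (J k x) a) \<le> cmod c * (d * nrm (J k x))"
      by (intro mult_left_mono approxD[OF A(2) x t]) auto
    also have "\<dots> \<le> e * nrm (J k x)" using mult_right_mono[OF d(2), of "nrm (J k x)"] by (simp add: mult.assoc)
    finally show "nrm (\<lambda>a. J k (op_scale c T x) a - c * A (J k x) a) \<le> e * nrm (J k x)"
      unfolding e1 nrm_scale .
  qed
  moreover have "cmod (c * F z a b - c * f z a b) \<le> e" for z a b
  proof -
    have "cmod (c * F z a b - c * f z a b) = cmod c * cmod (F z a b - f z a b)"
      by (simp add: norm_mult[symmetric] right_diff_distrib)
    also have "\<dots> \<le> cmod c * d" by (intro mult_left_mono A) auto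
    finally show ?thesis using d(2) by linarith
  qed
  ultimately show "\<exists>A f n. laurent R A f \<and> approx (op_scale c T) A e n \<and> (\<forall>z a b. cmod (c * F z a b - f z a b) \<le> e)"
    using laurent_scale[OF A(1)] by blast
qed

lemma symb_diff:
  assumes "T \<in> Lops P" "S \<in> Lops P" "symb T F" "symb S G"
  shows "symb (op_diff T S) (\<lambda>z a b. F z a b - G z a b)"
  using symb_add[OF assms(1) Lops_closed(4)[OF assms(2)] assms(3) symb_scale[OF assms(4)], of "-1"]
  by (simp add: op_diff_eq)

lemma symb_zero: "symb (\<lambda>x. fzero) (\<lambda>z a b. 0)"
proof -
  have "J k fzero = (\<lambda>a. 0)" for k by (auto simp: J_def fzero_def)
  hence "approx (\<lambda>x. fzero) (\<lambda>y a. 0) e 0" if "e > 0" for e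
    using that unfolding approx_def by simp
  thus ?thesis unfolding symb_def using laurent.zero by fastforce
qed

text \<open>The approximation of \<open>T\<close> is known only on module vectors, so
  \<open>B (J k x)\<close> is first realised as the coordinates of such a vector \<open>x'\<close>.
  Two errors remain: \<open>T\<close> applied to \<open>S x - x'\<close>, and the defect of
  \<open>A\<close> at \<open>x'\<close>.\<close>

lemma symb_comp:
  assumes T: "T \<in> Lops P" and S: "S \<in> Lops P" and F: "symb T F" and G: "symb S G"
  shows "symb (T \<circ> S) (mult_symbol F G)"
  unfolding symb_def
proof (intro allI impI)
  fix e :: real assume e: "e > 0"
  let ?d = "real CARD('a)"
  obtain C where C: "C \<ge> 0" "opb P T C" using Lops_bounded[OF T] by blast
  obtain MF where MF: "MF \<ge> 0" "\<And>z a b. cmod (F z a b) \<le> MF" using symb_bounded[OF F] by blast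
  \<comment> \<open>\<open>K2\<close> dominates the two factors that multiply the error of
    \<open>B\<close>, one from the operators and one from the symbols. \<open>B\<close> is fixed
    before \<open>A\<close> because the error allowed for \<open>A\<close> depends on the size of
    \<open>g\<close>.\<close>
  define K2 where "K2 = C + ?d * MF + 1"
  have K2: "K2 > 0" "C \<le> K2" "?d * MF \<le> K2" using C MF by (auto simp: K2_def add_pos_nonneg intro: add_nonneg_pos)
  define e2 where "e2 = e / (2 * K2)"
  have e2: "e2 > 0" "K2 * e2 = e / 2" using e K2 by (auto simp: e2_def)
  obtain B g m where B: "laurent R B g" "approx S B e2 m" "\<And>z a b. cmod (G z a b - g z a b) \<le> e2"
    by (rule symbE[OF G e2(1)]) (rule that)
  obtain Mg where Mg: "Mg \<ge> 0" "\<And>z a b. cmod (g z a b) \<le> Mg" using laurent_symbol_bounded[OF B(1)] by blast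
  define K1 where "K1 = ?d * Mg + 1"
  have K1: "K1 > 0" "?d * Mg \<le> K1" using Mg by (auto simp: K1_def intro: add_nonneg_pos)
  define e1 where "e1 = e / (2 * K1)"
  have e1: "e1 > 0" "K1 * e1 = e / 2" using e K1 by (auto simp: e1_def)
  obtain A f n where A: "laurent R A f" "approx T A e1 n" "\<And>z a b. cmod (F z a b - f z a b) \<le> e1"
    by (rule symbE[OF F e1(1)]) (rule that)
  obtain D N where DN: "\<And>n x. n \<ge> N \<Longrightarrow> x \<in> fock P \<Longrightarrow> tail (n + D) x \<Longrightarrow>
      (\<exists>x'\<in>fock P. tail n x' \<and> (\<forall>k. J k x' = B (J k x)))"
    using laurent_lift[OF B(1)] by blast
  \<comment> \<open>Degrees past \<open>n\<close> serve the approximation of \<open>T\<close>,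
    degrees past \<open>N\<close> the lift of \<open>B\<close>.\<close>
  define n' where "n' = max n N"
  have "approx (T \<circ> S) (\<lambda>y. A (B y)) e (max m (n' + D))"
    unfolding approx_def
  proof (intro ballI impI allI)
    fix x k assume x: "x \<in> fock P" and t: "tail (max m (n' + D)) x"
    obtain x' where x': "x' \<in> fock P" "tail n' x'" "\<And>k. J k x' = B (J k x)"
      using DN[of n' x] x tail_mono[OF t, of "n' + D"] by (auto simp: n'_def)
    note Sx = Lops_fock[OF S x]
    have 1: "nrm (\<lambda>a. J k (T (S x)) a - J k (T x') a) \<le> C * (e2 * nrm (J k x))"
    proof -
      have "(\<lambda>a. J k (T (S x)) a - J k (T x') a) = J k (T (\<lambda>n i k. S x n i k - x' n i k))"
        unfolding Lops_diff[OF T Sx x'(1)] J_diff ..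
      hence "nrm (\<lambda>a. J k (T (S x)) a - J k (T x') a) = nrm (col k (T (\<lambda>n i k. S x n i k - x' n i k)))"
        using J_nrm[OF Lops_fock[OF T fock_diff[OF Sx x'(1)]]] by simp
      also have "\<dots> \<le> C * nrm (col k (\<lambda>n i k. S x n i k - x' n i k))"
        using C(2) fock_diff[OF Sx x'(1)] unfolding opb_def by blast
      also have "nrm (col k (\<lambda>n i k. S x n i k - x' n i k)) = nrm (\<lambda>a. J k (S x) a - B (J k x) a)"
        using J_nrm[OF fock_diff[OF Sx x'(1)], of k] unfolding J_diff x'(3) by simp
      also have "C * nrm (\<lambda>a. J k (S x) a - B (J k x) a) \<le> C * (e2 * nrm (J k x))"
        by (intro mult_left_mono C approxD[OF B(2) x] tail_mono[OF t]) auto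
      finally show ?thesis .
    qed
    have 2: "nrm (\<lambda>a. J k (T x') a - A (B (J k x)) a) \<le> e1 * (?d * Mg * nrm (J k x))"
    proof -
      have "nrm (\<lambda>a. J k (T x') a - A (J k x') a) \<le> e1 * nrm (J k x')"
        by (rule approxD[OF A(2) x'(1) tail_mono[OF x'(2)]]) (simp add: n'_def)
      also have "\<dots> \<le> e1 * (?d * Mg * nrm (J k x))"
        unfolding x'(3) using e1 by (intro mult_left_mono laurent_bound(2)[OF B(1) Mg J_l2[OF x]]) auto
      finally show ?thesis unfolding x'(3) .
    qed
    have l: "l2 (J k (T (S x)))" "l2 (J k (T x'))" "l2 (A (B (J k x)))"
      by (rule J_l2[OF Lops_fock[OF T Sx]], rule J_l2[OF Lops_fock[OF T x'(1)]],
          rule laurent_l2[OF A(1) laurent_l2[OF B(1) J_l2[OF x]]])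
    have "nrm (\<lambda>a. J k ((T \<circ> S) x) a - A (B (J k x)) a)
       = nrm (\<lambda>a. (J k (T (S x)) a - J k (T x') a) + (J k (T x') a - A (B (J k x)) a))" by simp
    also have "\<dots> \<le> nrm (\<lambda>a. J k (T (S x)) a - J k (T x') a) + nrm (\<lambda>a. J k (T x') a - A (B (J k x)) a)"
      by (rule l2_add(2)[OF l2_diff(1)[OF l(1,2)] l2_diff(1)[OF l(2,3)]])
    also have "\<dots> \<le> C * (e2 * nrm (J k x)) + e1 * (?d * Mg * nrm (J k x))" using 1 2 by linarith
    also have "\<dots> = (C * e2) * nrm (J k x) + (?d * Mg * e1) * nrm (J k x)" by simp
    also have "\<dots> \<le> (K2 * e2) * nrm (J k x) + (K1 * e1) * nrm (J k x)"
      using K1 K2 e1(1) e2(1) by (intro add_mono mult_right_mono) auto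
    also have "\<dots> = e * nrm (J k x)" unfolding e1(2) e2(2) by (simp add: algebra_simps)
    finally show "nrm (\<lambda>a. J k ((T \<circ> S) x) a - A (B (J k x)) a) \<le> e * nrm (J k x)" .
  qed
  moreover have "cmod (mult_symbol F G z a b - (\<Sum>l\<in>UNIV. f z a l * g z l b)) \<le> e" for z a b
  proof -
    have "mult_symbol F G z a b - (\<Sum>l\<in>UNIV. f z a l * g z l b)
      = (\<Sum>l\<in>UNIV. F z a l * (G z l b - g z l b) + (F z a l - f z a l) * g z l b)"
      unfolding mult_symbol_def sum_subtractf[symmetric] by (intro sum.cong) (auto simp: algebra_simps)
    also have "cmod \<dots> \<le> (\<Sum>l\<in>(UNIV::'a set). MF * e2 + e1 * Mg)"
    proof (rule sum_norm_le)
      fix l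
      have "cmod (F z a l * (G z l b - g z l b) + (F z a l - f z a l) * g z l b)
        \<le> cmod (F z a l) * cmod (G z l b - g z l b) + cmod (F z a l - f z a l) * cmod (g z l b)"
        using norm_triangle_ineq[of "F z a l * (G z l b - g z l b)" "(F z a l - f z a l) * g z l b"]
        by (simp add: norm_mult)
      also have "\<dots> \<le> MF * e2 + e1 * Mg"
        using MF Mg A(3) B(3) e1(1) e2(1) by (intro add_mono mult_mono) auto
      finally show "cmod (F z a l * (G z l b - g z l b) + (F z a l - f z a l) * g z l b) \<le> MF * e2 + e1 * Mg" .
    qed
    also have "\<dots> = (?d * MF) * e2 + (?d * Mg) * e1" by (simp add: algebra_simps)
    also have "\<dots> \<le> K2 * e2 + K1 * e1" using K1 K2 e1(1) e2(1) by (intro add_mono mult_right_mono) auto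
    finally show ?thesis unfolding e1(2) e2(2) by simp
  qed
  moreover have "laurent R (\<lambda>y. A (B y)) (\<lambda>z a b. \<Sum>l\<in>UNIV. f z a l * g z l b)"
    by (rule laurent_comp[OF _ B(1) A(1)]) (rule R_trans)
  ultimately show "\<exists>A f n. laurent R A f \<and> approx (T \<circ> S) A e n \<and> (\<forall>z a b. cmod (mult_symbol F G z a b - f z a b) \<le> e)"
    by (intro exI conjI allI)
qed

section \<open>Norms of operators against norms of symbols\<close>

lemma symb_upper:
  assumes T: "T \<in> Lops P" and F: "symb T F" and M: "0 \<le> M" "\<And>z a b. cmod (F z a b) \<le> M" and e: "e > 0"
  shows "\<exists>n. \<forall>x\<in>fock P. tail n x \<longrightarrow> (\<forall>k. nrm (col k (T x)) \<le> (real CARD('a) * M + e) * nrm (col k x))"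
proof -
  let ?d = "real CARD('a)"
  \<comment> \<open>The defect \<open>d\<close> of the approximation and \<open>CARD('a)\<close>
    times the error \<open>d\<close> of the symbol together use up \<open>e\<close>.\<close>
  define d where "d = e / (?d + 1)"
  have d: "d > 0" "?d * d + d = e"
  proof -
    have "?d + 1 > 0" by (simp add: add_nonneg_pos)
    thus "d > 0" using e by (simp add: d_def)
    have "?d * d + d = d * (?d + 1)" by (simp add: algebra_simps)
    also have "\<dots> = e" using \<open>?d + 1 > 0\<close> by (simp add: d_def)
    finally show "?d * d + d = e" .
  qed
  obtain A f n where A: "laurent R A f" "approx T A d n" "\<And>z a b. cmod (F z a b - f z a b) \<le> d"
    by (rule symbE[OF F d(1)]) (rule that)
  have f: "cmod (f z a b) \<le> M + d" for z a b
    using norm_triangle_sub[of "f z a b" "F z a b"] A(3)[of z a b] M(2)[of z a b]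
    by (simp add: norm_minus_commute)
  have "nrm (col k (T x)) \<le> (?d * M + e) * nrm (col k x)" if x: "x \<in> fock P" "tail n x" for x k
  proof -
    note l = J_l2[OF Lops_fock[OF T x(1)], of k] laurent_l2[OF A(1) J_l2[OF x(1), of k]]
    have "nrm (col k (T x)) = nrm (\<lambda>a. (J k (T x) a - A (J k x) a) + A (J k x) a)"
      using J_nrm[OF Lops_fock[OF T x(1)]] by simp
    also have "\<dots> \<le> nrm (\<lambda>a. J k (T x) a - A (J k x) a) + nrm (A (J k x))"
      by (rule l2_add(2)[OF l2_diff(1)[OF l] l(2)])
    also have "\<dots> \<le> d * nrm (J k x) + ?d * (M + d) * nrm (J k x)"
      using d(1) M(1) f by (intro add_mono approxD[OF A(2) x] laurent_bound(2)[OF A(1)] J_l2 x) auto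
    also have "\<dots> = (?d * M + (?d * d + d)) * nrm (J k x)" by (simp add: algebra_simps)
    finally show ?thesis unfolding d(2) J_nrm[OF x(1)] .
  qed
  thus ?thesis by blast
qed

text \<open>The operator is tested on long windows of the eigensequences \<open>q \<mapsto> z powi (- q)\<close> far out.\<close>

lemma symb_lower:
  assumes T: "T \<in> Lops P" and F: "symb T F" and C: "0 \<le> C" "opb P T C"
  shows "cmod (F z a b) \<le> C"
proof (cases "cmod z = 1")
  case False
  thus ?thesis using symb_support[OF F] C(1) by simp
next
  case z: True
  have "cmod (F z a b) \<le> C + 2 * e" if e: "e > 0" for e
  proof -
    obtain A f n where A: "laurent R A f" "approx T A e n" "\<And>z a b. cmod (F z a b - f z a b) \<le> e"
      by (rule symbE[OF F e]) (rule that)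
    obtain L where L: "L \<ge> 0"
      "\<And>y y' q a. (\<And>q' i. \<bar>q' - q\<bar> \<le> L \<Longrightarrow> y (q', i) = y' (q', i)) \<Longrightarrow> A y (q, a) = A y' (q, a)"
      using laurent_propagation[OF A(1)] by blast
    obtain N where N: "\<And>n y. n \<ge> N \<Longrightarrow> (\<And>k. l2 (y k)) \<Longrightarrow>
        (\<And>k q i. \<not> R i k \<or> lev k q i < int n \<Longrightarrow> y k (q, i) = 0) \<Longrightarrow>
       (\<exists>x\<in>fock P. tail n x \<and> (\<forall>k. J k x = y k))"
      using J_surj by blast
    define m where "m = max n N"
    \<comment> \<open>A window of length \<open>K\<close> has squared norm \<open>K\<close>, and at
      \<open>K - 2 * L\<close> positions its image has the modulus of \<open>f z a b\<close>; for
      growing \<open>K\<close> the boundary loss becomes negligible.\<close>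
    have key: "(real K - 2 * of_int L) * (cmod (f z a b))\<^sup>2 \<le> real K * (C + e)\<^sup>2" for K :: nat
    proof (cases "int K \<ge> 2 * L")
      case False
      hence "real K - 2 * of_int L \<le> 0" by linarith
      hence "(real K - 2 * of_int L) * (cmod (f z a b))\<^sup>2 \<le> 0" by (simp add: mult_nonpos_nonneg)
      also have "0 \<le> real K * (C + e)\<^sup>2" by simp
      finally show ?thesis .
    next
      case K: True
      define I where "I = {int m..<int m + int K}"
      define y where "y = (\<lambda>(q, i). if i = b \<and> q \<in> I then z powi (- q) else 0)"
      have yn: "l2 y" "(nrm y)\<^sup>2 = real K"
      proof -
        have 1: "finite (I \<times> {b})" by (simp add: I_def)
        have 2: "y c = 0" if "c \<notin> I \<times> {b}" for c using that by (cases c) (auto simp: y_def)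
        show "l2 y" by (rule finite_support_l2(1)[OF 1 2])
        have "(nrm y)\<^sup>2 = (\<Sum>c\<in>I \<times> {b}. (cmod (y c))\<^sup>2)" by (rule finite_support_l2(2)[OF 1 2])
        also have "\<dots> = (\<Sum>c\<in>I \<times> {b}. 1)"
          by (intro sum.cong refl) (auto simp: y_def norm_power_int z)
        finally show "(nrm y)\<^sup>2 = real K" by (simp add: I_def)
      qed
      obtain x where x: "x \<in> fock P" "tail m x" "\<And>k. J k x = (if k = b then y else (\<lambda>c. 0))"
      proof -
        have "\<exists>x\<in>fock P. tail m x \<and> (\<forall>k. J k x = (if k = b then y else (\<lambda>c. 0)))"
        proof (rule N)
          show "N \<le> m" by (simp add: m_def)
          show "l2 (if k = b then y else (\<lambda>c. 0))" for k using yn(1) by simp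
          fix k q i assume h: "\<not> R i k \<or> lev k q i < int m"
          show "(if k = b then y else (\<lambda>c. 0)) (q, i) = 0"
          proof (rule ccontr)
            assume "(if k = b then y else (\<lambda>c. 0)) (q, i) \<noteq> 0"
            hence k: "k = b" "i = b" "q \<ge> int m" by (auto simp: y_def I_def split: if_splits)
            \<comment> \<open>Row \<open>b\<close> of column \<open>b\<close> has degree
              \<open>r b * q\<close> at position \<open>q\<close>, which is at least
              \<open>q\<close>; so the window lies in the required tail.\<close>
            have "q * 1 \<le> q * r b" using k r_pos[of b] by (intro mult_left_mono) auto
            hence "int m \<le> lev k q i" using k by (simp add: lev_def mult.commute)
            thus False using h k by simp
          qed
        qed
        thus thesis using that by blast
      qed
      note l = J_l2[OF Lops_fock[OF T x(1)], of b] laurent_l2[OF A(1) yn(1)]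
      have Jb: "J b x = y" by (simp add: x(3))
      have "nrm (A y) = nrm (\<lambda>c. J b (T x) c - (J b (T x) c - A y c))" by simp
      also have "\<dots> \<le> nrm (J b (T x)) + nrm (\<lambda>c. J b (T x) c - A y c)"
        by (rule l2_diff(2)[OF l(1) l2_diff(1)[OF l]])
      also have "\<dots> \<le> C * nrm y + e * nrm y"
      proof (rule add_mono)
        have "nrm (col b (T x)) \<le> C * nrm (col b x)" using C(2) x(1) by (simp add: opb_def)
        thus "nrm (J b (T x)) \<le> C * nrm y"
          using J_nrm[OF Lops_fock[OF T x(1)], of b] J_nrm[OF x(1), of b] Jb by simp
        show "nrm (\<lambda>c. J b (T x) c - A y c) \<le> e * nrm y"
          using approxD[OF A(2) x(1), of b] tail_mono[OF x(2), of n] Jb by (simp add: m_def)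
      qed
      finally have "nrm (A y) \<le> (C + e) * nrm y" by (simp add: algebra_simps)
      hence "(nrm (A y))\<^sup>2 \<le> ((C + e) * nrm y)\<^sup>2" by (intro power_mono) auto
      hence up: "(nrm (A y))\<^sup>2 \<le> real K * (C + e)\<^sup>2" by (simp add: power_mult_distrib yn(2) mult.commute)
      \<comment> \<open>The positions of the window from which \<open>A\<close> cannot read past
        either end.\<close>
      define I' where "I' = {int m + L..<int m + int K - L}"
      have "A y (q, a) = f z a b * z powi (- q)" if q: "q \<in> I'" for q
      proof -
        have "A y (q, a) = A (\<lambda>(q, i). if i = b then z powi (- q) else 0) (q, a)"
          by (rule L(2)) (use q in \<open>auto simp: y_def I_def I'_def abs_le_iff\<close>)
        also have "\<dots> = f z a b * z powi (- q)" by (rule laurent_eigen[OF z A(1)])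
        finally show ?thesis .
      qed
      hence "(\<Sum>c\<in>I' \<times> {a}. (cmod (A y c))\<^sup>2) = (\<Sum>c\<in>I' \<times> {a}. (cmod (f z a b))\<^sup>2)"
        by (intro sum.cong refl) (auto simp: norm_mult norm_power_int z)
      also have "\<dots> = (real K - 2 * of_int L) * (cmod (f z a b))\<^sup>2"
        using K L(1) by (simp add: I'_def)
      finally have "(real K - 2 * of_int L) * (cmod (f z a b))\<^sup>2 = (\<Sum>c\<in>I' \<times> {a}. (cmod (A y c))\<^sup>2)" ..
      also have "\<dots> \<le> (nrm (A y))\<^sup>2" by (rule sum_sq_le_nrm[OF l(2)]) (simp add: I'_def)
      finally show ?thesis using up by linarith
    qed
    have "cmod (f z a b) \<le> C + e"
    proof (rule ccontr)
      assume "\<not> cmod (f z a b) \<le> C + e"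
      hence "(C + e)\<^sup>2 < (cmod (f z a b))\<^sup>2" using C(1) e by (intro power_strict_mono) auto
      hence g: "(cmod (f z a b))\<^sup>2 - (C + e)\<^sup>2 > 0" by simp
      obtain K :: nat where "2 * of_int L * (cmod (f z a b))\<^sup>2 < real K * ((cmod (f z a b))\<^sup>2 - (C + e)\<^sup>2)"
        using reals_Archimedean3[OF g] by blast
      thus False using key[of K] by (simp add: algebra_simps)
    qed
    thus ?thesis using norm_triangle_sub[of "F z a b" "f z a b"] A(3)[of z a b] by linarith
  qed
  hence "cmod (F z a b) \<le> C + e" if "e > 0" for e using that[THEN half_gt_zero] by fastforce
  thus ?thesis by (rule field_le_epsilon)
qed

text \<open>The difference of the two symbols is a symbol of the zero operator, and
  \<open>symb_lower\<close> bounds it by 0.\<close>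

lemma symb_unique:
  assumes "T \<in> Lops P" "symb T F" "symb T G"
  shows "F = G"
proof (intro ext)
  fix z a b
  have "op_diff T T = (\<lambda>x. fzero)" by (auto simp: op_diff_def fzero_def)
  hence "opb P (op_diff T T) 0" by (simp add: opb_def fzero_def split_def)
  from symb_lower[OF Lops_closed(2)[OF assms(1,1)] symb_diff[OF assms(1,1,2,3)] order_refl this, of z a b]
  show "F z a b = G z a b" by simp
qed

text \<open>A member of the sequence close to \<open>T\<close> lends its Laurent approximation to
  \<open>T\<close>.\<close>

lemma symb_limit:
  fixes X :: "nat \<Rightarrow> 'a fop"
  assumes X: "\<And>s. X s \<in> Lops P" and T: "T \<in> Lops P" and l: "(\<lambda>s. opnorm P (op_diff (X s) T)) \<longlonglongrightarrow> 0"
    and F: "\<And>s. symb (X s) (F s)" and u: "\<And>e. e > 0 \<Longrightarrow> \<exists>N. \<forall>s\<ge>N. \<forall>z a b. cmod (F s z a b - G z a b) \<le> e"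
  shows "symb T G"
  unfolding symb_def
proof (intro allI impI)
  fix e :: real assume e: "e > 0"
  from u[OF half_gt_zero[OF e]] obtain N where N: "\<And>s z a b. s \<ge> N \<Longrightarrow> cmod (F s z a b - G z a b) \<le> e/2" by blast
  from order_tendstoD(2)[OF l, of "e/2"] e obtain N' where N': "\<And>s. s \<ge> N' \<Longrightarrow> opnorm P (op_diff (X s) T) < e/2"
    by (auto simp: eventually_sequentially)
  define t where "t = max N N'"
  obtain A f n where A: "laurent R A f" "approx (X t) A (e/2) n" "\<And>z a b. cmod (F t z a b - f z a b) \<le> e/2"
    by (rule symbE[OF F half_gt_zero[OF e]]) (rule that)
  have "approx T A e n"
    unfolding approx_def
  proof (intro ballI impI allI)
    fix x k assume x: "x \<in> fock P" and tl: "tail n x"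
    note Tx = Lops_fock[OF T x] and Xx = Lops_fock[OF X[of t] x]
    have d: "(\<lambda>a. J k (X t x) a - J k (T x) a) = J k (op_diff (X t) T x)"
      by (auto simp: J_def op_diff_def fun_eq_iff)
    have "nrm (\<lambda>a. J k (T x) a - A (J k x) a) = nrm (\<lambda>a. (J k (X t x) a - A (J k x) a) - (J k (X t x) a - J k (T x) a))" by simp
    also have "\<dots> \<le> nrm (\<lambda>a. J k (X t x) a - A (J k x) a) + nrm (\<lambda>a. J k (X t x) a - J k (T x) a)"
      by (rule l2_diff(2)[OF l2_diff(1)[OF J_l2[OF Xx] laurent_l2[OF A(1) J_l2[OF x]]] l2_diff(1)[OF J_l2[OF Xx] J_l2[OF Tx]]])
    also have "\<dots> \<le> e/2 * nrm (J k x) + e/2 * nrm (J k x)"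
    proof (rule add_mono[OF approxD[OF A(2) x tl]])
      have "nrm (J k (op_diff (X t) T x)) \<le> opnorm P (op_diff (X t) T) * nrm (J k x)"
        using opb_opnorm[OF Lops_closed(2)[OF X[of t] T]] x J_nrm[OF x, of k]
          J_nrm[OF Lops_fock[OF Lops_closed(2)[OF X[of t] T] x], of k]
        unfolding opb_def by simp
      also have "\<dots> \<le> e/2 * nrm (J k x)" using N'[of t] by (intro mult_right_mono) (auto simp: t_def)
      finally show "nrm (\<lambda>a. J k (X t x) a - J k (T x) a) \<le> e/2 * nrm (J k x)" unfolding d .
    qed
    finally show "nrm (\<lambda>a. J k (T x) a - A (J k x) a) \<le> e * nrm (J k x)" by simp
  qed
  moreover have "cmod (G z a b - f z a b) \<le> e" for z a b
    using norm_triangle_ineq[of "G z a b - F t z a b" "F t z a b - f z a b"] N[of t z a b] A(3)[of z a b]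
    by (simp add: norm_minus_commute t_def)
  ultimately show "\<exists>A f n. laurent R A f \<and> approx T A e n \<and> (\<forall>z a b. cmod (G z a b - f z a b) \<le> e)"
    using A(1) by blast
qed

text \<open>The relation between \<open>q\<close> and \<open>p\<close> says that moving
  \<open>q\<close> degrees from row \<open>j\<close> to row \<open>i\<close> moves \<open>p\<close>
  positions in the coordinates \<open>J\<close>. The difference from the Laurent unit then
  multiplies the shifted entry by \<open>w m k - c\<close>, which is small far out.\<close>

lemma symb_wunit:
  assumes R: "R i j" and q: "q = r i * p + s j - s i"
    and b: "\<And>n k. q \<le> int n \<Longrightarrow> cmod (w n k) \<le> C" "0 \<le> C"
    and w: "\<And>e. e > 0 \<Longrightarrow> \<exists>N. \<forall>m\<ge>N. \<forall>k. q \<le> int m \<longrightarrow> matpow P m i k \<noteq> 0 \<longrightarrow> matpow P (nat (int m - q)) j k \<noteq> 0 \<longrightarrow> cmod (w m k - c) \<le> e"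
  shows "symb (wunit P i j q w) (\<lambda>z a b. c * monom_symbol i j p z a b)"
  unfolding symb_def
proof (intro allI impI)
  fix e :: real assume e: "e > 0"
  obtain N where N: "\<And>m k. m \<ge> N \<Longrightarrow> q \<le> int m \<Longrightarrow> matpow P m i k \<noteq> 0 \<Longrightarrow> matpow P (nat (int m - q)) j k \<noteq> 0 \<Longrightarrow> cmod (w m k - c) \<le> e"
    using w[OF e] by blast
  obtain N' where N': "\<forall>n\<ge>N'. \<forall>i j. R i j \<longrightarrow> r i dvd int n + s i - s j \<longrightarrow> matpow P n i j > 0"
    using eventually_pos by blast
  \<comment> \<open>The margin \<open>nat \<bar>q\<bar>\<close> keeps the target degree above both
    thresholds when \<open>q\<close> is negative.\<close>
  define n where "n = max N N' + nat \<bar>q\<bar>"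
  have "approx (wunit P i j q w) (\<lambda>y a. c * laurent_unit i j p y a) e n"
    unfolding approx_def
  proof (intro ballI impI allI)
    fix x k assume x: "x \<in> fock P" and t: "tail n x"
    have lev: "lev k (q' - p) j = lev k q' i - q" for q'
      using r_eq[OF R] by (simp add: lev_def q algebra_simps)
    show "nrm (\<lambda>a. J k (wunit P i j q w x) a - c * laurent_unit i j p (J k x) a) \<le> e * nrm (J k x)"
    proof (rule l2_dom(2)[OF J_l2[OF x], of _ "\<lambda>(q', a). (q' - p, j)" "{(q' :: int, a). a = i}"])
      show "inj_on (\<lambda>(q', a). (q' - p, j)) {(q' :: int, a). a = i}" by (rule inj_onI) auto
      show "J k (wunit P i j q w x) b - c * laurent_unit i j p (J k x) b = 0" if "b \<notin> {(q', a). a = i}" for b :: "int \<times> 'a"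
        using that by (cases b) (auto simp: J_apply laurent_unit_def wunit_apply[OF x])
      fix b :: "int \<times> 'a" assume "b \<in> {(q', a). a = i}"
      then obtain q' where bq: "b = (q', i)" by auto
      show "cmod (J k (wunit P i j q w x) b - c * laurent_unit i j p (J k x) b) \<le> e * cmod (J k x ((\<lambda>(q', a). (q' - p, j)) b))"
      proof (cases "J k x (q' - p, j) = 0")
        case True
        have "J k (wunit P i j q w x) (q', i) = 0"
        proof (rule ccontr)
          assume "J k (wunit P i j q w x) (q', i) \<noteq> 0"
          hence h: "R i k" "0 \<le> lev k q' i" "q \<le> lev k q' i" "x (nat (lev k q' i - q)) j k \<noteq> 0"
            by (auto simp: J_apply wunit_apply[OF x] split: if_splits)
          hence "R j k" using R R_sym R_trans by blast
          thus False using True h by (simp add: J_apply lev)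
        qed
        thus ?thesis using True by (simp add: bq laurent_unit_def)
      next
        case nz: False
        hence h: "R j k" "q \<le> lev k q' i" "x (nat (lev k q' i - q)) j k \<noteq> 0"
          by (auto simp: J_apply lev split: if_splits)
        define m where "m = nat (lev k q' i - q)"
        have xm: "x m j k \<noteq> 0" using h by (simp add: m_def)
        hence "n \<le> m" using t unfolding tail_def by (meson not_less)
        hence mm: "int n \<le> lev k q' i - q" using h(2) by (simp add: m_def)
        have L: "0 \<le> lev k q' i" "N \<le> nat (lev k q' i)" "N' \<le> nat (lev k q' i)"
          using mm unfolding n_def by linarith+
        define l where "l = nat (lev k q' i)"
        have il: "int l = lev k q' i" using L by (simp add: l_def)
        have Rik: "R i k" using R h(1) R_trans by blast
        have "r i dvd int l + s i - s k" unfolding il by (simp add: lev_def)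
        hence pos: "matpow P l i k > 0" using N' Rik L(3) unfolding l_def by blast
        have pj: "matpow P (nat (int l - q)) j k \<noteq> 0"
          using xm fock_zero[OF x] unfolding il m_def by blast
        have wb: "cmod (w l k - c) \<le> e" by (rule N[OF _ _ _ pj]) (use L h(2) il pos in \<open>auto simp: l_def\<close>)
        have 1: "J k (wunit P i j q w x) (q', i) = w l k * J k x (q' - p, j)"
          using pos Rik L(1) h il by (simp add: J_apply wunit_apply[OF x] lev l_def[symmetric])
        have "cmod (J k (wunit P i j q w x) b - c * laurent_unit i j p (J k x) b)
          = cmod (w l k - c) * cmod (J k x (q' - p, j))"
          unfolding bq 1 by (simp add: laurent_unit_def norm_mult[symmetric] left_diff_distrib)
        also have "\<dots> \<le> e * cmod (J k x (q' - p, j))" by (intro mult_right_mono wb) auto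
        finally show ?thesis by (simp add: bq)
      qed
    qed (use e in auto)
  qed
  thus "\<exists>A f n. laurent R A f \<and> approx (wunit P i j q w) A e n \<and> (\<forall>z a b. cmod (c * monom_symbol i j p z a b - f z a b) \<le> e)"
    using laurent_monom[of R i j c p, OF R] e
    by (intro exI[of _ "\<lambda>y a. c * laurent_unit i j p y a"] exI[of _ "\<lambda>z a b. c * monom_symbol i j p z a b"] exI[of _ n]) auto
qed

end

section \<open>The symbol of the Toeplitz algebra\<close>

definition lclosure :: "('a \<Rightarrow> 'a \<Rightarrow> bool) \<Rightarrow> (complex \<Rightarrow> 'a \<Rightarrow> 'a \<Rightarrow> complex) set" where
  "lclosure R = {F. \<forall>e>0. \<exists>A f. laurent R A f \<and> (\<forall>z a b. cmod (F z a b - f z a b) \<le> e)}"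

lemma lclosure_continuous:
  assumes F: "F \<in> lclosure R"
  shows "continuous_on {z. cmod z = 1} (\<lambda>z. F z a b)"
proof -
  have "\<forall>n. \<exists>f. (\<exists>A. laurent R A f) \<and> (\<forall>z a b. cmod (F z a b - f z a b) \<le> inverse (real (Suc n)))"
  proof
    fix n
    have "inverse (real (Suc n)) > 0" by simp
    thus "\<exists>f. (\<exists>A. laurent R A f) \<and> (\<forall>z a b. cmod (F z a b - f z a b) \<le> inverse (real (Suc n)))"
      using F unfolding lclosure_def by blast
  qed
  then obtain f where f: "\<forall>n. (\<exists>A. laurent R A (f n)) \<and> (\<forall>z a b. cmod (F z a b - f n z a b) \<le> inverse (real (Suc n)))"
    by (rule choice[THEN exE])
  have "uniform_limit {z. cmod z = 1} (\<lambda>n z. f n z a b) (\<lambda>z. F z a b) sequentially"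
  proof (rule uniform_limitI)
    fix e :: real assume "e > 0"
    then obtain N where N: "inverse (real (Suc N)) < e" using reals_Archimedean by blast
    have "dist (f n z a b) (F z a b) < e" if "n \<ge> N" for n z
    proof -
      have "dist (f n z a b) (F z a b) \<le> inverse (real (Suc n))"
        using f by (simp add: dist_norm norm_minus_commute)
      also have "\<dots> \<le> inverse (real (Suc N))" using that by simp
      finally show ?thesis using N by simp
    qed
    thus "\<forall>\<^sub>F n in sequentially. \<forall>z\<in>{z. cmod z = 1}. dist (f n z a b) (F z a b) < e"
      unfolding eventually_sequentially by blast
  qed
  moreover have "continuous_on {z. cmod z = 1} (\<lambda>z. f n z a b)" for n
  proof -
    obtain A where "laurent R A (f n)" using f by blast
    thus ?thesis by (rule laurent_symbol_continuous)
  qed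
  ultimately show ?thesis by (intro uniform_limit_theorem[where F=sequentially]) auto
qed

lemma lclosure_support:
  assumes F: "F \<in> lclosure R" and z: "cmod z \<noteq> 1 \<or> \<not> R a b"
  shows "F z a b = 0"
proof -
  have "cmod (F z a b) \<le> 0 + e" if e: "e > 0" for e
  proof -
    obtain A f where "laurent R A f" and c: "\<And>z a b. cmod (F z a b - f z a b) \<le> e"
      using F e unfolding lclosure_def by blast
    thus ?thesis using laurent_symbol_support[of R A f z a b] z c[of z a b] by simp
  qed
  hence "cmod (F z a b) \<le> 0" by (rule field_le_epsilon)
  thus ?thesis by simp
qed

lemma star_mult: "star_symbol (mult_symbol F G) = mult_symbol (star_symbol G) (star_symbol F)"
  by (simp add: star_symbol_def mult_symbol_def fun_eq_iff mult.commute)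

text \<open>The norm of \<open>T \<circ> proj P n\<close> is a supremum that must be bounded before
  it can be used; contractivity of the cut-off gives the bound directly.\<close>

lemma opb_opnorm_proj:
  assumes T: "T \<in> Lops P"
  shows "\<And>x. x \<in> fock P \<Longrightarrow> proj P n x \<in> fock P" "\<And>x k. x \<in> fock P \<Longrightarrow> nrm (col k (proj P n x)) \<le> nrm (col k x)"
    "opb P (T \<circ> proj P n) (opnorm P T)"
proof -
  show 1: "proj P n x \<in> fock P" if x: "x \<in> fock P" for x
    by (rule fock_mono[OF x]) (simp add: proj_def x)
  show 2: "nrm (col k (proj P n x)) \<le> nrm (col k x)" if x: "x \<in> fock P" for x k
    by (rule l2_mono(2)[OF fock_l2[OF x]]) (auto simp: proj_def x)
  show "opb P (T \<circ> proj P n) (opnorm P T)"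
    unfolding opb_def
  proof (intro ballI allI)
    fix x k assume x: "x \<in> fock P"
    have "nrm (col k (T (proj P n x))) \<le> opnorm P T * nrm (col k (proj P n x))"
      using opb_opnorm[OF T] 1[OF x] unfolding opb_def by blast
    also have "\<dots> \<le> opnorm P T * nrm (col k x)" by (intro mult_left_mono 2 x opnorm_nonneg T)
    finally show "nrm (col k ((T \<circ> proj P n) x)) \<le> opnorm P T * nrm (col k x)" by simp
  qed
qed

lemma opnorm_proj_upper:
  assumes T: "T \<in> Lops P" and x: "x \<in> fock P" "fnorm x \<le> 1"
  shows "fnorm (T (proj P n x)) \<le> opnorm P (T \<circ> proj P n)"
proof -
  have f: "(T \<circ> proj P n) x \<in> fock P" if "x \<in> fock P" for x
    using Lops_fock[OF T opb_opnorm_proj(1)[OF T that]] by simp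
  have "bdd_above {fnorm ((T \<circ> proj P n) x) |x. x \<in> fock P \<and> fnorm x \<le> 1}"
    by (rule bdd_aboveI[of _ "opnorm P T"])
      (use opnorm_set_bound[OF f opb_opnorm_proj(3)[OF T] opnorm_nonneg[OF T]] in blast)
  thus ?thesis unfolding opnorm_def
    by (intro cSup_upper) (use x in auto)
qed

lemma opnorm_proj_nonneg: "T \<in> Lops P \<Longrightarrow> 0 \<le> opnorm P (T \<circ> proj P n)"
  using opnorm_proj_upper[of T P fzero n] fnorm_nonneg[of "T (proj P n fzero)"] by (simp add: fnorm_fzero)

lemma tailp_fock: "x \<in> fock P \<Longrightarrow> tailp P n x \<in> fock P"
  by (rule fock_mono[of x]) (simp_all add: tailp_def)

lemma tailp_nrm: "x \<in> fock P \<Longrightarrow> nrm (col k (tailp P n x)) \<le> nrm (col k x)"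
  by (rule l2_mono(2)[OF fock_l2]) (auto simp: tailp_def)

lemma tail_tailp: "tail n (tailp P n x)"
  by (auto simp: tail_def tailp_def fzero_def)

lemma tailp_tail: "x \<in> fock P \<Longrightarrow> tail n x \<Longrightarrow> tailp P n x = x"
  by (auto simp: tail_def tailp_def fun_eq_iff)

context phased
begin

section \<open>Symbols of the generators and of the generated algebra\<close>

lemma symb_lclosure: "symb T F \<Longrightarrow> F \<in> lclosure R"
  unfolding symb_def lclosure_def by blast

lemma symb_op_sum:
  assumes "finite I" "\<And>t. t \<in> I \<Longrightarrow> T t \<in> Lops P \<and> symb (T t) (F t)"
  shows "op_sum I T \<in> Lops P \<and> symb (op_sum I T) (\<lambda>z a b. \<Sum>t\<in>I. F t z a b)"
  using assms
proof (induction I rule: finite_induct)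
  case empty
  show ?case using adjp_Lops[OF adjp_zero] symb_zero by (simp add: op_sum_empty)
next
  case (insert t I)
  thus ?case
    using symb_add[of "T t" "op_sum I T" "F t" "\<lambda>z a b. \<Sum>t\<in>I. F t z a b"] Lops_closed(1)[of "T t" P "op_sum I T"]
    by (simp add: op_sum_insert)
qed

text \<open>As the target degree grows, the conditioning on \<open>k\<close> is forgotten: the
  quotient of the two factors that involve \<open>k\<close> tends to 1 by
  \<open>weight_limit\<close>, and only the transition from \<open>i\<close> to \<open>j\<close>
  remains.\<close>

lemma shift_weight_tendsto:
  assumes p: "matpow P n i j > 0" and e: "e > 0"
  shows "\<exists>N. \<forall>m\<ge>N. \<forall>k. n \<le> m \<longrightarrow> matpow P m i k \<noteq> 0 \<longrightarrow> matpow P (m - n) j k \<noteq> 0 \<longrightarrow>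
    \<bar>shift_weight P n i j m k - sqrt (matpow P n i j)\<bar> \<le> e"
proof -
  obtain N where N: "\<forall>m\<ge>N. \<forall>n i j k. matpow P n i j > 0 \<longrightarrow> matpow P m j k > 0 \<longrightarrow>
     \<bar>sqrt (matpow P m j k) / sqrt (matpow P (n + m) i k) - 1\<bar> \<le> e" using weight_limit[OF e] by blast
  show ?thesis
  proof (intro exI[of _ "N + n"] allI impI)
    fix m k assume m: "N + n \<le> m" "n \<le> m" and nz: "matpow P m i k \<noteq> 0" "matpow P (m - n) j k \<noteq> 0"
    have pos: "matpow P m i k > 0" "matpow P (m - n) j k > 0"
      using nz matpow_nonneg[OF stoch, of m i k] matpow_nonneg[OF stoch, of "m - n" j k] by auto
    define q where "q = sqrt (matpow P (m - n) j k) / sqrt (matpow P m i k)"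
    have q: "\<bar>q - 1\<bar> \<le> e" using N[rule_format, of "m - n" n i j k] m p pos by (simp add: q_def)
    have "shift_weight P n i j m k - sqrt (matpow P n i j) = sqrt (matpow P n i j) * (q - 1)"
      using pos by (simp add: shift_weight_def flat_def q_def field_simps)
    hence "\<bar>shift_weight P n i j m k - sqrt (matpow P n i j)\<bar> = sqrt (matpow P n i j) * \<bar>q - 1\<bar>"
      using p by (simp add: abs_mult)
    also have "\<dots> \<le> 1 * e" using q p matpow_le_1[OF stoch] by (intro mult_mono) auto
    finally show "\<bar>shift_weight P n i j m k - sqrt (matpow P n i j)\<bar> \<le> e" by simp
  qed
qed

lemma cmod_weight_diff: "cmod (c * of_real w - c * of_real v) = cmod c * \<bar>w - v\<bar>"
  by (metis norm_mult norm_of_real of_real_diff right_diff_distrib)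

text \<open>The adjoint carries the same weight read at a degree raised by \<open>n\<close>, so one
  limit of weights serves both claims.\<close>

lemma symb_shift_summand:
  assumes p: "matpow P n i j > 0" and q: "int n = r i * p + s j - s i"
  shows "symb (wunit P i j (int n) (\<lambda>N k. c * of_real (shift_weight P n i j N k)))
      (\<lambda>z a b. (c * of_real (sqrt (matpow P n i j))) * monom_symbol i j p z a b)"
    "symb (wunit P j i (- int n) (\<lambda>m k. cnj (c * of_real (shift_weight P n i j (nat (int m + int n)) k))))
      (\<lambda>z a b. cnj (c * of_real (sqrt (matpow P n i j))) * monom_symbol j i (- p) z a b)"
proof -
  have Rij: "R i j" using pos_phase[OF p] by blast
  have b: "cmod (c * of_real (shift_weight P n i j N k)) \<le> cmod c" if "n \<le> N" for N k
    using shift_weight_le_1[OF stoch that, of i j k] shift_weight_nonneg[OF stoch, of n i j N k]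
    by (simp add: norm_mult mult_left_le)
  have lim: "\<exists>N. \<forall>m\<ge>N. \<forall>k. n \<le> m \<longrightarrow> matpow P m i k \<noteq> 0 \<longrightarrow> matpow P (m - n) j k \<noteq> 0 \<longrightarrow>
      cmod (c * of_real (shift_weight P n i j m k) - c * of_real (sqrt (matpow P n i j))) \<le> e" if e: "e > 0" for e
  proof -
    have cp: "cmod c + 1 > 0" using norm_ge_zero[of c] by linarith
    define d where "d = e / (cmod c + 1)"
    have d: "d > 0" "cmod c * d \<le> e" using e cp by (auto simp: d_def field_simps)
    obtain N where N: "\<forall>m\<ge>N. \<forall>k. n \<le> m \<longrightarrow> matpow P m i k \<noteq> 0 \<longrightarrow> matpow P (m - n) j k \<noteq> 0 \<longrightarrow>
      \<bar>shift_weight P n i j m k - sqrt (matpow P n i j)\<bar> \<le> d" using shift_weight_tendsto[OF p d(1)] by blast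
    show ?thesis
    proof (intro exI[of _ N] allI impI)
      fix m k assume "N \<le> m" "n \<le> m" "matpow P m i k \<noteq> 0" "matpow P (m - n) j k \<noteq> 0"
      hence "cmod c * \<bar>shift_weight P n i j m k - sqrt (matpow P n i j)\<bar> \<le> cmod c * d"
        using N by (intro mult_left_mono) auto
      thus "cmod (c * of_real (shift_weight P n i j m k) - c * of_real (sqrt (matpow P n i j))) \<le> e"
        unfolding cmod_weight_diff using d(2) by linarith
    qed
  qed
  show "symb (wunit P i j (int n) (\<lambda>N k. c * of_real (shift_weight P n i j N k)))
      (\<lambda>z a b. (c * of_real (sqrt (matpow P n i j))) * monom_symbol i j p z a b)"
  proof (rule symb_wunit[OF Rij q, of _ "cmod c"])
    fix e :: real assume "e > 0"
    then obtain N where N: "\<forall>m\<ge>N. \<forall>k. n \<le> m \<longrightarrow> matpow P m i k \<noteq> 0 \<longrightarrow> matpow P (m - n) j k \<noteq> 0 \<longrightarrow>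
      cmod (c * of_real (shift_weight P n i j m k) - c * of_real (sqrt (matpow P n i j))) \<le> e" using lim by blast
    have "nat (int m - int n) = m - n" for m by (simp add: nat_diff_distrib')
    thus "\<exists>N. \<forall>m\<ge>N. \<forall>k. int n \<le> int m \<longrightarrow> matpow P m i k \<noteq> 0 \<longrightarrow> matpow P (nat (int m - int n)) j k \<noteq> 0 \<longrightarrow>
      cmod (c * of_real (shift_weight P n i j m k) - c * of_real (sqrt (matpow P n i j))) \<le> e"
      using N by (intro exI[of _ N]) simp
  qed (use b in auto)
  have q': "- int n = r j * (- p) + s i - s j" using q r_eq[OF Rij] by simp
  have b': "cmod (cnj (c * of_real (shift_weight P n i j (nat (int m + int n)) k))) \<le> cmod c" for m k
    unfolding complex_mod_cnj by (rule b) simp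
  show "symb (wunit P j i (- int n) (\<lambda>m k. cnj (c * of_real (shift_weight P n i j (nat (int m + int n)) k))))
      (\<lambda>z a b. cnj (c * of_real (sqrt (matpow P n i j))) * monom_symbol j i (- p) z a b)"
  proof (rule symb_wunit[OF R_sym[OF Rij] q' b'])
    fix e :: real assume "e > 0"
    then obtain N where N: "\<forall>m\<ge>N. \<forall>k. n \<le> m \<longrightarrow> matpow P m i k \<noteq> 0 \<longrightarrow> matpow P (m - n) j k \<noteq> 0 \<longrightarrow>
      cmod (c * of_real (shift_weight P n i j m k) - c * of_real (sqrt (matpow P n i j))) \<le> e" using lim by blast
    have e1: "nat (int m - - int n) = m + n" "nat (int m + int n) = m + n" for m by auto
    have "cmod (cnj (c * of_real (shift_weight P n i j (m + n) k)) - cnj (c * of_real (sqrt (matpow P n i j)))) \<le> e"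
      if "N \<le> m" "matpow P m j k \<noteq> 0" "matpow P (m + n) i k \<noteq> 0" for m k
      using N[rule_format, of "m + n" k] that unfolding complex_cnj_diff[symmetric] complex_mod_cnj by simp
    thus "\<exists>N. \<forall>m\<ge>N. \<forall>k. - int n \<le> int m \<longrightarrow> matpow P m j k \<noteq> 0 \<longrightarrow> matpow P (nat (int m - - int n)) i k \<noteq> 0 \<longrightarrow>
      cmod (cnj (c * of_real (shift_weight P n i j (nat (int m + int n)) k)) - cnj (c * of_real (sqrt (matpow P n i j)))) \<le> e"
      unfolding e1 by (intro exI[of _ N]) blast
  qed simp
qed

lemma star_monom: "star_symbol (\<lambda>z a b. c * monom_symbol i j p z a b) = (\<lambda>z a b. cnj c * monom_symbol j i (- p) z a b)"
proof -
  have "cnj (z powi p) = z powi (- p)" if "cmod z = 1" for z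
  proof -
    have "cnj z = inverse z" using that complex_div_cnj[of 1 z] by (simp add: divide_inverse)
    thus ?thesis by (simp add: power_int_minus power_int_inverse)
  qed
  thus ?thesis by (auto simp: star_symbol_def monom_symbol_def fun_eq_iff)
qed

lemma wunit_zero: "(\<And>n k. w n k = 0) \<Longrightarrow> wunit P i j q w = (\<lambda>x. fzero)"
  by (auto simp: wunit_def fzero_def fun_eq_iff)

lemma toeplitz_symb_gen:
  "\<exists>F. symb (shift P n A) F \<and> symb (adj P (shift P n A)) (star_symbol F)"
proof -
  define T where "T = (\<lambda>(i, j). wunit P i j (int n) (\<lambda>N k. A i j * of_real (shift_weight P n i j N k)))"
  define S where "S = (\<lambda>(i, j). wunit P j i (- int n) (\<lambda>m k. cnj (A i j * of_real (shift_weight P n i j (nat (int m + int n)) k))))"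
  have adjs: "adjp P (T t) (S t)" for t
    unfolding T_def S_def by (cases t) (simp only: prod.case adjp_shift_summand[OF stoch])
  have "\<forall>t. \<exists>F. symb (T t) F \<and> symb (S t) (star_symbol F)"
  proof
    fix t :: "'a \<times> 'a" obtain i j where t: "t = (i, j)" by fastforce
    show "\<exists>F. symb (T t) F \<and> symb (S t) (star_symbol F)"
    proof (cases "matpow P n i j > 0")
      case True
      have "r i dvd int n + s i - s j" using pos_phase[OF True] by blast
      then obtain p where "int n + s i - s j = r i * p" by blast
      hence q: "int n = r i * p + s j - s i" by simp
      show ?thesis
        using symb_shift_summand[OF True q, of "A i j"] unfolding t T_def S_def prod.case
        by (intro exI[of _ "\<lambda>z a b. (A i j * of_real (sqrt (matpow P n i j))) * monom_symbol i j p z a b"])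
          (simp only: star_monom)
    next
      case False
      \<comment> \<open>Off the support of the \<open>n\<close>-th power the weight vanishes, so
        such entries of \<open>A\<close> contribute the zero operator.\<close>
      hence "matpow P n i j = 0" using matpow_nonneg[OF stoch, of n i j] by simp
      hence "shift_weight P n i j N k = 0" for N k by (simp add: shift_weight_def)
      hence "T t = (\<lambda>x. fzero)" "S t = (\<lambda>x. fzero)" unfolding t T_def S_def by (simp_all add: wunit_zero)
      thus ?thesis using symb_zero by (intro exI[of _ "\<lambda>z a b. 0"]) (simp add: star_symbol_def)
    qed
  qed
  then obtain F where F: "\<forall>t. symb (T t) (F t) \<and> symb (S t) (star_symbol (F t))" by (rule choice[THEN exE])
  have sh: "shift P n A = op_sum UNIV T" by (simp add: shift_eq_op_sum T_def)
  have ad: "adj P (shift P n A) = op_sum UNIV S"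
    unfolding sh by (rule adjp_adj[OF adjp_op_sum]) (auto simp: adjs)
  have "symb (op_sum UNIV T) (\<lambda>z a b. \<Sum>t\<in>UNIV. F t z a b)"
    using symb_op_sum[of UNIV T F] F adjp_Lops[OF adjs] by simp
  moreover have "symb (op_sum UNIV S) (\<lambda>z a b. \<Sum>t\<in>UNIV. star_symbol (F t) z a b)"
    using symb_op_sum[of UNIV S "\<lambda>t. star_symbol (F t)"] F adjp_Lops[OF adjp_sym[OF adjs]] by simp
  moreover have "(\<lambda>z a b. \<Sum>t\<in>UNIV. star_symbol (F t) z a b) = star_symbol (\<lambda>z a b. \<Sum>t\<in>UNIV. F t z a b)"
    by (simp add: star_symbol_def)
  ultimately show ?thesis unfolding ad unfolding sh by metis
qed

lemma symb_lact: "symb (lact P g) (\<lambda>z a b. if a = b \<and> cmod z = 1 then g a else 0)"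
    "adj P (lact P g) = lact P (\<lambda>i. cnj (g i))"
proof -
  have 1: "wunit P i i 0 (\<lambda>N k. g i) \<in> Lops P \<and>
      symb (wunit P i i 0 (\<lambda>N k. g i)) (\<lambda>z a b. g i * monom_symbol i i 0 z a b)" for i g
  proof
    show "wunit P i i 0 (\<lambda>N k. g i) \<in> Lops P"
      by (rule adjp_Lops[OF adjp_wunit[where C="cmod (g i)"]]) auto
    show "symb (wunit P i i 0 (\<lambda>N k. g i)) (\<lambda>z a b. g i * monom_symbol i i 0 z a b)"
      by (rule symb_wunit[where C="cmod (g i)"]) auto
  qed
  have "symb (lact P g) (\<lambda>z a b. \<Sum>i\<in>UNIV. g i * monom_symbol i i 0 z a b)"
    unfolding lact_eq_op_sum
    using symb_op_sum[of UNIV "\<lambda>i. wunit P i i 0 (\<lambda>N k. g i)" "\<lambda>i z a b. g i * monom_symbol i i 0 z a b"] 1 by simp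
  also have "(\<lambda>z a b. \<Sum>i\<in>UNIV. g i * monom_symbol i i 0 z a b) = (\<lambda>z a b. if a = b \<and> cmod z = 1 then g a else 0)"
  proof (intro ext)
    fix z a b
    have "(\<Sum>i\<in>UNIV. g i * monom_symbol i i 0 z a b) = (\<Sum>i\<in>UNIV. if i = a then (if a = b \<and> cmod z = 1 then g a else 0) else 0)"
      by (intro sum.cong refl) (auto simp: monom_symbol_def)
    thus "(\<Sum>i\<in>UNIV. g i * monom_symbol i i 0 z a b) = (if a = b \<and> cmod z = 1 then g a else 0)" by simp
  qed
  finally show "symb (lact P g) (\<lambda>z a b. if a = b \<and> cmod z = 1 then g a else 0)" .
  show "adj P (lact P g) = lact P (\<lambda>i. cnj (g i))"
  proof (rule adjp_adj)
    have "adjp P (wunit P i i 0 (\<lambda>N k. g i)) (wunit P i i (- 0) (\<lambda>m k. cnj (g i)))" for i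
      by (rule adjp_wunit[where C="cmod (g i)"]) auto
    thus "adjp P (lact P g) (lact P (\<lambda>i. cnj (g i)))"
      unfolding lact_eq_op_sum by (intro adjp_op_sum) auto
  qed
qed

text \<open>Applied to differences, \<open>symb_lower\<close> turns norm convergence of operators
  into uniform convergence of symbols, and \<open>symb_limit\<close> identifies the limit.\<close>

lemma symb_family_limit:
  fixes X :: "nat \<Rightarrow> 'a fop"
  assumes X: "\<And>k. X k \<in> Lops P" "\<And>k. symb (X k) (F k)" and T: "T \<in> Lops P"
    and l: "(\<lambda>k. opnorm P (op_diff (X k) T)) \<longlonglongrightarrow> 0"
  shows "\<exists>G. symb T G \<and> (\<forall>e>0. \<exists>N. \<forall>k\<ge>N. \<forall>z a b. cmod (F k z a b - G z a b) \<le> e)"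
proof -
  have cau: "\<exists>N. \<forall>k\<ge>N. \<forall>m\<ge>N. \<forall>z a b. cmod (F k z a b - F m z a b) \<le> e" if e: "e > 0" for e
  proof -
    from order_tendstoD(2)[OF l half_gt_zero[OF e]] obtain N where
      N: "\<And>s. s \<ge> N \<Longrightarrow> opnorm P (op_diff (X s) T) < e/2" by (auto simp: eventually_sequentially)
    have "cmod (F k z a b - F m z a b) \<le> e" if km: "k \<ge> N" "m \<ge> N" for k m z a b
    proof (rule symb_lower[OF Lops_closed(2)[OF X(1) X(1)] symb_diff[OF X(1) X(1) X(2) X(2)]])
      show "0 \<le> e" using e by simp
      show "opb P (op_diff (X k) (X m)) e"
        unfolding opb_def
      proof (intro ballI allI)
        fix x c assume x: "x \<in> fock P"
        have c: "nrm (col c (op_diff (X t) T x)) \<le> e/2 * nrm (col c x)" if "t \<ge> N" for t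
        proof -
          have "nrm (col c (op_diff (X t) T x)) \<le> opnorm P (op_diff (X t) T) * nrm (col c x)"
            using opb_opnorm[OF Lops_closed(2)[OF X(1) T]] x unfolding opb_def by blast
          also have "\<dots> \<le> e/2 * nrm (col c x)" using N[OF that] by (intro mult_right_mono) auto
          finally show ?thesis .
        qed
        have "col c (op_diff (X k) (X m) x) = (\<lambda>a. col c (op_diff (X k) T x) a - col c (op_diff (X m) T x) a)"
          by (auto simp: op_diff_def)
        hence "nrm (col c (op_diff (X k) (X m) x)) \<le> nrm (col c (op_diff (X k) T x)) + nrm (col c (op_diff (X m) T x))"
          using l2_diff(2)[OF fock_l2[OF Lops_fock[OF Lops_closed(2)[OF X(1) T] x]] fock_l2[OF Lops_fock[OF Lops_closed(2)[OF X(1) T] x]]]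
          by simp
        thus "nrm (col c (op_diff (X k) (X m) x)) \<le> e * nrm (col c x)"
          using c[OF km(1)] c[OF km(2)] by (simp add: field_simps)
      qed
    qed
    thus ?thesis by blast
  qed
  have conv: "convergent (\<lambda>k. F k z a b)" for z a b
  proof (rule Cauchy_convergent, rule metric_CauchyI)
    fix e :: real assume e: "e > 0"
    from cau[OF half_gt_zero[OF e]] obtain N where
      N: "\<And>k m. k \<ge> N \<Longrightarrow> m \<ge> N \<Longrightarrow> cmod (F k z a b - F m z a b) \<le> e/2" by blast
    show "\<exists>M. \<forall>m\<ge>M. \<forall>n\<ge>M. dist (F m z a b) (F n z a b) < e"
    proof (intro exI[of _ N] allI impI)
      fix m n assume "N \<le> m" "N \<le> n"
      from N[OF this] show "dist (F m z a b) (F n z a b) < e" using e by (simp add: dist_norm)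
    qed
  qed
  define G where "G z a b = lim (\<lambda>k. F k z a b)" for z a b
  have lim: "(\<lambda>k. F k z a b) \<longlonglongrightarrow> G z a b" for z a b
    unfolding G_def using conv by (simp add: convergent_LIMSEQ_iff)
  have u: "\<exists>N. \<forall>k\<ge>N. \<forall>z a b. cmod (F k z a b - G z a b) \<le> e" if e: "e > 0" for e
  proof -
    from cau[OF e] obtain N where N: "\<And>k m z a b. k \<ge> N \<Longrightarrow> m \<ge> N \<Longrightarrow> cmod (F k z a b - F m z a b) \<le> e" by blast
    have "cmod (F k z a b - G z a b) \<le> e" if "k \<ge> N" for k z a b
    proof (rule LIMSEQ_le_const2)
      show "(\<lambda>m. cmod (F k z a b - F m z a b)) \<longlonglongrightarrow> cmod (F k z a b - G z a b)"
        by (intro tendsto_intros lim)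
      show "\<exists>M. \<forall>n\<ge>M. cmod (F k z a b - F n z a b) \<le> e" using N[OF that] by blast
    qed
    thus ?thesis by blast
  qed
  have "symb T G" by (rule symb_limit[OF X(1) T l X(2) u])
  thus ?thesis using u by blast
qed

text \<open>Induction over the generated algebra: the operators with this property form a closed set
  containing the generators. The adjoint is carried along because a symbol for \<open>T\<close>
  alone does not supply an approximation of \<open>adj P T\<close>.\<close>

lemma toeplitz_symb: "T \<in> toeplitz P \<Longrightarrow> \<exists>F. symb T F \<and> symb (adj P T) (star_symbol F)"
proof -
  define S where "S = {T \<in> Lops P. \<exists>F. symb T F \<and> symb (adj P T) (star_symbol F)}"
  have "cstar_closed P S"
    unfolding cstar_closed_def
  proof (intro conjI ballI allI impI)
    show "S \<subseteq> Lops P" by (auto simp: S_def)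
  next
    fix T T' assume "T \<in> S" "T' \<in> S"
    then obtain F G where h: "T \<in> Lops P" "T' \<in> Lops P" "symb T F" "symb T' G"
      "symb (adj P T) (star_symbol F)" "symb (adj P T') (star_symbol G)" by (auto simp: S_def)
    have "symb (adj P (op_add T T')) (star_symbol (\<lambda>z a b. F z a b + G z a b))"
      using symb_add[OF adj_Lops[OF h(1)] adj_Lops[OF h(2)] h(5,6)]
      by (simp add: adj_simps h star_symbol_def)
    thus "op_add T T' \<in> S" using symb_add[OF h(1-4)] Lops_closed(1)[OF h(1,2)] by (auto simp: S_def)
    have "symb (adj P (T \<circ> T')) (star_symbol (mult_symbol F G))"
      using symb_comp[OF adj_Lops[OF h(2)] adj_Lops[OF h(1)] h(6,5)]
      by (simp add: adj_simps(3)[OF h(1,2)] star_mult)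
    thus "T \<circ> T' \<in> S" using symb_comp[OF h(1-4)] Lops_closed(3)[OF h(1,2)] by (auto simp: S_def)
  next
    fix T c assume "T \<in> S"
    then obtain F where h: "T \<in> Lops P" "symb T F" "symb (adj P T) (star_symbol F)" by (auto simp: S_def)
    have "symb (adj P (op_scale c T)) (star_symbol (\<lambda>z a b. c * F z a b))"
      using symb_scale[OF h(3), of "cnj c"] by (simp add: adj_simps h star_symbol_def)
    thus "op_scale c T \<in> S" using symb_scale[OF h(2)] Lops_closed(4)[OF h(1)] by (auto simp: S_def)
  next
    fix T assume "T \<in> S"
    then obtain F where h: "T \<in> Lops P" "symb T F" "symb (adj P T) (star_symbol F)" by (auto simp: S_def)
    have "star_symbol (star_symbol F) = F" by (simp add: star_symbol_def)
    thus "adj P T \<in> S" using h adj_Lops[OF h(1)] adj_adj[OF h(1)] by (auto simp: S_def)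
  next
    fix X :: "nat \<Rightarrow> 'a fop" and T
    assume "(\<forall>k. X k \<in> S) \<and> T \<in> Lops P \<and> (\<lambda>k. opnorm P (op_diff (X k) T)) \<longlonglongrightarrow> 0"
    hence X: "\<And>k. X k \<in> Lops P" and ex: "\<forall>k. \<exists>F. symb (X k) F \<and> symb (adj P (X k)) (star_symbol F)"
      and T: "T \<in> Lops P" and l: "(\<lambda>k. opnorm P (op_diff (X k) T)) \<longlonglongrightarrow> 0" by (auto simp: S_def)
    obtain F where F: "\<forall>k. symb (X k) (F k) \<and> symb (adj P (X k)) (star_symbol (F k))"
      using ex by (rule choice[THEN exE])
    obtain G where G: "symb T G" "\<And>e. e > 0 \<Longrightarrow> \<exists>N. \<forall>k\<ge>N. \<forall>z a b. cmod (F k z a b - G z a b) \<le> e"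
      using symb_family_limit[OF X _ T l, of F] F by blast
    have "symb (adj P T) (star_symbol G)"
    proof (rule symb_limit[where X="\<lambda>k. adj P (X k)" and F="\<lambda>k. star_symbol (F k)"])
      show "adj P (X k) \<in> Lops P" for k by (rule adj_Lops[OF X])
      show "adj P T \<in> Lops P" by (rule adj_Lops[OF T])
      show "symb (adj P (X k)) (star_symbol (F k))" for k using F by blast
      have "opnorm P (op_diff (adj P (X k)) (adj P T)) \<le> opnorm P (op_diff (X k) T)" for k
        using opnorm_adj[OF Lops_closed(2)[OF X T], of k] by (simp add: adj_simps X T)
      thus "(\<lambda>k. opnorm P (op_diff (adj P (X k)) (adj P T))) \<longlonglongrightarrow> 0"
        by (intro tendsto_sandwich[OF _ _ tendsto_const l] always_eventually allI)
          (auto intro: opnorm_nonneg[OF Lops_closed(2)[OF adj_Lops[OF X] adj_Lops[OF T]]])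
      fix e :: real assume "e > 0"
      from G(2)[OF this] obtain N where N: "\<And>k z a b. k \<ge> N \<Longrightarrow> cmod (F k z a b - G z a b) \<le> e" by blast
      have "cmod (star_symbol (F k) z a b - star_symbol G z a b) \<le> e" if "k \<ge> N" for k z a b
        using N[OF that, of z b a] unfolding star_symbol_def complex_cnj_diff[symmetric] complex_mod_cnj .
      thus "\<exists>N. \<forall>k\<ge>N. \<forall>z a b. cmod (star_symbol (F k) z a b - star_symbol G z a b) \<le> e" by blast
    qed
    thus "T \<in> S" using G(1) T by (auto simp: S_def)
  qed
  moreover have "lact P g \<in> S" for g
  proof -
    have "symb (adj P (lact P g)) (star_symbol (\<lambda>z a b. if a = b \<and> cmod z = 1 then g a else 0))"
      using symb_lact(1)[of "\<lambda>i. cnj (g i)"] unfolding symb_lact(2) star_symbol_def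
      by (rule back_subst[of "symb _"]) (auto simp: fun_eq_iff)
    thus ?thesis using symb_lact(1)[of g] lact_Lops by (auto simp: S_def)
  qed
  moreover have "shift P n A \<in> S" for n A
    using toeplitz_symb_gen shift_Lops[OF stoch] by (auto simp: S_def)
  ultimately have "toeplitz P \<subseteq> S" by (rule toeplitz_least)
  thus "T \<in> toeplitz P \<Longrightarrow> \<exists>F. symb T F \<and> symb (adj P T) (star_symbol F)" by (auto simp: S_def)
qed

definition symbol :: "'a fop \<Rightarrow> complex \<Rightarrow> 'a \<Rightarrow> 'a \<Rightarrow> complex" where
  "symbol T = (SOME F. symb T F)"

lemma toeplitz_in_Lops: "T \<in> toeplitz P \<Longrightarrow> T \<in> Lops P"
  using toeplitz_Lops[OF stoch] by blast

lemma symb_symbol: "T \<in> toeplitz P \<Longrightarrow> symb T (symbol T)"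
  unfolding symbol_def using toeplitz_symb by (metis someI_ex)

lemma symbol_eqI: "T \<in> toeplitz P \<Longrightarrow> symb T F \<Longrightarrow> symbol T = F"
  using symb_unique[OF toeplitz_in_Lops symb_symbol] by blast

lemma symbol_hom:
  assumes T: "T \<in> toeplitz P" and S: "S \<in> toeplitz P"
  shows "symbol (op_add T S) = (\<lambda>z a b. symbol T z a b + symbol S z a b)"
    "symbol (op_diff T S) = (\<lambda>z a b. symbol T z a b - symbol S z a b)"
    "symbol (op_scale c T) = (\<lambda>z a b. c * symbol T z a b)"
    "symbol (T \<circ> S) = mult_symbol (symbol T) (symbol S)"
    "symbol (adj P T) = star_symbol (symbol T)"
proof -
  note L = toeplitz_in_Lops[OF T] toeplitz_in_Lops[OF S] symb_symbol[OF T] symb_symbol[OF S]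
  show "symbol (op_add T S) = (\<lambda>z a b. symbol T z a b + symbol S z a b)"
    by (rule symbol_eqI[OF toeplitz_closed(1)[OF T S] symb_add[OF L]])
  show "symbol (op_diff T S) = (\<lambda>z a b. symbol T z a b - symbol S z a b)"
    by (rule symbol_eqI[OF toeplitz_diff[OF T S] symb_diff[OF L]])
  show "symbol (op_scale c T) = (\<lambda>z a b. c * symbol T z a b)"
    by (rule symbol_eqI[OF toeplitz_closed(3)[OF T] symb_scale[OF L(3)]])
  show "symbol (T \<circ> S) = mult_symbol (symbol T) (symbol S)"
    by (rule symbol_eqI[OF toeplitz_closed(2)[OF T S] symb_comp[OF L]])
  obtain F where F: "symb T F" "symb (adj P T) (star_symbol F)" using toeplitz_symb[OF T] by blast
  have "symbol T = F" by (rule symbol_eqI[OF T F(1)])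
  thus "symbol (adj P T) = star_symbol (symbol T)" using symbol_eqI[OF toeplitz_closed(4)[OF T] F(2)] by simp
qed

section \<open>The kernel of the symbol\<close>

lemma cp_ideal_if_symbol_0:
  assumes T: "T \<in> toeplitz P" and F: "symbol T = (\<lambda>z a b. 0)"
  shows "T \<in> cp_ideal P"
proof -
  note TL = toeplitz_in_Lops[OF T]
  have s0: "symb T (\<lambda>z a b. 0)" using symb_symbol[OF T] F by simp
  have "(\<lambda>n. opnorm P (T \<circ> proj P n)) \<longlonglongrightarrow> 0"
  proof (rule LIMSEQ_I)
    fix e :: real assume e: "e > 0"
    \<comment> \<open>With symbol 0 the bound on tails is an arbitrarily small constant, and
      projections onto high degrees land in such tails.\<close>
    have "\<exists>n. \<forall>x\<in>fock P. tail n x \<longrightarrow> (\<forall>k. nrm (col k (T x)) \<le> (real CARD('a) * 0 + e/2) * nrm (col k x))"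
      by (rule symb_upper[OF TL s0]) (use e in auto)
    then obtain n where n: "\<And>x k. x \<in> fock P \<Longrightarrow> tail n x \<Longrightarrow> nrm (col k (T x)) \<le> e/2 * nrm (col k x)" by auto
    have "opnorm P (T \<circ> proj P m) \<le> e/2" if m: "m \<ge> n" for m
    proof (rule opnorm_le)
      show "(T \<circ> proj P m) x \<in> fock P" if "x \<in> fock P" for x
        using Lops_fock[OF TL opb_opnorm_proj(1)[OF TL that]] by simp
      show "opb P (T \<circ> proj P m) (e/2)" unfolding opb_def
      proof (intro ballI allI)
        fix x k assume x: "x \<in> fock P"
        have "tail n (proj P m x)" using m x by (auto simp: tail_def proj_def)
        from n[OF opb_opnorm_proj(1)[OF TL x] this]
        have "nrm (col k (T (proj P m x))) \<le> e/2 * nrm (col k (proj P m x))" .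
        also have "\<dots> \<le> e/2 * nrm (col k x)" using e by (intro mult_left_mono opb_opnorm_proj(2)[OF TL x]) auto
        finally show "nrm (col k ((T \<circ> proj P m) x)) \<le> e/2 * nrm (col k x)" by simp
      qed
    qed (use e in simp)
    hence "norm (opnorm P (T \<circ> proj P m) - 0) < e" if "m \<ge> n" for m
      using that e opnorm_proj_nonneg[OF TL, of m] by fastforce
    thus "\<exists>N. \<forall>n\<ge>N. norm (opnorm P (T \<circ> proj P n) - 0) < e" by blast
  qed
  thus ?thesis using T by (simp add: cp_ideal_def)
qed

lemma nonneg_continuous_small_integral:
  fixes g :: "real \<Rightarrow> real"
  assumes c: "continuous_on {0..2*pi} g" and nn: "\<And>t. t \<in> {0..2*pi} \<Longrightarrow> 0 \<le> g t"
    and sm: "\<And>e. e > 0 \<Longrightarrow> integral {0..2*pi} g \<le> e" and t: "t \<in> {0..2*pi}"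
  shows "g t = 0"
proof -
  have "integral {0..2*pi} g \<le> 0" using sm field_le_epsilon[of "integral {0..2*pi} g" 0] by simp
  moreover have "0 \<le> integral {0..2*pi} g"
    by (rule integral_nonneg[OF integrable_continuous_interval[OF c] nn])
  ultimately have "integral {0..2*pi} g = 0" by simp
  hence hi: "(g has_integral 0) (cbox 0 (2*pi))"
    using integrable_integral[OF integrable_continuous_interval[OF c]] by simp
  have "pi \<in> box 0 (2 * pi)" by simp
  hence ne: "box 0 (2 * pi) \<noteq> {}" by blast
  show ?thesis
    by (rule has_integral_0_cbox_imp_0[OF _ _ hi ne]) (use c nn t in auto)
qed

text \<open>A basis vector of a single high degree is fixed by the projection onto that degree, so
  \<open>T\<close> is small on it and so is its Laurent image; by \<open>laurent_unitv_norm\<close>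
  column \<open>b\<close> of the symbol has small mean square, and continuity makes it
  vanish.\<close>

lemma symbol_0_if_cp_ideal:
  assumes T: "T \<in> cp_ideal P"
  shows "symbol T = (\<lambda>z a b. 0)"
proof (intro ext)
  fix z a b
  have Tt: "T \<in> toeplitz P" and lim: "(\<lambda>n. opnorm P (T \<circ> proj P n)) \<longlonglongrightarrow> 0"
    using T by (auto simp: cp_ideal_def)
  note TL = toeplitz_in_Lops[OF Tt]
  note F = symb_symbol[OF Tt]
  define g where "g t = (cmod (symbol T (cis t) a b))\<^sup>2" for t
  have cont: "continuous_on {0..2*pi} g"
    unfolding g_def
    by (intro continuous_intros continuous_on_compose2[OF lclosure_continuous[OF symb_lclosure[OF F]]]) auto
  \<comment> \<open>The estimate \<open>(u + e)^2 \<le> 2 * u^2 + 2 * e^2\<close> and the bound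
    \<open>2 * e\<close> for the norm of the Laurent image give
    \<open>16 * pi + 4 * pi\<close>.\<close>
  have small: "integral {0..2*pi} g \<le> 20 * pi * e\<^sup>2" if e: "e > 0" for e
  proof -
    obtain A f n where A: "laurent R A f" "approx T A e n" "\<And>z a b. cmod (symbol T z a b - f z a b) \<le> e"
      by (rule symbE[OF F e]) (rule that)
    from order_tendstoD(2)[OF lim e] obtain N where N: "\<And>m. m \<ge> N \<Longrightarrow> opnorm P (T \<circ> proj P m) < e"
      by (auto simp: eventually_sequentially)
    obtain N' where N': "\<forall>n\<ge>N'. \<forall>i j. R i j \<longrightarrow> r i dvd int n + s i - s j \<longrightarrow> matpow P n i j > 0"
      using eventually_pos by blast
    \<comment> \<open>Degree \<open>r b * q\<close> is a multiple of the period past all thresholds,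
      so the diagonal entry at \<open>b\<close> is positive there; its position is exactly
      \<open>q\<close>.\<close>
    define q where "q = int (n + N + N')"
    define m where "m = nat (r b * q)"
    have "1 * q \<le> r b * q" using r_pos[of b] by (intro mult_right_mono) (auto simp: q_def)
    hence mq: "int m = r b * q" "n + N + N' \<le> m" by (auto simp: m_def q_def)
    have "matpow P m b b > 0" using N' mq by simp
    hence x: "bvec m b b \<in> fock P" by (intro bvec_fock) auto
    have Jx: "J b (bvec m b b) = unitv (q, b)"
    proof
      fix c :: "int \<times> 'a" obtain q' i where c: "c = (q', i)" by fastforce
      show "J b (bvec m b b) c = unitv (q, b) c"
      proof (cases "i = b")
        case False
        thus ?thesis by (simp add: c J_apply bvec_def unitv_def)
      next
        case True
        have lv: "lev b q' b = r b * q'" by (simp add: lev_def)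
        show ?thesis
        proof (cases "q' = q")
          case q: True
          have "0 \<le> r b * q" "nat (r b * q) = m" using mq(1) by linarith+
          thus ?thesis using True by (simp add: c q J_apply bvec_def unitv_def lev_def)
        next
          case False
          hence "r b * q' \<noteq> int m" unfolding mq(1) using r_pos[of b] by simp
          hence "0 \<le> r b * q' \<Longrightarrow> nat (r b * q') \<noteq> m" by linarith
          thus ?thesis using True False by (simp add: c J_apply bvec_def unitv_def lv)
        qed
      qed
    qed
    have nx: "nrm (J b (bvec m b b)) = 1" unfolding Jx by simp
    have "fnorm (bvec m b b) \<le> 1"
    proof (rule fnorm_le[OF x])
      fix k show "nrm (col k (bvec m b b)) \<le> 1"
        by (cases "k = b") (simp_all add: col_bvec, simp add: bvec_def split_def)
    qed
    from opnorm_proj_upper[OF TL x this, of m]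
    have "fnorm (T (bvec m b b)) \<le> opnorm P (T \<circ> proj P m)"
    proof -
      have "proj P m (bvec m b b) = bvec m b b" using x by (auto simp: proj_def bvec_def fun_eq_iff)
      thus ?thesis using \<open>fnorm (T (proj P m (bvec m b b))) \<le> _\<close> by simp
    qed
    hence "nrm (J b (T (bvec m b b))) \<le> e"
      using N[of m] mq(2) nrm_col_le_fnorm[OF Lops_fock[OF TL x], of b] J_nrm[OF Lops_fock[OF TL x], of b] by linarith
    moreover have "nrm (\<lambda>c. J b (T (bvec m b b)) c - A (unitv (q, b)) c) \<le> e"
    proof -
      have "tail n (bvec m b b)" using mq(2) by (auto simp: tail_def bvec_def)
      from approxD[OF A(2) x this, of b] show ?thesis unfolding nx unfolding Jx by simp
    qed
    moreover have "nrm (A (unitv (q, b))) \<le> nrm (J b (T (bvec m b b))) + nrm (\<lambda>c. J b (T (bvec m b b)) c - A (unitv (q, b)) c)"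
    proof -
      note l = J_l2[OF Lops_fock[OF TL x], of b] laurent_l2[OF A(1) unitv_l2(1), of "(q, b)"]
      have "nrm (A (unitv (q, b))) = nrm (\<lambda>c. J b (T (bvec m b b)) c - (J b (T (bvec m b b)) c - A (unitv (q, b)) c))" by simp
      also have "\<dots> \<le> nrm (J b (T (bvec m b b))) + nrm (\<lambda>c. J b (T (bvec m b b)) c - A (unitv (q, b)) c)"
        by (rule l2_diff(2)[OF l(1) l2_diff(1)[OF l]])
      finally show ?thesis .
    qed
    ultimately have "nrm (A (unitv (q, b))) \<le> 2 * e" by linarith
    hence An: "(nrm (A (unitv (q, b))))\<^sup>2 \<le> 4 * e\<^sup>2"
      using power_mono[of "nrm (A (unitv (q, b)))" "2 * e" 2] by (simp add: power_mult_distrib)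
    have c1: "((\<lambda>t. 2 * e\<^sup>2) has_integral 4 * pi * e\<^sup>2) {0..2*pi}"
      using has_integral_const_real[of "2 * e\<^sup>2" 0 "2*pi"] by (simp add: mult.assoc)
    have c2: "((\<lambda>t. 2 * (\<Sum>a\<in>UNIV. (cmod (f (cis t) a b))\<^sup>2) + 2 * e\<^sup>2) has_integral
        2 * (2 * pi * (nrm (A (unitv (q, b))))\<^sup>2) + 4 * pi * e\<^sup>2) {0..2*pi}"
      by (intro has_integral_add has_integral_mult_right laurent_unitv_norm[OF A(1)] c1)
    have "integral {0..2*pi} g \<le> 2 * (2 * pi * (nrm (A (unitv (q, b))))\<^sup>2) + 4 * pi * e\<^sup>2"
    proof (rule has_integral_le[OF integrable_integral[OF integrable_continuous_interval[OF cont]] c2])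
      fix t
      have "cmod (symbol T (cis t) a b) \<le> cmod (f (cis t) a b) + e"
        using norm_triangle_sub[of "symbol T (cis t) a b" "f (cis t) a b"] A(3)[of "cis t" a b] by linarith
      hence "g t \<le> (cmod (f (cis t) a b) + e)\<^sup>2" unfolding g_def by (intro power_mono) auto
      also have "\<dots> \<le> 2 * (cmod (f (cis t) a b))\<^sup>2 + 2 * e\<^sup>2"
        using zero_le_power2[of "cmod (f (cis t) a b) - e"] by (simp add: power2_eq_square algebra_simps)
      also have "(cmod (f (cis t) a b))\<^sup>2 \<le> (\<Sum>a\<in>UNIV. (cmod (f (cis t) a b))\<^sup>2)"
        by (rule member_le_sum) auto
      finally show "g t \<le> 2 * (\<Sum>a\<in>UNIV. (cmod (f (cis t) a b))\<^sup>2) + 2 * e\<^sup>2" by simp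
    qed
    also have "\<dots> \<le> 2 * (2 * pi * (4 * e\<^sup>2)) + 4 * pi * e\<^sup>2" using An by (intro add_mono mult_left_mono) auto
    finally show ?thesis by simp
  qed
  show "symbol T z a b = 0"
  proof (cases "cmod z = 1")
    case False thus ?thesis using symb_support[OF F] by blast
  next
    case True
    obtain t where t: "0 \<le> t" "t < 2 * pi" and zt: "z = Complex (cos t) (sin t)"
      by (rule complex_unimodular_polar[OF True]) (rule that)
    have z: "z = cis t" unfolding zt by (simp add: complex_eq_iff)
    have "g t = 0"
    proof (rule nonneg_continuous_small_integral[OF cont])
      fix e :: real assume e: "e > 0"
      have "integral {0..2*pi} g \<le> 20 * pi * (sqrt (e / (20 * pi)))\<^sup>2" using e by (intro small) auto
      also have "\<dots> = e" using e by simp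
      finally show "integral {0..2*pi} g \<le> e" .
    qed (use t in \<open>auto simp: g_def\<close>)
    thus ?thesis by (simp add: g_def z)
  qed
qed

section \<open>The range of the symbol\<close>

lemma symb_tailp:
  assumes F: "symb T F"
  shows "symb (T \<circ> tailp P n) F"
  unfolding symb_def
proof (intro allI impI)
  fix e :: real assume e: "e > 0"
  obtain A f m where A: "laurent R A f" "approx T A e m" "\<And>z a b. cmod (F z a b - f z a b) \<le> e"
    by (rule symbE[OF F e]) (rule that)
  have "approx (T \<circ> tailp P n) A e (max m n)"
    unfolding approx_def
  proof (intro ballI impI allI)
    fix x k assume x: "x \<in> fock P" "tail (max m n) x"
    have "tailp P n x = x" by (rule tailp_tail[OF x(1) tail_mono[OF x(2)]]) simp
    thus "nrm (\<lambda>a. J k ((T \<circ> tailp P n) x) a - A (J k x) a) \<le> e * nrm (J k x)"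
      using approxD[OF A(2) x(1) tail_mono[OF x(2)], of k] by simp
  qed
  thus "\<exists>A f m. laurent R A f \<and> approx (T \<circ> tailp P n) A e m \<and> (\<forall>z a b. cmod (F z a b - f z a b) \<le> e)"
    using A by blast
qed

text \<open>A shift has positive degree and needs a positive entry of the matching power, so an
  arbitrary exponent is reached as a difference: \<open>a\<close> from a diagonal shift at
  \<open>i\<close>, and \<open>- b\<close> from the adjoint of the shift with entry
  \<open>(l, i)\<close>, where \<open>a - b = p\<close>.\<close>

lemma monom_realised:
  assumes il: "R i l"
  shows "\<exists>T\<in>toeplitz P. symb T (\<lambda>z a b. c * monom_symbol i l p z a b)"
proof -
  obtain N where N: "\<forall>n\<ge>N. \<forall>i j. R i j \<longrightarrow> r i dvd int n + s i - s j \<longrightarrow> matpow P n i j > 0"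
    using eventually_pos by blast
  \<comment> \<open>Large enough that both degrees are at least \<open>N + 1\<close> after the
    phases are accounted for; the summand 1 makes them admissible degrees of shifts.\<close>
  define b where "b = \<bar>p\<bar> + int N + 1 + \<bar>s i\<bar> + \<bar>s l\<bar>"
  define a where "a = p + b"
  have li: "R l i" using R_sym[OF il] .
  have le1: "r j * x \<ge> x" if "x \<ge> 0" for j x
    using mult_right_mono[of 1 "r j" x] that r_pos[of j] by simp
  have a: "r i * a \<ge> int N + 1" using le1[of a i] unfolding a_def b_def by linarith
  have bb: "r l * b + s i - s l \<ge> int N + 1" using le1[of b l] unfolding b_def by linarith
  define n where "n = nat (r i * a)"
  define m where "m = nat (r l * b + s i - s l)"
  have n: "int n = r i * a + s i - s i" "n \<ge> 1" "n \<ge> N" using a by (auto simp: n_def)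
  have m: "int m = r l * b + s i - s l" "m \<ge> 1" "m \<ge> N" using bb by (auto simp: m_def)
  have pn: "matpow P n i i > 0" using N n by simp
  have pm: "matpow P m l i > 0"
  proof -
    have "r l dvd int m + s l - s i" unfolding m(1) by simp
    thus ?thesis using N m(3) li by blast
  qed
  define u v where "u = complex_of_real (sqrt (matpow P n i i))" and "v = complex_of_real (sqrt (matpow P m l i))"
  have uv: "u \<noteq> 0" "v \<noteq> 0" "cnj v = v" using pn pm by (auto simp: u_def v_def)
  define S S' where "S = shift P n (munit i i)" and "S' = shift P m (munit l i)"
  have SS: "S \<in> toeplitz P" "S' \<in> toeplitz P"
    unfolding S_def S'_def using n m pn pm by (auto intro!: toeplitz_gens(2) simp: arv_def munit_def)
  have sS: "symb S (\<lambda>z x y. u * monom_symbol i i a z x y)"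
    using symb_shift_summand(1)[OF pn n(1), of 1] by (simp add: S_def shift_munit u_def)
  have sS': "symb S' (\<lambda>z x y. v * monom_symbol l i b z x y)"
    using symb_shift_summand(1)[OF pm m(1), of 1] by (simp add: S'_def shift_munit v_def)
  have "symbol S' = (\<lambda>z x y. v * monom_symbol l i b z x y)" by (rule symbol_eqI[OF SS(2) sS'])
  hence "symbol (adj P S') = (\<lambda>z x y. v * monom_symbol i l (- b) z x y)"
    using symbol_hom(5)[OF SS(2) SS(2)] star_monom[of v l i b] uv(3) by simp
  hence sa: "symb (adj P S') (\<lambda>z x y. v * monom_symbol i l (- b) z x y)"
    using symb_symbol[OF toeplitz_closed(4)[OF SS(2)]] by simp
  have "symb (S \<circ> adj P S') (mult_symbol (\<lambda>z x y. u * monom_symbol i i a z x y) (\<lambda>z x y. v * monom_symbol i l (- b) z x y))"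
    using SS by (intro symb_comp sS sa toeplitz_in_Lops adj_Lops)
  also have "mult_symbol (\<lambda>z x y. u * monom_symbol i i a z x y) (\<lambda>z x y. v * monom_symbol i l (- b) z x y)
     = (\<lambda>z x y. (u * v) * monom_symbol i l p z x y)"
  proof (intro ext)
    fix z x y
    have "z powi p = z powi a * z powi (- b)" if "cmod z = 1"
      using that by (subst power_int_add[symmetric]) (auto simp: a_def)
    hence e: "u * monom_symbol i i a z x k * (v * monom_symbol i l (- b) z k y)
      = (if k = i then (u * v) * monom_symbol i l p z x y else 0)" for k
      by (auto simp: monom_symbol_def)
    show "mult_symbol (\<lambda>z x y. u * monom_symbol i i a z x y) (\<lambda>z x y. v * monom_symbol i l (- b) z x y) z x y
     = (u * v) * monom_symbol i l p z x y"
      unfolding mult_symbol_def e by simp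
  qed
  \<comment> \<open>The limits \<open>u\<close> and \<open>v\<close> of the two weights are nonzero,
    so they can be divided out.\<close>
  finally have "symb (op_scale (c / (u * v)) (S \<circ> adj P S')) (\<lambda>z x y. (c / (u * v)) * ((u * v) * monom_symbol i l p z x y))"
    by (rule symb_scale)
  moreover have "(\<lambda>z x y. (c / (u * v)) * ((u * v) * monom_symbol i l p z x y)) = (\<lambda>z x y. c * monom_symbol i l p z x y)"
    using uv by simp
  ultimately show ?thesis
    using toeplitz_closed(3)[OF toeplitz_closed(2)[OF SS(1) toeplitz_closed(4)[OF SS(2)]]] by metis
qed

lemma laurent_realised: "laurent R A f \<Longrightarrow> \<exists>T\<in>toeplitz P. symb T f"
proof (induction rule: laurent.induct)
  case zero
  show ?case using toeplitz_zero symb_zero by blast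
next
  case (step A f i j c p)
  obtain T where T: "T \<in> toeplitz P" "symb T f" using step.IH by blast
  obtain S where S: "S \<in> toeplitz P" "symb S (\<lambda>z a b. c * monom_symbol i j p z a b)"
    using monom_realised[OF step.hyps(2)] by blast
  show ?case
    using symb_add[OF toeplitz_in_Lops[OF T(1)] toeplitz_in_Lops[OF S(1)] T(2) S(2)] toeplitz_closed(1)[OF T(1) S(1)]
    by blast
qed

text \<open>A telescoping series of lifts, each cut off by \<^const>\<open>tailp\<close> so far out that its norm is controlled by
  its symbol.\<close>

lemma lclosure_realised:
  assumes F: "F \<in> lclosure R"
  shows "\<exists>T\<in>toeplitz P. symb T F"
proof -
  let ?d = "real CARD('a)"
  define h :: "nat \<Rightarrow> real" where "h n = (1/2)^n" for n
  have h: "h n > 0" "h (Suc n) = h n / 2" for n by (simp_all add: h_def)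
  have "\<forall>n. \<exists>f. (\<exists>A. laurent R A f) \<and> (\<forall>z a b. cmod (F z a b - f z a b) \<le> h n)"
    using F h(1) unfolding lclosure_def by blast
  then obtain f where f: "\<forall>n. (\<exists>A. laurent R A (f n)) \<and> (\<forall>z a b. cmod (F z a b - f n z a b) \<le> h n)"
    by (rule choice[THEN exE])
  have "\<forall>n. \<exists>T. T \<in> toeplitz P \<and> symb T (f n)" using f laurent_realised by blast
  then obtain T where T: "\<forall>n. T n \<in> toeplitz P \<and> symb (T n) (f n)" by (rule choice[THEN exE])
  define G where "G n = op_diff (T (Suc n)) (T n)" for n
  have G: "G n \<in> toeplitz P" "symb (G n) (\<lambda>z a b. f (Suc n) z a b - f n z a b)" for n
    using T toeplitz_diff[of "T (Suc n)" P "T n"] symb_diff[OF toeplitz_in_Lops toeplitz_in_Lops, of "T (Suc n)" "T n"]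
    by (simp_all add: G_def)
  have Gb: "cmod (f (Suc n) z a b - f n z a b) \<le> 2 * h n" for n z a b
  proof -
    have "cmod (f (Suc n) z a b - f n z a b) \<le> cmod (F z a b - f (Suc n) z a b) + cmod (F z a b - f n z a b)"
      by (metis dist_norm dist_triangle3)
    also have "\<dots> \<le> h (Suc n) + h n" using f by (intro add_mono) auto
    finally show ?thesis using h(1)[of n] by (simp add: h(2))
  qed
  \<comment> \<open>A lift of a small symbol may be large in low degrees. Past degree
    \<open>m n\<close> its norm is governed by the bound \<open>2 * h n\<close> on the symbol, with
    slack \<open>h n\<close>; this is where \<open>D = 2 * CARD('a) + 1\<close> comes from.\<close>
  have "\<forall>n. \<exists>m. \<forall>x\<in>fock P. tail m x \<longrightarrow> (\<forall>k. nrm (col k (G n x)) \<le> (?d * (2 * h n) + h n) * nrm (col k x))"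
    using symb_upper[OF toeplitz_in_Lops[OF G(1)] G(2) _ Gb h(1)] h(1) by (simp add: less_imp_le)
  then obtain m where m: "\<forall>n. \<forall>x\<in>fock P. tail (m n) x \<longrightarrow> (\<forall>k. nrm (col k (G n x)) \<le> (?d * (2 * h n) + h n) * nrm (col k x))"
    by (rule choice[THEN exE])
  define D where "D = 2 * ?d + 1"
  have D: "D > 0" by (simp add: D_def add_nonneg_pos)
  \<comment> \<open>\<open>Suc\<close> provides the degree at least 1 that
    \<open>tailp_toeplitz\<close> asks for.\<close>
  define U where "U n = G n \<circ> tailp P (Suc (m n))" for n
  have U: "U n \<in> toeplitz P" "symb (U n) (\<lambda>z a b. f (Suc n) z a b - f n z a b)" for n
    unfolding U_def by (rule toeplitz_closed(2)[OF G(1) tailp_toeplitz[OF stoch]], simp, rule symb_tailp[OF G(2)])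
  have Ub: "nrm (col k (U n x)) \<le> D * h n * nrm (col k x)" if x: "x \<in> fock P" for n x k
  proof -
    have "nrm (col k (U n x)) \<le> (?d * (2 * h n) + h n) * nrm (col k (tailp P (Suc (m n)) x))"
    proof -
      have t: "tail (m n) (tailp P (Suc (m n)) x)" by (rule tail_mono[OF tail_tailp]) simp
      from m[rule_format, OF tailp_fock[OF x] t, of k] show ?thesis by (simp add: U_def)
    qed
    also have "\<dots> = D * h n * nrm (col k (tailp P (Suc (m n)) x))" by (simp add: D_def algebra_simps)
    also have "\<dots> \<le> D * h n * nrm (col k x)" using D h(1)[of n] by (intro mult_left_mono tailp_nrm x) auto
    finally show ?thesis .
  qed
  define X where "X = rec_nat (T 0) (\<lambda>n Y. op_add Y (U n))"
  have X0: "X 0 = T 0" and XS: "X (Suc n) = op_add (X n) (U n)" for n by (simp_all add: X_def)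
  have X: "X n \<in> toeplitz P \<and> symb (X n) (f n)" for n
  proof (induction n)
    case 0 thus ?case using T by (simp add: X0)
  next
    case (Suc n)
    have "symb (X (Suc n)) (\<lambda>z a b. f n z a b + (f (Suc n) z a b - f n z a b))"
      unfolding XS using Suc U by (intro symb_add toeplitz_in_Lops) auto
    thus ?case using toeplitz_closed(1)[of "X n" P "U n"] Suc U by (simp add: XS)
  qed
  have XT: "X n \<in> toeplitz P" for n using X by blast
  \<comment> \<open>The geometric sum from \<open>h n\<close> to \<open>h (n + j - 1)\<close> is
    exactly \<open>2 * h n - 2 * h (n + j)\<close>; a plain bound by \<open>2 * h n\<close> would
    not survive the induction.\<close>
  have Xd: "nrm (col k (op_diff (X (n + j)) (X n) x)) \<le> D * (2 * h n - 2 * h (n + j)) * nrm (col k x)"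
    if x: "x \<in> fock P" for n j x k
  proof (induction j)
    case 0
    have "op_diff (X n) (X n) x = (\<lambda>n i k. 0)" by (simp add: op_diff_def)
    thus ?case by (simp add: split_def)
  next
    case (Suc j)
    have l: "l2 (col k (op_diff (X (n + j)) (X n) x))" "l2 (col k (U (n + j) x))"
      by (rule fock_l2[OF Lops_fock[OF toeplitz_in_Lops[OF toeplitz_diff[OF XT XT]] x]],
          rule fock_l2[OF Lops_fock[OF toeplitz_in_Lops[OF U(1)] x]])
    have "col k (op_diff (X (n + Suc j)) (X n) x) = (\<lambda>a. col k (op_diff (X (n + j)) (X n) x) a + col k (U (n + j) x) a)"
      by (auto simp: op_diff_def XS op_add_def)
    hence "nrm (col k (op_diff (X (n + Suc j)) (X n) x)) \<le> nrm (col k (op_diff (X (n + j)) (X n) x)) + nrm (col k (U (n + j) x))"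
      using l2_add(2)[OF l] by simp
    also have "\<dots> \<le> D * (2 * h n - 2 * h (n + j)) * nrm (col k x) + D * h (n + j) * nrm (col k x)"
      by (intro add_mono Suc Ub x)
    also have "\<dots> = D * (2 * h n - 2 * h (n + Suc j)) * nrm (col k x)"
      using h(2)[of "n + j"] by (simp add: algebra_simps)
    finally show ?case .
  qed
  have XL: "X n \<in> Lops P" for n using X toeplitz_in_Lops by blast
  have cau: "\<exists>N. \<forall>s\<ge>N. \<forall>t\<ge>N. opb P (op_diff (X s) (X t)) e" if e: "e > 0" for e
  proof -
    have "(\<lambda>n. D * (4 * h n)) \<longlonglongrightarrow> D * (4 * 0)"
      unfolding h_def by (intro tendsto_intros LIMSEQ_realpow_zero) auto
    from order_tendstoD(2)[OF this, of e] e obtain N where N: "D * (4 * h N) < e"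
      by (auto simp: eventually_sequentially)
    have b: "nrm (col k (op_diff (X t) (X N) x)) \<le> D * (2 * h N) * nrm (col k x)" if "t \<ge> N" and x: "x \<in> fock P" for t k x
    proof -
      have "nrm (col k (op_diff (X t) (X N) x)) \<le> D * (2 * h N - 2 * h t) * nrm (col k x)"
        using Xd[OF x, where k=k and n=N and j="t - N"] that by simp
      also have "\<dots> \<le> D * (2 * h N) * nrm (col k x)"
        using D h(1)[of t] by (intro mult_right_mono mult_left_mono) auto
      finally show ?thesis .
    qed
    have "opb P (op_diff (X t) (X u)) e" if tu: "t \<ge> N" "u \<ge> N" for t u
      unfolding opb_def
    proof (intro ballI allI)
      fix x k assume x: "x \<in> fock P"
      have l: "l2 (col k (op_diff (X t) (X N) x))" for t
        by (rule fock_l2[OF Lops_fock[OF Lops_closed(2)[OF XL XL] x]])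
      have "col k (op_diff (X t) (X u) x) = (\<lambda>a. col k (op_diff (X t) (X N) x) a - col k (op_diff (X u) (X N) x) a)"
        by (auto simp: op_diff_def)
      hence "nrm (col k (op_diff (X t) (X u) x)) \<le> nrm (col k (op_diff (X t) (X N) x)) + nrm (col k (op_diff (X u) (X N) x))"
        using l2_diff(2)[OF l l] by simp
      also have "\<dots> \<le> D * (2 * h N) * nrm (col k x) + D * (2 * h N) * nrm (col k x)"
        by (intro add_mono b tu x)
      also have "\<dots> = D * (4 * h N) * nrm (col k x)" by (simp add: algebra_simps)
      also have "\<dots> \<le> e * nrm (col k x)" using N by (intro mult_right_mono) auto
      finally show "nrm (col k (op_diff (X t) (X u) x)) \<le> e * nrm (col k x)" .
    qed
    thus ?thesis by blast
  qed
  obtain Y where Y: "Y \<in> Lops P" "(\<lambda>n. opnorm P (op_diff (X n) Y)) \<longlonglongrightarrow> 0"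
    by (rule Lops_complete[OF XL cau], assumption, rule that)
  have "symb Y F"
  proof (rule symb_limit[OF XL Y])
    show "symb (X n) (f n)" for n using X by blast
    fix e :: real assume e: "e > 0"
    have "h \<longlonglongrightarrow> 0" unfolding h_def by (intro LIMSEQ_realpow_zero) auto
    from order_tendstoD(2)[OF this e] obtain N where N: "\<And>n. n \<ge> N \<Longrightarrow> h n < e" by (auto simp: eventually_sequentially)
    have "cmod (f n z a b - F z a b) \<le> e" if "n \<ge> N" for n z a b
      using f[rule_format, of n] N[OF that] by (metis less_imp_le norm_minus_commute order_trans)
    thus "\<exists>N. \<forall>n\<ge>N. \<forall>z a b. cmod (f n z a b - F z a b) \<le> e" by blast
  qed
  moreover have "Y \<in> toeplitz P" by (rule toeplitz_limit[OF _ Y]) (use X in blast)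
  ultimately show ?thesis by blast
qed

lemma symbol_image: "symbol ` toeplitz P = lclosure R"
  using symb_lclosure[OF symb_symbol] lclosure_realised symbol_eqI by blast

text \<open>Combines the two kernel results with compatibility of the symbol with
  differences.\<close>

lemma coset_eq: "T \<in> toeplitz P \<Longrightarrow> coset P T = {S \<in> toeplitz P. symbol S = symbol T}"
proof -
  assume T: "T \<in> toeplitz P"
  have "op_diff S T \<in> cp_ideal P \<longleftrightarrow> symbol S = symbol T" if S: "S \<in> toeplitz P" for S
  proof -
    have "op_diff S T \<in> cp_ideal P \<longleftrightarrow> symbol (op_diff S T) = (\<lambda>z a b. 0)"
      using symbol_0_if_cp_ideal cp_ideal_if_symbol_0[OF toeplitz_diff[OF S T]] by blast
    thus ?thesis unfolding symbol_hom(2)[OF S T] by (auto simp: fun_eq_iff)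
  qed
  thus ?thesis unfolding coset_def by blast
qed

end

section \<open>The Cuntz--Pimsner algebra\<close>

type_synonym 'a symb = "complex \<Rightarrow> 'a \<Rightarrow> 'a \<Rightarrow> complex"

definition add_symbol :: "'a symb \<Rightarrow> 'a symb \<Rightarrow> 'a symb" where
  "add_symbol F G = (\<lambda>z a b. F z a b + G z a b)"

definition scale_symbol :: "complex \<Rightarrow> 'a symb \<Rightarrow> 'a symb" where
  "scale_symbol c F = (\<lambda>z a b. c * F z a b)"

definition star_iso :: "'a::finite symb set \<Rightarrow> 'b::finite symb set \<Rightarrow> ('a symb \<Rightarrow> 'b symb) \<Rightarrow> bool" where
  "star_iso S S' \<Psi> \<longleftrightarrow> bij_betw \<Psi> S S' \<and> (\<forall>F\<in>S. \<forall>G\<in>S. \<forall>c.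
     \<Psi> (add_symbol F G) = add_symbol (\<Psi> F) (\<Psi> G) \<and> \<Psi> (scale_symbol c F) = scale_symbol c (\<Psi> F) \<and>
     \<Psi> (mult_symbol F G) = mult_symbol (\<Psi> F) (\<Psi> G) \<and> \<Psi> (star_symbol F) = star_symbol (\<Psi> F))"

definition star_closed :: "'a::finite symb set \<Rightarrow> bool" where
  "star_closed S \<longleftrightarrow> (\<forall>F\<in>S. \<forall>G\<in>S. \<forall>c. add_symbol F G \<in> S \<and> scale_symbol c F \<in> S \<and>
     mult_symbol F G \<in> S \<and> star_symbol F \<in> S)"

lemma star_iso_inverse:
  assumes i: "star_iso S S' \<Psi>" and c: "star_closed S"
  shows "star_iso S' S (the_inv_into S \<Psi>)"
proof -
  let ?I = "the_inv_into S \<Psi>"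
  have b: "bij_betw \<Psi> S S'" using i by (simp add: star_iso_def)
  hence inj: "inj_on \<Psi> S" and im: "\<Psi> ` S = S'" by (auto simp: bij_betw_def)
  have I: "?I F \<in> S \<and> \<Psi> (?I F) = F" if "F \<in> S'" for F
    using that im inj by (metis f_the_inv_into_f the_inv_into_into order_refl)
  have inv_eq: "?I G = F" if "F \<in> S" "\<Psi> F = G" for F G
    using that the_inv_into_f_f[OF inj] by blast
  show ?thesis
    unfolding star_iso_def
  proof (intro conjI ballI allI)
    show "bij_betw ?I S' S" by (rule bij_betw_the_inv_into[OF b])
    fix F G c assume F: "F \<in> S'" and G: "G \<in> S'"
    have h: "?I F \<in> S" "?I G \<in> S" "\<Psi> (?I F) = F" "\<Psi> (?I G) = G" using I F G by auto
    have m: "add_symbol (?I F) (?I G) \<in> S" "scale_symbol c (?I F) \<in> S"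
        "mult_symbol (?I F) (?I G) \<in> S" "star_symbol (?I F) \<in> S"
      using c h(1,2) unfolding star_closed_def by blast+
    have e: "\<Psi> (add_symbol (?I F) (?I G)) = add_symbol (\<Psi> (?I F)) (\<Psi> (?I G))"
      "\<Psi> (scale_symbol c (?I F)) = scale_symbol c (\<Psi> (?I F))"
      "\<Psi> (mult_symbol (?I F) (?I G)) = mult_symbol (\<Psi> (?I F)) (\<Psi> (?I G))"
      "\<Psi> (star_symbol (?I F)) = star_symbol (\<Psi> (?I F))"
      using i h(1,2) unfolding star_iso_def by blast+
    show "?I (add_symbol F G) = add_symbol (?I F) (?I G)" by (rule inv_eq[OF m(1)]) (simp add: e h)
    show "?I (scale_symbol c F) = scale_symbol c (?I F)" by (rule inv_eq[OF m(2)]) (simp add: e h)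
    show "?I (mult_symbol F G) = mult_symbol (?I F) (?I G)" by (rule inv_eq[OF m(3)]) (simp add: e h)
    show "?I (star_symbol F) = star_symbol (?I F)" by (rule inv_eq[OF m(4)]) (simp add: e h)
  qed
qed

context phased
begin

lemma symbol_hom':
  assumes T: "T \<in> toeplitz P" and S: "S \<in> toeplitz P"
  shows "symbol (op_add T S) = add_symbol (symbol T) (symbol S)"
    "symbol (op_scale c T) = scale_symbol c (symbol T)"
    "symbol (T \<circ> S) = mult_symbol (symbol T) (symbol S)"
    "symbol (adj P T) = star_symbol (symbol T)"
  using symbol_hom[OF T S] by (simp_all add: add_symbol_def scale_symbol_def)

lemma symbol_in: "T \<in> toeplitz P \<Longrightarrow> symbol T \<in> lclosure R"
  using symbol_image by blast

lemma star_closed_lclosure: "star_closed (lclosure R)"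
  unfolding star_closed_def
proof (intro ballI allI)
  fix F G c assume "F \<in> lclosure R" "G \<in> lclosure R"
  then obtain T S where h: "T \<in> toeplitz P" "S \<in> toeplitz P" "F = symbol T" "G = symbol S"
    using symbol_image by blast
  show "add_symbol F G \<in> lclosure R \<and> scale_symbol c F \<in> lclosure R \<and> mult_symbol F G \<in> lclosure R \<and> star_symbol F \<in> lclosure R"
    unfolding h(3,4) symbol_hom'[OF h(1,2), symmetric]
    by (intro conjI symbol_in toeplitz_closed h)
qed

definition fibre :: "'a symb \<Rightarrow> 'a fop set" where
  "fibre F = {S \<in> toeplitz P. symbol S = F}"

lemma coset_fibre: "T \<in> toeplitz P \<Longrightarrow> coset P T = fibre (symbol T)"
  by (simp add: coset_eq fibre_def)

lemma cp_alg_fibre: "cp_alg P = fibre ` lclosure R"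
  unfolding cp_alg_def symbol_image[symmetric] image_image
  by (rule image_cong) (simp_all add: coset_fibre)

lemma fibre_nonempty: "F \<in> lclosure R \<Longrightarrow> \<exists>T. T \<in> fibre F"
proof -
  assume "F \<in> lclosure R"
  hence "F \<in> symbol ` toeplitz P" by (simp add: symbol_image)
  thus ?thesis by (auto simp: fibre_def)
qed

lemma fibre_inj: "F \<in> lclosure R \<Longrightarrow> fibre F = fibre G \<Longrightarrow> F = G"
  using fibre_nonempty[of F] by (auto simp: fibre_def)

text \<open>Decodes a coset; the choice is harmless because the symbol is constant on it.\<close>

definition rep :: "'a fop set \<Rightarrow> 'a symb" where
  "rep C = symbol (SOME x. x \<in> C)"

lemma rep_fibre: "F \<in> lclosure R \<Longrightarrow> rep (fibre F) = F"
  using someI_ex[OF fibre_nonempty[of F]] by (simp add: rep_def fibre_def)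

end

text \<open>Both directions conjugate by the bijection between cosets and symbols. As
  \<open>cp_isomorphic\<close> speaks of arbitrary representatives, operations on them are matched
  with operations on symbols through \<open>symbol_hom'\<close>.\<close>

lemma cp_isomorphic_iff:
  assumes "phased P R r s" and "phased Q R' r' s'"
  shows "cp_isomorphic P Q \<longleftrightarrow> (\<exists>\<Psi>. star_iso (lclosure R) (lclosure R') \<Psi>)"
proof -
  interpret A: phased P R r s by (rule assms(1))
  interpret B: phased Q R' r' s' by (rule assms(2))
  show ?thesis
  proof
    assume "cp_isomorphic P Q"
    then obtain \<Phi> where b: "bij_betw \<Phi> (cp_alg P) (cp_alg Q)"
      and h: "\<And>a b x y c. a \<in> toeplitz P \<Longrightarrow> b \<in> toeplitz P \<Longrightarrow> x \<in> \<Phi> (coset P a) \<Longrightarrow> y \<in> \<Phi> (coset P b) \<Longrightarrow>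
        \<Phi> (coset P (op_add a b)) = coset Q (op_add x y) \<and>
        \<Phi> (coset P (op_scale c a)) = coset Q (op_scale c x) \<and>
        \<Phi> (coset P (a \<circ> b)) = coset Q (x \<circ> y) \<and>
        \<Phi> (coset P (adj P a)) = coset Q (adj Q x)"
      unfolding cp_isomorphic_def by blast
    define \<Psi> where "\<Psi> F = B.rep (\<Phi> (A.fibre F))" for F
    have \<Psi>: "\<Psi> F \<in> lclosure R' \<and> \<Phi> (A.fibre F) = B.fibre (\<Psi> F)" if F: "F \<in> lclosure R" for F
    proof -
      have "\<Phi> (A.fibre F) \<in> cp_alg Q" using b F unfolding A.cp_alg_fibre by (auto simp: bij_betw_def)
      then obtain G where G: "G \<in> lclosure R'" "\<Phi> (A.fibre F) = B.fibre G" unfolding B.cp_alg_fibre by blast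
      thus ?thesis using B.rep_fibre[OF G(1)] by (simp add: \<Psi>_def)
    qed
    have "star_iso (lclosure R) (lclosure R') \<Psi>"
      unfolding star_iso_def
    proof (intro conjI ballI allI)
      show "bij_betw \<Psi> (lclosure R) (lclosure R')"
      proof (rule bij_betwI')
        fix F G assume F: "F \<in> lclosure R" and G: "G \<in> lclosure R"
        have "\<Psi> F = \<Psi> G \<Longrightarrow> F = G"
        proof -
          assume "\<Psi> F = \<Psi> G"
          hence "\<Phi> (A.fibre F) = \<Phi> (A.fibre G)" using \<Psi>[OF F] \<Psi>[OF G] by simp
          moreover have "inj_on \<Phi> (A.fibre ` lclosure R)" using b unfolding A.cp_alg_fibre by (simp add: bij_betw_def)
          ultimately have "A.fibre F = A.fibre G" using F G by (meson imageI inj_onD)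
          thus "F = G" by (rule A.fibre_inj[OF F])
        qed
        thus "(\<Psi> F = \<Psi> G) = (F = G)" by blast
        show "\<Psi> F \<in> lclosure R'" using \<Psi>[OF F] by blast
      next
        fix G assume G: "G \<in> lclosure R'"
        hence "B.fibre G \<in> \<Phi> ` cp_alg P" using b unfolding B.cp_alg_fibre by (simp add: bij_betw_def)
        then obtain F where F: "F \<in> lclosure R" "B.fibre G = \<Phi> (A.fibre F)" unfolding A.cp_alg_fibre by blast
        have "G = \<Psi> F" using B.fibre_inj[OF G, of "\<Psi> F"] F(2) \<Psi>[OF F(1)] by simp
        thus "\<exists>F\<in>lclosure R. G = \<Psi> F" using F(1) by blast
      qed
    next
      fix F G c assume F: "F \<in> lclosure R" and G: "G \<in> lclosure R"
      obtain a where a: "a \<in> toeplitz P" "A.symbol a = F" using A.fibre_nonempty[OF F] by (auto simp: A.fibre_def)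
      obtain b where b: "b \<in> toeplitz P" "A.symbol b = G" using A.fibre_nonempty[OF G] by (auto simp: A.fibre_def)
      obtain x where x: "x \<in> B.fibre (\<Psi> F)" using B.fibre_nonempty \<Psi>[OF F] by blast
      obtain y where y: "y \<in> B.fibre (\<Psi> G)" using B.fibre_nonempty \<Psi>[OF G] by blast
      have x': "x \<in> toeplitz Q" "B.symbol x = \<Psi> F" and y': "y \<in> toeplitz Q" "B.symbol y = \<Psi> G"
        using x y by (auto simp: B.fibre_def)
      have cx: "x \<in> \<Phi> (coset P a)" "y \<in> \<Phi> (coset P b)"
        using x y \<Psi>[OF F] \<Psi>[OF G] by (simp_all add: A.coset_fibre a b)
      note H = h[OF a(1) b(1) cx, of c]
      note c = toeplitz_closed
      \<comment> \<open>Equal cosets have equal symbols; each of the four laws is an instance for a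
        suitable pair of operators.\<close>
      have key: "\<Psi> (A.symbol t) = B.symbol u" if "t \<in> toeplitz P" "u \<in> toeplitz Q" "\<Phi> (coset P t) = coset Q u" for t u
      proof -
        have "B.fibre (\<Psi> (A.symbol t)) = B.fibre (B.symbol u)"
          using that \<Psi>[OF A.symbol_in[OF that(1)]] by (simp add: A.coset_fibre B.coset_fibre)
        thus ?thesis using B.fibre_inj \<Psi>[OF A.symbol_in[OF that(1)]] by blast
      qed
      show "\<Psi> (add_symbol F G) = add_symbol (\<Psi> F) (\<Psi> G)"
        using key[OF c(1)[OF a(1) b(1)] c(1)[OF x'(1) y'(1)]] H
        by (simp add: A.symbol_hom'(1)[OF a(1) b(1)] B.symbol_hom'(1)[OF x'(1) y'(1)] a b x' y')
      show "\<Psi> (scale_symbol c F) = scale_symbol c (\<Psi> F)"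
        using key[OF c(3)[OF a(1)] c(3)[OF x'(1)], of c c] H
        by (simp add: A.symbol_hom'(2)[OF a(1) a(1)] B.symbol_hom'(2)[OF x'(1) x'(1)] a x')
      show "\<Psi> (mult_symbol F G) = mult_symbol (\<Psi> F) (\<Psi> G)"
        using key[OF c(2)[OF a(1) b(1)] c(2)[OF x'(1) y'(1)]] H
        by (simp add: A.symbol_hom'(3)[OF a(1) b(1)] B.symbol_hom'(3)[OF x'(1) y'(1)] a b x' y')
      show "\<Psi> (star_symbol F) = star_symbol (\<Psi> F)"
        using key[OF c(4)[OF a(1)] c(4)[OF x'(1)]] H
        by (simp add: A.symbol_hom'(4)[OF a(1) a(1)] B.symbol_hom'(4)[OF x'(1) x'(1)] a x')
    qed
    thus "\<exists>\<Psi>. star_iso (lclosure R) (lclosure R') \<Psi>" by blast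
  next
    assume "\<exists>\<Psi>. star_iso (lclosure R) (lclosure R') \<Psi>"
    then obtain \<Psi> where b: "bij_betw \<Psi> (lclosure R) (lclosure R')"
      and h: "\<And>F G c. F \<in> lclosure R \<Longrightarrow> G \<in> lclosure R \<Longrightarrow>
        \<Psi> (add_symbol F G) = add_symbol (\<Psi> F) (\<Psi> G) \<and> \<Psi> (scale_symbol c F) = scale_symbol c (\<Psi> F) \<and>
        \<Psi> (mult_symbol F G) = mult_symbol (\<Psi> F) (\<Psi> G) \<and> \<Psi> (star_symbol F) = star_symbol (\<Psi> F)"
      unfolding star_iso_def by blast
    have \<Psi>: "\<Psi> F \<in> lclosure R'" if "F \<in> lclosure R" for F using b that by (auto simp: bij_betw_def)
    define \<Phi> where "\<Phi> C = B.fibre (\<Psi> (A.rep C))" for C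
    have \<Phi>: "\<Phi> (A.fibre F) = B.fibre (\<Psi> F)" if "F \<in> lclosure R" for F
      using A.rep_fibre[OF that] by (simp add: \<Phi>_def)
    have \<Phi>c: "\<Phi> (coset P t) = B.fibre (\<Psi> (A.symbol t))" if "t \<in> toeplitz P" for t
      using \<Phi>[OF A.symbol_in[OF that]] by (simp add: A.coset_fibre[OF that])
    have bij: "bij_betw \<Phi> (cp_alg P) (cp_alg Q)"
      unfolding A.cp_alg_fibre B.cp_alg_fibre
    proof (rule bij_betwI')
      fix C D assume "C \<in> A.fibre ` lclosure R" "D \<in> A.fibre ` lclosure R"
      then obtain F G where FG: "F \<in> lclosure R" "G \<in> lclosure R" "C = A.fibre F" "D = A.fibre G" by blast
      have "\<Phi> C = \<Phi> D \<Longrightarrow> F = G"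
      proof -
        assume "\<Phi> C = \<Phi> D"
        hence "\<Psi> F = \<Psi> G" using B.fibre_inj[OF \<Psi>[OF FG(1)], of "\<Psi> G"] by (simp add: FG \<Phi>)
        thus "F = G" using b FG(1,2) unfolding bij_betw_def by (meson inj_onD)
      qed
      thus "(\<Phi> C = \<Phi> D) = (C = D)" using FG by blast
      show "\<Phi> C \<in> B.fibre ` lclosure R'" using \<Psi>[OF FG(1)] by (simp add: FG \<Phi>)
    next
      fix D assume "D \<in> B.fibre ` lclosure R'"
      then obtain G where G: "G \<in> lclosure R'" "D = B.fibre G" by blast
      then obtain F where "F \<in> lclosure R" "G = \<Psi> F" using b unfolding bij_betw_def by blast
      thus "\<exists>C\<in>A.fibre ` lclosure R. D = \<Phi> C" using G by (intro bexI[of _ "A.fibre F"]) (auto simp: \<Phi>)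
    qed
    show "cp_isomorphic P Q"
      unfolding cp_isomorphic_def
    proof (intro exI[of _ \<Phi>] conjI ballI allI bij)
      fix a b x y c
      assume a: "a \<in> toeplitz P" and b: "b \<in> toeplitz P" and x: "x \<in> \<Phi> (coset P a)" and y: "y \<in> \<Phi> (coset P b)"
      have x': "x \<in> toeplitz Q" "B.symbol x = \<Psi> (A.symbol a)" and y': "y \<in> toeplitz Q" "B.symbol y = \<Psi> (A.symbol b)"
        using x y by (auto simp: \<Phi>c a b B.fibre_def)
      note H = h[OF A.symbol_in[OF a] A.symbol_in[OF b]]
      note c = toeplitz_closed
      show "\<Phi> (coset P (op_add a b)) = coset Q (op_add x y)"
        using H by (simp add: \<Phi>c[OF c(1)[OF a b]] B.coset_fibre[OF c(1)[OF x'(1) y'(1)]]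
          A.symbol_hom'(1)[OF a b] B.symbol_hom'(1)[OF x'(1) y'(1)] x' y')
      show "\<Phi> (coset P (op_scale c a)) = coset Q (op_scale c x)"
        using H by (simp add: \<Phi>c[OF c(3)[OF a]] B.coset_fibre[OF c(3)[OF x'(1)]]
          A.symbol_hom'(2)[OF a a] B.symbol_hom'(2)[OF x'(1) x'(1)] x')
      show "\<Phi> (coset P (a \<circ> b)) = coset Q (x \<circ> y)"
        using H by (simp add: \<Phi>c[OF c(2)[OF a b]] B.coset_fibre[OF c(2)[OF x'(1) y'(1)]]
          A.symbol_hom'(3)[OF a b] B.symbol_hom'(3)[OF x'(1) y'(1)] x' y')
      show "\<Phi> (coset P (adj P a)) = coset Q (adj Q x)"
        using H by (simp add: \<Phi>c[OF c(4)[OF a]] B.coset_fibre[OF c(4)[OF x'(1)]]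
          A.symbol_hom'(4)[OF a a] B.symbol_hom'(4)[OF x'(1) x'(1)] x')
    qed
  qed
qed

section \<open>Recovering the block sizes\<close>

definition relabel :: "('b \<Rightarrow> 'a) \<Rightarrow> 'a symb \<Rightarrow> 'b symb" where
  "relabel g F = (\<lambda>z a b. F z (g a) (g b))"

lemma relabel_laurent:
  assumes g: "bij g" and R: "\<And>a b. R' a b \<longleftrightarrow> R (g a) (g b)"
  shows "laurent R A f \<Longrightarrow> \<exists>A'. laurent R' A' (relabel g f)"
proof (induction rule: laurent.induct)
  case zero
  show ?case unfolding relabel_def using laurent.zero by blast
next
  case (step A f i j c p)
  obtain A' where A': "laurent R' A' (relabel g f)" using step.IH by blast
  obtain i' j' where ij: "g i' = i" "g j' = j" using g by (metis bij_pointE)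
  have m: "monom_symbol i j p z (g a) (g b) = monom_symbol i' j' p z a b" for z a b
    unfolding monom_symbol_def ij[symmetric] using g by (simp add: bij_def inj_eq)
  have "R' i' j'" using step.hyps(2) by (simp add: R ij)
  from laurent.step[OF A' this, of c p] show ?case unfolding relabel_def m by blast
qed

lemma relabel_lclosure:
  assumes g: "bij g" and R: "\<And>a b. R' a b \<longleftrightarrow> R (g a) (g b)" and F: "F \<in> lclosure R"
  shows "relabel g F \<in> lclosure R'"
  unfolding lclosure_def
proof (intro CollectI allI impI)
  fix e :: real assume "e > 0"
  then obtain A f where A: "laurent R A f" "\<And>z a b. cmod (F z a b - f z a b) \<le> e"
    using F unfolding lclosure_def by blast
  obtain A' where "laurent R' A' (relabel g f)" using relabel_laurent[OF g R A(1)] by blast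
  moreover have "cmod (relabel g F z a b - relabel g f z a b) \<le> e" for z a b
    unfolding relabel_def by (rule A(2))
  ultimately show "\<exists>A f. laurent R' A f \<and> (\<forall>z a b. cmod (relabel g F z a b - f z a b) \<le> e)" by blast
qed

text \<open>\<open>lclosure\<close> depends on the equivalence relation alone, so a bijection of
  states that respects the blocks induces an isomorphism, whatever the transition probabilities and
  the periods.\<close>

lemma relabel_star_iso:
  fixes R :: "'a::finite \<Rightarrow> 'a \<Rightarrow> bool" and R' :: "'b::finite \<Rightarrow> 'b \<Rightarrow> bool"
  assumes g: "bij g" and R: "\<And>a b. R' a b \<longleftrightarrow> R (g a) (g b)"
  shows "star_iso (lclosure R) (lclosure R') (relabel g)"
  unfolding star_iso_def
proof (intro conjI ballI allI)
  have gi: "bij (inv g)" using g by (rule bij_imp_bij_inv)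
  have Ri: "R a b \<longleftrightarrow> R' (inv g a) (inv g b)" for a b
    using g by (simp add: R bij_is_surj surj_f_inv_f)
  show "bij_betw (relabel g) (lclosure R) (lclosure R')"
  proof (rule bij_betw_byWitness[where f'="relabel (inv g)"])
    show "\<forall>F\<in>lclosure R. relabel (inv g) (relabel g F) = F"
      using g by (simp add: relabel_def bij_is_surj surj_f_inv_f)
    show "\<forall>F\<in>lclosure R'. relabel g (relabel (inv g) F) = F"
      using g by (simp add: relabel_def bij_is_inj inv_f_f)
    show "relabel g ` lclosure R \<subseteq> lclosure R'" using relabel_lclosure[of g R' R] g R by blast
    show "relabel (inv g) ` lclosure R' \<subseteq> lclosure R" using relabel_lclosure[of "inv g" R R'] gi Ri by blast
  qed
  fix F G :: "'a symb" and c
  show "relabel g (add_symbol F G) = add_symbol (relabel g F) (relabel g G)"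
    by (simp add: relabel_def add_symbol_def)
  show "relabel g (scale_symbol c F) = scale_symbol c (relabel g F)"
    by (simp add: relabel_def scale_symbol_def)
  show "relabel g (star_symbol F) = star_symbol (relabel g F)"
    by (simp add: relabel_def star_symbol_def)
  show "relabel g (mult_symbol F G) = mult_symbol (relabel g F) (relabel g G)"
  proof -
    have "(\<Sum>l\<in>UNIV. F z a l * G z l b) = (\<Sum>l\<in>UNIV. F z a (g l) * G z (g l) b)" for z a b
      using sum.reindex_bij_betw[of g UNIV UNIV "\<lambda>l. F z a l * G z l b"] g by simp
    thus ?thesis by (simp add: relabel_def mult_symbol_def)
  qed
qed

definition blocks :: "'a set list \<Rightarrow> bool" where
  "blocks Bs \<longleftrightarrow> (\<forall>B\<in>set Bs. B \<noteq> {}) \<and> (\<forall>k<length Bs. \<forall>k'<length Bs. k \<noteq> k' \<longrightarrow> Bs ! k \<inter> Bs ! k' = {})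
     \<and> \<Union>(set Bs) = UNIV"

lemma blocks_irred: "irred_block_decomp P Bs \<Longrightarrow> blocks Bs"
  unfolding irred_block_decomp_def blocks_def by blast

lemma blocks_ex: "blocks Bs \<Longrightarrow> \<exists>k<length Bs. i \<in> Bs ! k"
proof -
  assume "blocks Bs"
  hence "i \<in> \<Union>(set Bs)" by (simp add: blocks_def)
  thus ?thesis by (auto simp: in_set_conv_nth)
qed

lemma blocks_unique: "blocks Bs \<Longrightarrow> k < length Bs \<Longrightarrow> k' < length Bs \<Longrightarrow> i \<in> Bs ! k \<Longrightarrow> i \<in> Bs ! k' \<Longrightarrow> k = k'"
  unfolding blocks_def by (metis IntI empty_iff)

lemma blocks_same:
  assumes b: "blocks Bs" and k: "k < length Bs" "i \<in> Bs ! k"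
  shows "same_block Bs i j \<longleftrightarrow> j \<in> Bs ! k"
proof
  assume "same_block Bs i j"
  then obtain k' where k': "k' < length Bs" "i \<in> Bs ! k'" "j \<in> Bs ! k'"
    by (auto simp: same_block_def in_set_conv_nth)
  show "j \<in> Bs ! k" using blocks_unique[OF b k(1) k'(1) k(2) k'(2)] k'(3) by simp
next
  assume j: "j \<in> Bs ! k"
  have "Bs ! k \<in> set Bs" using k(1) by simp
  thus "same_block Bs i j" unfolding same_block_def using k(2) j by (intro bexI[of _ "Bs ! k"]) simp_all
qed

text \<open>Bijections between blocks of equal index are glued; the index \<open>ix\<close> of a
  point is well defined because the blocks partition the states.\<close>

lemma block_bijection:
  fixes Bs :: "'a::finite set list" and Cs :: "'b::finite set list"
  assumes B: "blocks Bs" and C: "blocks Cs" and len: "length Bs = length Cs"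
    and card: "\<forall>k<length Bs. card (Bs ! k) = card (Cs ! k)"
  shows "\<exists>g. bij g \<and> (\<forall>a b. same_block Cs a b \<longleftrightarrow> same_block Bs (g a) (g b))"
proof -
  have "\<forall>k. \<exists>h. k < length Bs \<longrightarrow> bij_betw h (Cs ! k) (Bs ! k)"
  proof
    fix k
    show "\<exists>h. k < length Bs \<longrightarrow> bij_betw h (Cs ! k) (Bs ! k)"
    proof (cases "k < length Bs")
      case True
      hence "card (Cs ! k) = card (Bs ! k)" using card by simp
      from finite_same_card_bij[OF _ _ this] show ?thesis by simp
    qed simp
  qed
  then obtain h where h: "\<forall>k. k < length Bs \<longrightarrow> bij_betw (h k) (Cs ! k) (Bs ! k)" by (rule choice[THEN exE])
  define ix where "ix c = (SOME k. k < length Cs \<and> c \<in> Cs ! k)" for c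
  have ix: "ix c < length Cs \<and> c \<in> Cs ! ix c" for c
    unfolding ix_def using blocks_ex[OF C, of c] by (rule someI_ex)
  have ixeq: "ix c = k" if "k < length Cs" "c \<in> Cs ! k" for c k
    using blocks_unique[OF C] ix that by blast
  define g where "g c = h (ix c) c" for c
  have gin: "g c \<in> Bs ! ix c" for c
    unfolding g_def using h ix[of c] len by (metis bij_betwE)
  have ixB: "ix c = k" if "k < length Bs" "g c \<in> Bs ! k" for c k
    using blocks_unique[OF B] gin ix[of c] len that by metis
  have "inj g"
  proof (rule injI)
    fix c d assume e: "g c = g d"
    have k: "ix c = ix d" using ixB[of "ix d" c] gin[of d] ix[of d] len e by simp
    have "inj_on (h (ix c)) (Cs ! ix c)" using h ix[of c] len by (simp add: bij_betw_def)
    moreover have "h (ix c) c = h (ix c) d" using e k by (simp add: g_def)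
    ultimately show "c = d" using ix[of c] ix[of d] k by (auto dest: inj_onD)
  qed
  moreover have "surj g"
    unfolding surj_def
  proof
    fix i obtain k where k: "k < length Bs" "i \<in> Bs ! k" using blocks_ex[OF B] by blast
    have "h k ` (Cs ! k) = Bs ! k" using h k(1) by (simp add: bij_betw_def)
    hence "i \<in> h k ` (Cs ! k)" using k(2) by simp
    then obtain c where c: "i = h k c" "c \<in> Cs ! k" by (rule imageE)
    have "ix c = k" by (rule ixeq[OF _ c(2)]) (simp add: len[symmetric] k(1))
    hence "i = g c" using c(1) by (simp add: g_def)
    thus "\<exists>c. i = g c" by (rule exI)
  qed
  moreover have "same_block Cs a b \<longleftrightarrow> same_block Bs (g a) (g b)" for a b
  proof -
    have la: "ix a < length Cs" "ix a < length Bs" "a \<in> Cs ! ix a" using ix[of a] len by simp_all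
    have "same_block Cs a b \<longleftrightarrow> b \<in> Cs ! ix a" by (rule blocks_same[OF C la(1,3)])
    also have "\<dots> \<longleftrightarrow> ix b = ix a"
    proof
      assume "b \<in> Cs ! ix a" thus "ix b = ix a" by (rule ixeq[OF la(1)])
    next
      assume "ix b = ix a" thus "b \<in> Cs ! ix a" using ix[of b] by simp
    qed
    also have "\<dots> \<longleftrightarrow> g b \<in> Bs ! ix a"
    proof
      assume "ix b = ix a" thus "g b \<in> Bs ! ix a" using gin[of b] by simp
    next
      assume "g b \<in> Bs ! ix a" thus "ix b = ix a" by (rule ixB[OF la(2)])
    qed
    also have "\<dots> \<longleftrightarrow> same_block Bs (g a) (g b)"
      by (rule blocks_same[OF B la(2) gin[of a], symmetric])
    finally show ?thesis .
  qed
  ultimately show ?thesis by (intro exI[of _ g]) (simp add: bij_def)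
qed

section \<open>Projections, traces and the induced map of blocks\<close>

definition diag_symbol :: "'a set \<Rightarrow> 'a symb" where
  "diag_symbol S = (\<lambda>z a b. if a = b \<and> a \<in> S \<and> cmod z = 1 then 1 else 0)"

lemma monom_lclosure: "R i j \<Longrightarrow> monom_symbol i j p \<in> lclosure R"
  unfolding lclosure_def using laurent_monom[of R i j 1 p]
  by (intro CollectI allI impI exI[of _ "\<lambda>y a. 1 * laurent_unit i j p y a"] exI[of _ "monom_symbol i j p"]) simp

text \<open>What an isomorphism preserves of the diagonal matrix units. Orthogonality holds with any
  element in between, since no symbol connects different blocks. The diagonals sum to 1 because the
  image of the unit acts as a left unit on an algebra that contains the constant diagonal matrix
  units.\<close>

lemma star_iso_projections:
  fixes R :: "'a::finite \<Rightarrow> 'a \<Rightarrow> bool" and R' :: "'b::finite \<Rightarrow> 'b \<Rightarrow> bool"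
  assumes eqR: "equivp R" and eqR': "equivp R'"
    and cl: "star_closed (lclosure R)" and iso: "star_iso (lclosure R) (lclosure R') \<Psi>"
  shows "\<exists>f :: 'a \<Rightarrow> 'b symb. (\<forall>i. f i \<in> lclosure R' \<and> mult_symbol (f i) (f i) = f i \<and> star_symbol (f i) = f i
      \<and> (\<exists>z a b. f i z a b \<noteq> 0)) \<and>
    (\<forall>i j. \<not> R i j \<longrightarrow> (\<forall>G\<in>lclosure R'. mult_symbol (f i) (mult_symbol G (f j)) = (\<lambda>z a b. 0))) \<and>
    (\<forall>z a. cmod z = 1 \<longrightarrow> (\<Sum>i\<in>UNIV. f i z a a) = 1)"
proof -
  have bij: "bij_betw \<Psi> (lclosure R) (lclosure R')" and
    add: "\<And>F G. F \<in> lclosure R \<Longrightarrow> G \<in> lclosure R \<Longrightarrow> \<Psi> (add_symbol F G) = add_symbol (\<Psi> F) (\<Psi> G)" and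
    scl: "\<And>F c. F \<in> lclosure R \<Longrightarrow> \<Psi> (scale_symbol c F) = scale_symbol c (\<Psi> F)" and
    mlt: "\<And>F G. F \<in> lclosure R \<Longrightarrow> G \<in> lclosure R \<Longrightarrow> \<Psi> (mult_symbol F G) = mult_symbol (\<Psi> F) (\<Psi> G)" and
    str: "\<And>F. F \<in> lclosure R \<Longrightarrow> \<Psi> (star_symbol F) = star_symbol (\<Psi> F)"
    using iso unfolding star_iso_def by blast+
  have into: "\<Psi> F \<in> lclosure R'" if "F \<in> lclosure R" for F using bij that by (auto simp: bij_betw_def)
  have onto: "\<exists>F\<in>lclosure R. \<Psi> F = G" if "G \<in> lclosure R'" for G
    using bij that unfolding bij_betw_def by (metis imageE)
  have inj: "F = G" if "F \<in> lclosure R" "G \<in> lclosure R" "\<Psi> F = \<Psi> G" for F G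
    using bij that unfolding bij_betw_def by (meson inj_onD)
  have refl: "R i i" for i using eqR by (rule equivp_reflp)
  define E where "E i = monom_symbol i i 0" for i :: 'a
  have E: "E i \<in> lclosure R" for i unfolding E_def by (rule monom_lclosure[of R, OF refl])
  have Ez: "E i z a b = (if a = i \<and> b = i \<and> cmod z = 1 then 1 else 0)" for i z a b by (simp add: E_def monom_symbol_def)
  have EE: "mult_symbol (E i) (E i) = E i" "star_symbol (E i) = E i" for i
  proof -
    have "(\<Sum>l\<in>UNIV. E i z a l * E i z l b) = (\<Sum>l\<in>UNIV. if l = i then E i z a b else 0)" for z a b
      by (intro sum.cong refl) (auto simp: Ez)
    thus "mult_symbol (E i) (E i) = E i" by (simp add: mult_symbol_def)
    show "star_symbol (E i) = E i" by (auto simp: star_symbol_def Ez fun_eq_iff)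
  qed
  define Z :: "'a symb" where "Z = (\<lambda>z a b. 0)"
  have sc0: "scale_symbol 0 F = (\<lambda>z a b. 0)" for F :: "'c symb" by (simp add: scale_symbol_def)
  have Zin: "Z \<in> lclosure R" using cl E sc0[of "E _"] unfolding star_closed_def Z_def by metis
  have \<Psi>Z: "\<Psi> Z = (\<lambda>z a b. 0)" using scl[OF E, of 0] by (simp add: sc0 Z_def)
  \<comment> \<open>Partial sums of the unit, so that additivity can be applied by induction over
    the set of states.\<close>
  define D where "D S = diag_symbol S" for S :: "'a set"
  have Ds: "D S \<in> lclosure R \<and> \<Psi> (D S) = (\<lambda>z a b. \<Sum>i\<in>S. \<Psi> (E i) z a b)" if "finite S" for S
    using that
  proof (induction S rule: finite_induct)
    case empty
    have "D {} = Z" by (simp add: D_def diag_symbol_def Z_def)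
    thus ?case using Zin \<Psi>Z by simp
  next
    case (insert i S)
    have "D (insert i S) = add_symbol (E i) (D S)"
      using insert(2) by (auto simp: D_def diag_symbol_def add_symbol_def Ez fun_eq_iff)
    moreover have "add_symbol (E i) (D S) \<in> lclosure R" using cl E insert(3) unfolding star_closed_def by blast
    ultimately show ?case using add[OF E, of "D S" i] insert by (simp add: add_symbol_def)
  qed
  have unit: "mult_symbol (D UNIV) F = F" if "F \<in> lclosure R" for F
  proof (intro ext)
    fix z a b
    have "(\<Sum>l\<in>UNIV. D UNIV z a l * F z l b) = (\<Sum>l\<in>UNIV. if l = a then F z a b else 0)"
      using lclosure_support[OF that, of z a b] by (intro sum.cong refl) (auto simp: D_def diag_symbol_def)
    thus "mult_symbol (D UNIV) F z a b = F z a b" by (simp add: mult_symbol_def)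
  qed
  have DU: "D UNIV \<in> lclosure R" using Ds[of UNIV] by simp
  have unit': "mult_symbol (\<Psi> (D UNIV)) G = G" if G: "G \<in> lclosure R'" for G
  proof -
    obtain F where F: "F \<in> lclosure R" "\<Psi> F = G" using onto[OF G] by blast
    show ?thesis using mlt[OF DU F(1)] unit[OF F(1)] F(2) by simp
  qed
  have one: "\<Psi> (D UNIV) z a a = 1" if z: "cmod z = 1" for z a
  proof -
    have "monom_symbol a a 0 \<in> lclosure R'" by (rule monom_lclosure[of R', OF equivp_reflp[OF eqR']])
    hence "mult_symbol (\<Psi> (D UNIV)) (monom_symbol a a 0) z a a = monom_symbol a a 0 z a a" by (simp add: unit')
    moreover have "mult_symbol (\<Psi> (D UNIV)) (monom_symbol a a 0) z a a
      = (\<Sum>l\<in>UNIV. if l = a then \<Psi> (D UNIV) z a a else 0)"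
      unfolding mult_symbol_def using z by (intro sum.cong refl) (auto simp: monom_symbol_def)
    ultimately show ?thesis using z by (simp add: monom_symbol_def)
  qed
  show ?thesis
  proof (intro exI[of _ "\<lambda>i. \<Psi> (E i)"] conjI allI impI ballI)
    fix i
    show "\<Psi> (E i) \<in> lclosure R'" by (rule into[OF E])
    show "mult_symbol (\<Psi> (E i)) (\<Psi> (E i)) = \<Psi> (E i)" using mlt[OF E E, of i i] EE(1) by simp
    show "star_symbol (\<Psi> (E i)) = \<Psi> (E i)" using str[OF E, of i] EE(2) by simp
    show "\<exists>z a b. \<Psi> (E i) z a b \<noteq> 0"
    proof (rule ccontr)
      assume "\<nexists>z a b. \<Psi> (E i) z a b \<noteq> 0"
      hence "\<Psi> (E i) = \<Psi> Z" unfolding \<Psi>Z by (simp add: fun_eq_iff)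
      hence "E i = Z" by (rule inj[OF E Zin])
      hence "E i 1 i i = 0" by (simp add: Z_def)
      thus False by (simp add: Ez)
    qed
  next
    fix i j G assume nR: "\<not> R i j" and G: "G \<in> lclosure R'"
    obtain F where F: "F \<in> lclosure R" "\<Psi> F = G" using onto[OF G] by blast
    have "(\<Sum>l\<in>UNIV. E i z a l * (\<Sum>m\<in>UNIV. F z l m * E j z m b)) = 0" for z a b
    proof -
      have t: "E i z a l * (F z l m * E j z m b) = 0" for l m
        using lclosure_support[OF F(1), of z i j] nR by (auto simp: Ez)
      show ?thesis unfolding sum_distrib_left t by simp
    qed
    hence "mult_symbol (E i) (mult_symbol F (E j)) = Z" by (simp add: mult_symbol_def Z_def)
    moreover have "mult_symbol F (E j) \<in> lclosure R" using cl F(1) E unfolding star_closed_def by blast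
    ultimately show "mult_symbol (\<Psi> (E i)) (mult_symbol G (\<Psi> (E j))) = (\<lambda>z a b. 0)"
      using mlt[OF E, of "mult_symbol F (E j)" i] mlt[OF F(1) E, of j] \<Psi>Z F(2) by simp
  next
    fix z a assume "cmod (z::complex) = 1"
    from one[OF this, of a] show "(\<Sum>i\<in>UNIV. \<Psi> (E i) z a a) = 1" using Ds[of UNIV] by simp
  qed
qed

text \<open>Squared Frobenius norm on the block of \<open>c\<close>. For a projection it equals the
  trace there, but in this form it is plainly real, nonnegative and continuous along the
  circle.\<close>

definition block_trace :: "('b::finite \<Rightarrow> 'b \<Rightarrow> bool) \<Rightarrow> 'b symb \<Rightarrow> complex \<Rightarrow> 'b \<Rightarrow> real" where
  "block_trace R f z c = (\<Sum>b\<in>{b. R b c}. \<Sum>l\<in>{l. R l c}. (cmod (f z b l))\<^sup>2)"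

lemma projection_diag:
  fixes f :: "'b::finite symb"
  assumes "mult_symbol f f = f" "star_symbol f = f"
  shows "f z b b = of_real (\<Sum>l\<in>UNIV. (cmod (f z b l))\<^sup>2)"
proof -
  have "f z b b = (\<Sum>l\<in>UNIV. f z b l * f z l b)" using fun_cong[OF fun_cong[OF fun_cong[OF assms(1)]], of z b b] by (simp add: mult_symbol_def)
  also have "\<dots> = (\<Sum>l\<in>UNIV. f z b l * cnj (f z b l))"
    using fun_cong[OF fun_cong[OF fun_cong[OF assms(2)]], of z _ b] by (simp add: star_symbol_def)
  also have "\<dots> = (\<Sum>l\<in>UNIV. of_real ((cmod (f z b l))\<^sup>2))" by (simp only: complex_norm_square)
  finally show ?thesis by simp
qed

lemma block_trace_eq:
  assumes eq: "equivp R" and f: "f \<in> lclosure R" "mult_symbol f f = f" "star_symbol f = f"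
  shows "of_real (block_trace R f z c) = (\<Sum>b\<in>{b. R b c}. f z b b)"
proof -
  have "(\<Sum>l\<in>UNIV. (cmod (f z b l))\<^sup>2) = (\<Sum>l\<in>{l. R l c}. (cmod (f z b l))\<^sup>2)" if "R b c" for b
  proof (rule sum.mono_neutral_right)
    show "\<forall>l\<in>UNIV - {l. R l c}. (cmod (f z b l))\<^sup>2 = 0"
    proof
      fix l assume "l \<in> UNIV - {l. R l c}"
      hence "\<not> R b l" using that equivp_transp[OF eq] equivp_symp[OF eq] by blast
      thus "(cmod (f z b l))\<^sup>2 = 0" using lclosure_support[OF f(1)] by simp
    qed
  qed auto
  thus ?thesis unfolding block_trace_def projection_diag[OF f(2,3)] by simp
qed

lemma block_trace_nonneg: "0 \<le> block_trace R f z c"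
  unfolding block_trace_def by (intro sum_nonneg) auto

text \<open>The Frobenius norm is submultiplicative and \<open>f = f f\<close>.\<close>

lemma block_trace_gap:
  assumes eq: "equivp R" and f: "f \<in> lclosure R" "mult_symbol f f = f"
  shows "block_trace R f z c = 0 \<or> block_trace R f z c \<ge> 1"
proof -
  let ?B = "{b. R b c}"
  define t where "t = block_trace R f z c"
  have "(cmod (f z b l))\<^sup>2 \<le> (\<Sum>m\<in>?B. (cmod (f z b m))\<^sup>2) * (\<Sum>m\<in>?B. (cmod (f z m l))\<^sup>2)" if b: "R b c" for b l
  proof -
    have "f z b l = (\<Sum>m\<in>UNIV. f z b m * f z m l)"
      using fun_cong[OF fun_cong[OF fun_cong[OF f(2)]], of z b l] by (simp add: mult_symbol_def)
    also have "\<dots> = (\<Sum>m\<in>?B. f z b m * f z m l)"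
    proof (rule sum.mono_neutral_right)
      show "\<forall>m\<in>UNIV - ?B. f z b m * f z m l = 0"
      proof
        fix m assume "m \<in> UNIV - ?B"
        hence "\<not> R b m" using b equivp_transp[OF eq] equivp_symp[OF eq] by blast
        thus "f z b m * f z m l = 0" using lclosure_support[OF f(1)] by simp
      qed
    qed auto
    finally have "cmod (f z b l) \<le> (\<Sum>m\<in>?B. \<bar>cmod (f z b m)\<bar> * \<bar>cmod (f z m l)\<bar>)"
      by (simp add: sum_norm_le norm_mult)
    also have "\<dots> \<le> L2_set (\<lambda>m. cmod (f z b m)) ?B * L2_set (\<lambda>m. cmod (f z m l)) ?B"
      by (rule L2_set_mult_ineq)
    finally have "(cmod (f z b l))\<^sup>2 \<le> (L2_set (\<lambda>m. cmod (f z b m)) ?B * L2_set (\<lambda>m. cmod (f z m l)) ?B)\<^sup>2"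
      by (intro power_mono) auto
    thus ?thesis by (simp add: L2_set_def power_mult_distrib sum_nonneg)
  qed
  hence "t \<le> (\<Sum>b\<in>?B. \<Sum>l\<in>?B. (\<Sum>m\<in>?B. (cmod (f z b m))\<^sup>2) * (\<Sum>m\<in>?B. (cmod (f z m l))\<^sup>2))"
    unfolding t_def block_trace_def by (intro sum_mono) auto
  also have "\<dots> = (\<Sum>b\<in>?B. \<Sum>m\<in>?B. (cmod (f z b m))\<^sup>2) * (\<Sum>l\<in>?B. \<Sum>m\<in>?B. (cmod (f z m l))\<^sup>2)"
    by (simp add: sum_product)
  also have "(\<Sum>l\<in>?B. \<Sum>m\<in>?B. (cmod (f z m l))\<^sup>2) = (\<Sum>m\<in>?B. \<Sum>l\<in>?B. (cmod (f z m l))\<^sup>2)" by (rule sum.swap)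
  finally have "t \<le> t * t" by (simp add: t_def block_trace_def)
  thus ?thesis using block_trace_nonneg[of R f z c] unfolding t_def[symmetric]
    by (cases "t = 0") (auto simp: mult_le_cancel_right1)
qed

text \<open>A projection that is nonzero somewhere on a block stays nonzero at the point 1, since
  the intermediate value \<open>1/2\<close> is excluded; all further comparisons can be made at that
  single point.\<close>

lemma block_trace_connected:
  assumes eq: "equivp R" and f: "f \<in> lclosure R" "mult_symbol f f = f"
    and z: "cmod z = 1" "block_trace R f z c \<noteq> 0"
  shows "block_trace R f 1 c \<ge> 1"
proof (rule ccontr)
  assume "\<not> block_trace R f 1 c \<ge> 1"
  hence 0: "block_trace R f 1 c = 0" using block_trace_gap[OF eq f] by blast
  have 1: "block_trace R f z c \<ge> 1" using block_trace_gap[OF eq f] z(2) by blast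
  obtain t where t: "0 \<le> t" "z = Complex (cos t) (sin t)"
    using complex_unimodular_polar[OF z(1)] by metis
  have zt: "z = cis t" unfolding t(2) by (simp add: complex_eq_iff)
  have cont: "continuous_on {0..t} (\<lambda>u. block_trace R f (cis u) c)"
    unfolding block_trace_def
    by (intro continuous_intros continuous_on_compose2[OF lclosure_continuous[OF f(1)]]) auto
  have "\<exists>u. 0 \<le> u \<and> u \<le> t \<and> block_trace R f (cis u) c = 1/2"
    by (rule IVT'[OF _ _ t(1) cont]) (use 0 1 zt in auto)
  then obtain u where "block_trace R f (cis u) c = 1/2" by blast
  thus False using block_trace_gap[OF eq f, of "cis u" c] by simp
qed

text \<open>\<open>\<tau> k\<close> is the block of states whose projections live on block
  \<open>k\<close>: orthogonality permits only one, and every block is reached because no projection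
  vanishes. If \<open>\<tau>\<close> is injective, the projections of block \<open>\<tau> k\<close>
  all live on block \<open>k\<close> alone, where each has trace at least 1 and the traces of all
  projections sum to the block size.\<close>

lemma star_iso_block_map:
  fixes Bs :: "'a::finite set list" and Cs :: "'b::finite set list"
  assumes B: "blocks Bs" and C: "blocks Cs"
    and eqR: "equivp (same_block Bs)" and eqR': "equivp (same_block Cs)"
    and cl: "star_closed (lclosure (same_block Bs))"
    and iso: "star_iso (lclosure (same_block Bs)) (lclosure (same_block Cs)) \<Psi>"
  shows "\<exists>\<tau>. \<tau> ` {..<length Cs} = {..<length Bs} \<and>
    (inj_on \<tau> {..<length Cs} \<longrightarrow> (\<forall>k<length Cs. card (Bs ! \<tau> k) \<le> card (Cs ! k)))"
proof -
  let ?R = "same_block Bs" and ?S = "same_block Cs"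
  obtain f :: "'a \<Rightarrow> 'b symb" where
    f: "\<And>i. f i \<in> lclosure ?S" "\<And>i. mult_symbol (f i) (f i) = f i" "\<And>i. star_symbol (f i) = f i"
      "\<And>i. \<exists>z a b. f i z a b \<noteq> 0"
    and orth: "\<And>i j G. \<not> ?R i j \<Longrightarrow> G \<in> lclosure ?S \<Longrightarrow> mult_symbol (f i) (mult_symbol G (f j)) = (\<lambda>z a b. 0)"
    and one: "\<And>z a. cmod z = 1 \<Longrightarrow> (\<Sum>i\<in>UNIV. f i z a a) = 1"
    using star_iso_projections[OF eqR eqR' cl iso] by blast
  define T where "T i c = block_trace ?S (f i) 1 c" for i c
  have gap: "T i c = 0 \<or> T i c \<ge> 1" for i c unfolding T_def by (rule block_trace_gap[OF eqR' f(1,2)])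
  have Tnn: "0 \<le> T i c" for i c unfolding T_def by (rule block_trace_nonneg)
  have sumT: "(\<Sum>i\<in>UNIV. T i c) = real (card {b. ?S b c})" for c
  proof -
    have "complex_of_real (\<Sum>i\<in>UNIV. T i c) = (\<Sum>i\<in>UNIV. \<Sum>b\<in>{b. ?S b c}. f i 1 b b)"
      by (simp add: T_def block_trace_eq[OF eqR' f(1-3)])
    also have "\<dots> = (\<Sum>b\<in>{b. ?S b c}. \<Sum>i\<in>UNIV. f i 1 b b)" by (rule sum.swap)
    also have "\<dots> = complex_of_real (real (card {b. ?S b c}))" by (simp add: one)
    finally show ?thesis unfolding of_real_eq_iff .
  qed
  have exi: "\<exists>i. T i c \<ge> 1" for c
  proof (rule ccontr)
    assume "\<nexists>i. T i c \<ge> 1"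
    hence "(\<Sum>i\<in>UNIV. T i c) = 0" using gap by (intro sum.neutral) blast
    moreover have "c \<in> {b. ?S b c}" using equivp_reflp[OF eqR'] by simp
    hence "card {b. ?S b c} > 0" by (auto simp: card_gt_0_iff)
    ultimately show False using sumT[of c] by simp
  qed
  have exc: "\<exists>c. T i c \<ge> 1" for i
  proof -
    obtain z a b where nz: "f i z a b \<noteq> 0" using f(4) by blast
    have z: "cmod z = 1" "?S a b" using lclosure_support[OF f(1), of z a b i] nz by blast+
    have "0 < (cmod (f i z a b))\<^sup>2" using nz by simp
    also have "\<dots> \<le> (\<Sum>l\<in>{l. ?S l b}. (cmod (f i z a l))\<^sup>2)"
      using equivp_reflp[OF eqR'] by (intro member_le_sum) auto
    also have "\<dots> \<le> block_trace ?S (f i) z b"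
      unfolding block_trace_def
      by (rule member_le_sum[of a "{b'. ?S b' b}" "\<lambda>a. \<Sum>l\<in>{l. ?S l b}. (cmod (f i z a l))\<^sup>2"])
        (use z(2) in \<open>auto intro: sum_nonneg\<close>)
    finally have "block_trace ?S (f i) z b \<noteq> 0" by simp
    thus ?thesis unfolding T_def using block_trace_connected[OF eqR' f(1,2) z(1)] by blast
  qed
  have nzT: "\<exists>x y. ?S x c \<and> ?S y c \<and> f i 1 x y \<noteq> 0" if "T i c \<ge> 1" for i c
  proof (rule ccontr)
    assume "\<not> ?thesis"
    hence "T i c = 0" unfolding T_def block_trace_def by (intro sum.neutral ballI) auto
    thus False using that by simp
  qed
  have uni: "?R i j" if ij: "T i c \<ge> 1" "T j c \<ge> 1" for i j c
  proof (rule ccontr)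
    assume n: "\<not> ?R i j"
    obtain x b where xb: "?S x c" "?S b c" "f i 1 x b \<noteq> 0" using nzT[OF ij(1)] by blast
    obtain m y where my: "?S m c" "?S y c" "f j 1 m y \<noteq> 0" using nzT[OF ij(2)] by blast
    \<comment> \<open>The matrix unit joining a nonzero entry of \<open>f i\<close> to one of
      \<open>f j\<close> in the same block gives a nonzero product, which contradicts
      orthogonality.\<close>
    have "?S b m" using xb(2) my(1) equivp_transp[OF eqR'] equivp_symp[OF eqR'] by blast
    hence G: "monom_symbol b m 0 \<in> lclosure ?S" by (rule monom_lclosure)
    have "mult_symbol (monom_symbol b m 0) (f j) 1 l y = (\<Sum>k\<in>UNIV. if k = m then (if l = b then f j 1 m y else 0) else 0)" for l
      unfolding mult_symbol_def by (intro sum.cong refl) (auto simp: monom_symbol_def)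
    hence e: "mult_symbol (monom_symbol b m 0) (f j) 1 l y = (if l = b then f j 1 m y else 0)" for l by simp
    have "mult_symbol (f i) (mult_symbol (monom_symbol b m 0) (f j)) 1 x y
      = (\<Sum>l\<in>UNIV. f i 1 x l * mult_symbol (monom_symbol b m 0) (f j) 1 l y)" by (simp add: mult_symbol_def)
    also have "\<dots> = (\<Sum>l\<in>UNIV. if l = b then f i 1 x b * f j 1 m y else 0)"
      unfolding e by (intro sum.cong refl) auto
    also have "\<dots> \<noteq> 0" using xb(3) my(3) by simp
    finally show False using orth[OF n G] by simp
  qed
  have Tsame: "T i c = T i d" if "?S c d" for i c d
  proof -
    have "?S b c \<longleftrightarrow> ?S b d" for b using that equivp_transp[OF eqR'] equivp_symp[OF eqR'] by blast
    thus ?thesis by (simp add: T_def block_trace_def)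
  qed
  have "\<forall>k. \<exists>j. k < length Cs \<longrightarrow> j < length Bs \<and> (\<forall>c\<in>Cs ! k. \<forall>i. T i c \<ge> 1 \<longrightarrow> i \<in> Bs ! j)"
  proof
    fix k
    show "\<exists>j. k < length Cs \<longrightarrow> j < length Bs \<and> (\<forall>c\<in>Cs ! k. \<forall>i. T i c \<ge> 1 \<longrightarrow> i \<in> Bs ! j)"
    proof (cases "k < length Cs")
      case True
      hence "Cs ! k \<noteq> {}" using C by (simp add: blocks_def)
      then obtain c where c: "c \<in> Cs ! k" by blast
      obtain i where i: "T i c \<ge> 1" using exi by blast
      obtain j where j: "j < length Bs" "i \<in> Bs ! j" using blocks_ex[OF B] by blast
      have "i' \<in> Bs ! j" if "d \<in> Cs ! k" "T i' d \<ge> 1" for d i'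
      proof -
        have "?S d c" using blocks_same[OF C True that(1)] c by simp
        hence "T i' c \<ge> 1" using Tsame that(2) by simp
        from uni[OF i this] show ?thesis using blocks_same[OF B j] by simp
      qed
      thus ?thesis using j by blast
    qed blast
  qed
  then obtain \<tau> where \<tau>: "\<forall>k. k < length Cs \<longrightarrow> \<tau> k < length Bs \<and> (\<forall>c\<in>Cs ! k. \<forall>i. T i c \<ge> 1 \<longrightarrow> i \<in> Bs ! \<tau> k)"
    by (rule choice[THEN exE])
  have hit: "\<exists>k<length Cs. \<exists>c\<in>Cs ! k. T i c \<ge> 1 \<and> \<tau> k = j" if "j < length Bs" "i \<in> Bs ! j" for i j
  proof -
    obtain c where c: "T i c \<ge> 1" using exc by blast
    obtain k where k: "k < length Cs" "c \<in> Cs ! k" using blocks_ex[OF C] by blast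
    have "\<tau> k < length Bs" "i \<in> Bs ! \<tau> k" using \<tau> k c by blast+
    hence "\<tau> k = j" using blocks_unique[OF B _ that(1) _ that(2)] by blast
    thus ?thesis using k c by (intro exI[of _ k] conjI bexI[of _ c])
  qed
  have im: "\<tau> ` {..<length Cs} = {..<length Bs}"
  proof
    show "\<tau> ` {..<length Cs} \<subseteq> {..<length Bs}" using \<tau> by auto
    show "{..<length Bs} \<subseteq> \<tau> ` {..<length Cs}"
    proof
      fix j assume "j \<in> {..<length Bs}"
      hence j: "j < length Bs" by simp
      hence "Bs ! j \<noteq> {}" using B by (simp add: blocks_def)
      then obtain i where "i \<in> Bs ! j" by blast
      from hit[OF j this] show "j \<in> \<tau> ` {..<length Cs}" by blast
    qed
  qed
  have "card (Bs ! \<tau> k) \<le> card (Cs ! k)" if inj: "inj_on \<tau> {..<length Cs}" and k: "k < length Cs" for k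
  proof -
    have "Cs ! k \<noteq> {}" using C k by (simp add: blocks_def)
    then obtain c where c: "c \<in> Cs ! k" by blast
    have set: "{b. ?S b c} = Cs ! k" using blocks_same[OF C k c] equivp_symp[OF eqR'] by blast
    have "T i c \<ge> 1" if i: "i \<in> Bs ! \<tau> k" for i
    proof -
      obtain k' d where k': "k' < length Cs" "d \<in> Cs ! k'" "T i d \<ge> 1" "\<tau> k' = \<tau> k" using hit[OF _ i] \<tau> k by blast
      have "k' = k" by (rule inj_onD[OF inj k'(4)]) (use k k'(1) in simp_all)
      hence "?S c d" using blocks_same[OF C k c] k'(2) by simp
      thus ?thesis using Tsame k'(3) by simp
    qed
    hence "real (card (Bs ! \<tau> k)) \<le> (\<Sum>i\<in>Bs ! \<tau> k. T i c)"
      using sum_mono[of "Bs ! \<tau> k" "\<lambda>i. 1" "\<lambda>i. T i c"] by simp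
    also have "\<dots> \<le> (\<Sum>i\<in>UNIV. T i c)" by (rule sum_mono2) (auto simp: Tnn)
    also have "\<dots> = real (card (Cs ! k))" unfolding sumT set ..
    finally show ?thesis by simp
  qed
  thus ?thesis using im by blast
qed

section \<open>Comparison of the sorted lists of sizes\<close>

lemma sum_card_blocks:
  fixes Bs :: "'a::finite set list"
  assumes B: "blocks Bs"
  shows "(\<Sum>k<length Bs. card (Bs ! k)) = CARD('a)"
proof -
  have "card (\<Union>k\<in>{..<length Bs}. Bs ! k) = (\<Sum>k<length Bs. card (Bs ! k))"
    using B by (intro card_UN_disjoint) (auto simp: blocks_def)
  moreover have "(\<Union>k\<in>{..<length Bs}. Bs ! k) = UNIV" using blocks_ex[OF B] by blast
  ultimately show ?thesis by simp
qed

lemma mset_map_nth: "mset (map f xs) = image_mset (\<lambda>k. f (xs ! k)) (mset_set {..<length xs})"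
proof -
  have "map f xs = map (\<lambda>k. f (xs ! k)) [0..<length xs]" by (rule nth_equalityI) simp_all
  hence "mset (map f xs) = mset (map (\<lambda>k. f (xs ! k)) [0..<length xs])" by (rule arg_cong)
  also have "\<dots> = image_mset (\<lambda>k. f (xs ! k)) (mset_set {..<length xs})"
    by (simp only: mset_map mset_upt atLeast0LessThan)
  finally show ?thesis .
qed

text \<open>Surjections in both directions make the lengths equal and both maps injective, so both
  families of inequalities become available. Summed, they give equal totals, hence equality block by
  block along \<open>\<tau>\<close>; a bijection preserves the multiset of sizes, and sorted lists
  with the same multiset agree.\<close>

lemma sorted_blocks_eq:
  fixes Bs :: "'a::finite set list" and Cs :: "'b::finite set list"
  assumes B: "blocks Bs" "sorted (map card Bs)" and C: "blocks Cs" "sorted (map card Cs)"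
    and \<tau>: "\<tau> ` {..<length Cs} = {..<length Bs}"
      "inj_on \<tau> {..<length Cs} \<longrightarrow> (\<forall>k<length Cs. card (Bs ! \<tau> k) \<le> card (Cs ! k))"
    and \<sigma>: "\<sigma> ` {..<length Bs} = {..<length Cs}"
      "inj_on \<sigma> {..<length Bs} \<longrightarrow> (\<forall>k<length Bs. card (Cs ! \<sigma> k) \<le> card (Bs ! k))"
  shows "map card Bs = map card Cs"
proof -
  have "length Bs \<le> length Cs" using card_image_le[of "{..<length Cs}" \<tau>] \<tau>(1) by simp
  moreover have "length Cs \<le> length Bs" using card_image_le[of "{..<length Bs}" \<sigma>] \<sigma>(1) by simp
  ultimately have len: "length Bs = length Cs" by simp
  have it: "inj_on \<tau> {..<length Cs}" using \<tau>(1) len by (intro eq_card_imp_inj_on) auto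
  have isg: "inj_on \<sigma> {..<length Bs}" using \<sigma>(1) len by (intro eq_card_imp_inj_on) auto
  have rt: "(\<Sum>k<length Cs. card (Bs ! \<tau> k)) = CARD('a)"
    using sum.reindex[OF it, of "\<lambda>j. card (Bs ! j)"] \<tau>(1) sum_card_blocks[OF B(1)] by (simp add: o_def)
  have rs: "(\<Sum>k<length Bs. card (Cs ! \<sigma> k)) = CARD('b)"
    using sum.reindex[OF isg, of "\<lambda>j. card (Cs ! j)"] \<sigma>(1) sum_card_blocks[OF C(1)] by (simp add: o_def)
  have le: "card (Bs ! \<tau> k) \<le> card (Cs ! k)" if "k < length Cs" for k using \<tau>(2) it that by blast
  \<comment> \<open>The inequalities for \<open>\<sigma>\<close> enter only through their sum, which
    excludes a strict inequality for \<open>\<tau>\<close>.\<close>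
  have "CARD('b) \<le> CARD('a)"
    unfolding rs[symmetric] sum_card_blocks[OF B(1), symmetric] using \<sigma>(2) isg by (intro sum_mono) auto
  hence eq: "card (Bs ! \<tau> k) = card (Cs ! k)" if "k < length Cs" for k
  proof -
    have "(\<Sum>k<length Cs. card (Cs ! k) - card (Bs ! \<tau> k)) = CARD('b) - CARD('a)"
      using le sum_subtractf_nat[of "{..<length Cs}" "\<lambda>k. card (Bs ! \<tau> k)" "\<lambda>k. card (Cs ! k)"]
      by (simp add: rt sum_card_blocks[OF C(1)])
    hence "card (Cs ! k) - card (Bs ! \<tau> k) = 0" using \<open>CARD('b) \<le> CARD('a)\<close> that by simp
    thus ?thesis using le[OF that] by simp
  qed
  have "mset (map card Cs) = image_mset (\<lambda>k. card (Cs ! k)) (mset_set {..<length Cs})"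
    by (rule mset_map_nth)
  also have "\<dots> = image_mset (\<lambda>k. card (Bs ! \<tau> k)) (mset_set {..<length Cs})"
  proof (rule image_mset_cong)
    fix k assume "k \<in># mset_set {..<length Cs}"
    hence "k < length Cs" by simp
    thus "card (Cs ! k) = card (Bs ! \<tau> k)" by (rule eq[symmetric])
  qed
  also have "\<dots> = image_mset (\<lambda>j. card (Bs ! j)) (image_mset \<tau> (mset_set {..<length Cs}))"
    unfolding image_mset.compositionality o_def ..
  also have "image_mset \<tau> (mset_set {..<length Cs}) = mset_set {..<length Bs}"
    using image_mset_mset_set[OF it] \<tau>(1) by simp
  also have "image_mset (\<lambda>j. card (Bs ! j)) (mset_set {..<length Bs}) = mset (map card Bs)"
    by (rule mset_map_nth[symmetric])
  finally have "mset (map card Bs) = mset (map card Cs)" by (rule sym)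
  from properties_for_sort[OF this B(2)] C(2) show ?thesis by (simp add: sorted_sort_id)
qed

theorem mainTheorem5:
  fixes P :: "'a::finite \<Rightarrow> 'a \<Rightarrow> real" and Q :: "'b::finite \<Rightarrow> 'b \<Rightarrow> real"
    and Bs :: "'a set list" and Cs :: "'b set list"
  assumes "stochastic P" and "essential P" and "stochastic Q" and "essential Q"
    and "irred_block_decomp P Bs" and "irred_block_decomp Q Cs"
  shows "cp_isomorphic P Q \<longleftrightarrow>
           length Bs = length Cs \<and> (\<forall>k<length Bs. card (Bs ! k) = card (Cs ! k))"
proof -
  obtain r s where A: "phased P (same_block Bs) r s" using phased_exists[OF assms(1,5)] by blast
  obtain r' s' where B: "phased Q (same_block Cs) r' s'" using phased_exists[OF assms(3,6)] by blast
  note bl = blocks_irred[OF assms(5)] blocks_irred[OF assms(6)]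
  note eq = equivp_same_block[OF assms(5)] equivp_same_block[OF assms(6)]
  note cl = phased.star_closed_lclosure[OF A] phased.star_closed_lclosure[OF B]
  have so: "sorted (map card Bs)" "sorted (map card Cs)"
    using assms(5,6) by (simp_all add: irred_block_decomp_def)
  show ?thesis
    unfolding cp_isomorphic_iff[OF A B]
  proof
    assume "\<exists>\<Psi>. star_iso (lclosure (same_block Bs)) (lclosure (same_block Cs)) \<Psi>"
    then obtain \<Psi> where i: "star_iso (lclosure (same_block Bs)) (lclosure (same_block Cs)) \<Psi>" by blast
    obtain \<tau> where \<tau>: "\<tau> ` {..<length Cs} = {..<length Bs}"
      "inj_on \<tau> {..<length Cs} \<longrightarrow> (\<forall>k<length Cs. card (Bs ! \<tau> k) \<le> card (Cs ! k))"
      using star_iso_block_map[OF bl eq cl(1) i] by blast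
    \<comment> \<open>The inverse isomorphism is treated as well, because \<open>\<tau>\<close>
      alone yields size bounds only once it is known to be injective.\<close>
    obtain \<sigma> where \<sigma>: "\<sigma> ` {..<length Bs} = {..<length Cs}"
      "inj_on \<sigma> {..<length Bs} \<longrightarrow> (\<forall>k<length Bs. card (Cs ! \<sigma> k) \<le> card (Bs ! k))"
      using star_iso_block_map[OF bl(2,1) eq(2,1) cl(2) star_iso_inverse[OF i cl(1)]] by blast
    have e: "map card Bs = map card Cs" by (rule sorted_blocks_eq[OF bl(1) so(1) bl(2) so(2) \<tau> \<sigma>])
    hence l: "length Bs = length Cs" by (metis length_map)
    have "card (Bs ! k) = card (Cs ! k)" if "k < length Bs" for k
      using arg_cong[OF e, of "\<lambda>xs. xs ! k"] that l by simp
    thus "length Bs = length Cs \<and> (\<forall>k<length Bs. card (Bs ! k) = card (Cs ! k))" using l by blast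
  next
    assume "length Bs = length Cs \<and> (\<forall>k<length Bs. card (Bs ! k) = card (Cs ! k))"
    then obtain g where g: "bij g" "\<And>a b. same_block Cs a b \<longleftrightarrow> same_block Bs (g a) (g b)"
      using block_bijection[OF bl] by blast
    show "\<exists>\<Psi>. star_iso (lclosure (same_block Bs)) (lclosure (same_block Cs)) \<Psi>"
      using relabel_star_iso[of g "same_block Cs" "same_block Bs"] g by blast
  qed
qed

end
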